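(* Let $(\phi,k)$ be an instance of $\textsc{WSAT}(\Gamma^{-}_{1,2})$, and let $m$ be such that $\max\{\mathrm{var}(\phi),\mathrm{cl}(\phi)\}\le 2^{m}$. Then there is an $(m\log m,\, m\log m)$-restricted probabilistic FPT-time Turing machine (verifier) with access to a proof string that rejects $(\phi,k)$ with high probability if $(\phi,k)$ is a No-instance of $\textsc{WSAT}(\Gamma^{-}_{1,2})$. That is, $\textsc{WSAT}(\Gamma^{-}_{1,2})\in p\text{-PCP}(m\log m,\, m\log m)$.
   Context: $\Gamma^{-}_{1,2}$ is the class of propositional formulas that are conjunctions of clauses, each clause being a disjunction of at most two literals, all of which are negated (i.e. 2-CNF formulas with only negative literals). $\mathrm{var}(\phi)$ and $\mathrm{cl}(\phi)$ denote the number of variables and clauses of $\phi$. A weight-$k$ assignment is a truth assignment setting exactly $k$ variables to TRUE. $\textsc{WSAT}(\Gamma^{-}_{1,2})$ is the parameterized problem: given $\phi\in\Gamma^{-}_{1,2}$ and a positive integer $k$ (the parameter), decide whether $\phi$ has a satisfying assignment of weight $k$. A parameterized PCP ($p$-PCP) for a parameterized problem $\Pi$ is a probabilistic Turing machine $V$ running in time $f(k)\cdot|x|^{O(1)}$ for some computable $f$ (FPT time) that, on input $(x,k)$ and with oracle access to a proof string $\sigma$, satisfies: if $(x,k)$ is a Yes-instance there is $\sigma$ such that $V^{\sigma}$ accepts with probability $1$; if $(x,k)$ is a No-instance then for every $\sigma$, $V^{\sigma}$ accepts with probability at most $1/2$. It is $(r,p)$-restricted if on every input it uses $O(r)$ random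 bits and reads $O(p)$ bits of $\sigma$; $p\text{-PCP}(r,p)$ denotes the class of problems having an $(r,p)$-restricted $p$-PCP. *)

theory Defs
  imports
    "HOL-Probability.Probability"
    "HOL-Library.Landau_Symbols"
    "HOL-Library.Log_Nat"
begin

section \<open>Total recursive functions\<close>

text \<open>
  \<open>recursive n F\<close>: on lists of length \<open>n\<close>, \<open>F\<close> is a total general recursive function of \<open>n\<close>
  arguments (closure of the basic functions under composition, primitive recursion and
  minimization of functions that have a zero everywhere).
\<close>

inductive recursive :: "nat \<Rightarrow> (nat list \<Rightarrow> nat) \<Rightarrow> bool" where
  zero: "recursive n (\<lambda>xs. 0)"
| succ: "recursive 1 (\<lambda>xs. Suc (xs ! 0))"
| proj: "i < n \<Longrightarrow> recursive n (\<lambda>xs. xs ! i)"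
| comp: "recursive (length hs) g \<Longrightarrow> (\<forall>h\<in>set hs. recursive n h) \<Longrightarrow>
    recursive n (\<lambda>xs. g (map (\<lambda>h. h xs) hs))"
| prec: "recursive n g \<Longrightarrow> recursive (n + 2) h \<Longrightarrow>
    recursive (n + 1) (\<lambda>xs. rec_nat (g (tl xs)) (\<lambda>y r. h (y # r # tl xs)) (hd xs))"
| mini: "recursive (n + 1) g \<Longrightarrow> (\<forall>xs. length xs = n \<longrightarrow> (\<exists>y. g (y # xs) = 0)) \<Longrightarrow>
    recursive n (\<lambda>xs. LEAST y. g (y # xs) = 0)"

definition computable :: "(nat \<Rightarrow> nat) \<Rightarrow> bool" where
  "computable f \<longleftrightarrow> (\<exists>F. recursive 1 F \<and> (\<forall>k. F [k] = f k))"

section \<open>Probabilistic oracle Turing machines\<close>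

datatype sym = Blank | Bit bool | Mark nat

datatype move = Left | Stay | Right

text \<open>
  \<open>Toss\<close> states obtain a fair random bit and \<open>Query\<close> states a bit of the proof string; this bit is
  passed to the transition function as its \<open>bool\<close> argument, which is \<open>False\<close> in \<open>Compute\<close>
  states. \<open>Halt True\<close> is accepting, \<open>Halt False\<close> rejecting.
\<close>

datatype mode = Compute | Toss | Query | Halt bool

record machine =
  states :: "nat set"
  start :: nat
  alphabet :: "sym set"
  tape_count :: nat
  mode :: "nat \<Rightarrow> mode"
  trans :: "nat \<Rightarrow> bool \<Rightarrow> sym list \<Rightarrow> nat \<times> (sym \<times> move) list"

text \<open>Tape 0 is the input tape and tape 1 the address tape for the proof string.\<close>

definition turing_machine :: "machine \<Rightarrow> bool" where
  "turing_machine V \<longleftrightarrow>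
     finite (states V) \<and> start V \<in> states V \<and>
     finite (alphabet V) \<and> {Blank, Bit False, Bit True} \<subseteq> alphabet V \<and>
     2 \<le> tape_count V \<and>
     (\<forall>q\<in>states V. \<forall>b as. length as = tape_count V \<and> set as \<subseteq> alphabet V \<longrightarrow>
        fst (trans V q b as) \<in> states V \<and>
        length (snd (trans V q b as)) = tape_count V \<and>
        fst ` set (snd (trans V q b as)) \<subseteq> alphabet V)"

type_synonym tape = "(int \<Rightarrow> sym) \<times> int"  \<comment> \<open>contents and head position\<close>

record config =
  state :: nat
  tapes :: "tape list"
  tosses :: nat
  queries :: nat

fun scan :: "tape \<Rightarrow> sym" where
  "scan (t, h) = t h"

fun shift :: "move \<Rightarrow> int" where
  "shift Left = -1"
| "shift Stay = 0"
| "shift Right = 1"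

fun act :: "tape \<Rightarrow> sym \<times> move \<Rightarrow> tape" where
  "act (t, h) (a, d) = (t(h := a), h + shift d)"

definition advance :: "machine \<Rightarrow> bool \<Rightarrow> config \<Rightarrow> config" where
  "advance V b c =
     (let (q, as) = trans V (state c) b (map scan (tapes c))
      in c\<lparr>state := q, tapes := map2 act (tapes c) as\<rparr>)"

text \<open>
  The address is the number written in binary, least significant bit first, in the maximal block
  of bits starting at cell 0 of the address tape.
\<close>

definition address :: "tape \<Rightarrow> nat" where
  "address t =
     horner_sum of_bool 2
       (map (\<lambda>i. fst t (int i) = Bit True) [0..<(LEAST i. fst t (int i) \<notin> range Bit)])"

text \<open>Cells beyond the end of the proof string read as \<open>False\<close>.\<close>

definition proof_bit :: "bool list \<Rightarrow> nat \<Rightarrow> bool" where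
  "proof_bit \<sigma> a \<longleftrightarrow> a < length \<sigma> \<and> \<sigma> ! a"

definition step :: "machine \<Rightarrow> bool list \<Rightarrow> config \<Rightarrow> config pmf" where
  "step V \<sigma> c =
     (case mode V (state c) of
        Compute \<Rightarrow> return_pmf (advance V False c)
      | Toss \<Rightarrow> map_pmf (\<lambda>b. (advance V b c)\<lparr>tosses := Suc (tosses c)\<rparr>) (bernoulli_pmf (1/2))
      | Query \<Rightarrow> return_pmf ((advance V (proof_bit \<sigma> (address (tapes c ! 1))) c)
                    \<lparr>queries := Suc (queries c)\<rparr>)
      | Halt _ \<Rightarrow> return_pmf c)"

definition input_tape :: "sym list \<Rightarrow> tape" where
  "input_tape w = ((\<lambda>i. if 0 \<le> i \<and> i < int (length w) then w ! nat i else Blank), 0)"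

definition initial :: "machine \<Rightarrow> sym list \<Rightarrow> config" where
  "initial V w =
     \<lparr>state = start V,
      tapes = input_tape w # replicate (tape_count V - 1) (input_tape []),
      tosses = 0, queries = 0\<rparr>"

primrec run :: "machine \<Rightarrow> bool list \<Rightarrow> sym list \<Rightarrow> nat \<Rightarrow> config pmf" where
  "run V \<sigma> w 0 = return_pmf (initial V w)"
| "run V \<sigma> w (Suc n) = bind_pmf (run V \<sigma> w n) (step V \<sigma>)"

definition halts_within :: "machine \<Rightarrow> bool list \<Rightarrow> sym list \<Rightarrow> nat \<Rightarrow> bool" where
  "halts_within V \<sigma> w n \<longleftrightarrow> (\<forall>c\<in>set_pmf (run V \<sigma> w n). \<exists>b. mode V (state c) = Halt b)"

definition tosses_at_most :: "machine \<Rightarrow> bool list \<Rightarrow> sym list \<Rightarrow> nat \<Rightarrow> bool" where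
  "tosses_at_most V \<sigma> w b \<longleftrightarrow> (\<forall>n. \<forall>c\<in>set_pmf (run V \<sigma> w n). tosses c \<le> b)"

definition queries_at_most :: "machine \<Rightarrow> bool list \<Rightarrow> sym list \<Rightarrow> nat \<Rightarrow> bool" where
  "queries_at_most V \<sigma> w b \<longleftrightarrow> (\<forall>n. \<forall>c\<in>set_pmf (run V \<sigma> w n). queries c \<le> b)"

text \<open>
  Halted configurations persist, so the probability below is nondecreasing in \<open>n\<close> and its
  supremum is the probability of ever accepting.
\<close>

definition accept_prob :: "machine \<Rightarrow> bool list \<Rightarrow> sym list \<Rightarrow> real" where
  "accept_prob V \<sigma> w =
     (SUP n. measure_pmf.prob (run V \<sigma> w n) {c. mode V (state c) = Halt True})"

section \<open>Parameterized problems and parameterized PCPs\<close>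

text \<open>The second component of an instance is its parameter.\<close>

record 'a param_problem =
  instances :: "('a \<times> nat) set"
  yes_instances :: "('a \<times> nat) set"
  encode :: "'a \<times> nat \<Rightarrow> sym list"

definition fpt_time :: "machine \<Rightarrow> 'a param_problem \<Rightarrow> bool" where
  "fpt_time V Q \<longleftrightarrow>
     (\<exists>f d. computable f \<and>
        (\<forall>(x, k)\<in>instances Q. \<forall>\<sigma>.
           halts_within V \<sigma> (encode Q (x, k)) (f k * length (encode Q (x, k)) ^ d)))"

definition p_pcp_verifier :: "machine \<Rightarrow> 'a param_problem \<Rightarrow> bool" where
  "p_pcp_verifier V Q \<longleftrightarrow>
     turing_machine V \<and>
     (\<forall>I\<in>instances Q. set (encode Q I) \<subseteq> alphabet V) \<and>
     fpt_time V Q \<and>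
     (\<forall>I\<in>instances Q.
        (I \<in> yes_instances Q \<longrightarrow> (\<exists>\<sigma>. accept_prob V \<sigma> (encode Q I) = 1)) \<and>
        (I \<notin> yes_instances Q \<longrightarrow> (\<forall>\<sigma>. accept_prob V \<sigma> (encode Q I) \<le> 1/2)))"

text \<open>The bounds \<open>r\<close> and \<open>p\<close> are functions of a numerical quantity \<open>\<mu> I\<close> attached to instances.\<close>

definition restricted ::
  "('a \<times> nat \<Rightarrow> nat) \<Rightarrow> (nat \<Rightarrow> real) \<Rightarrow> (nat \<Rightarrow> real) \<Rightarrow> machine \<Rightarrow> 'a param_problem \<Rightarrow> bool" where
  "restricted \<mu> r p V Q \<longleftrightarrow>
     (\<exists>g h :: nat \<Rightarrow> nat.
        (\<lambda>n. real (g n)) \<in> O(r) \<and> (\<lambda>n. real (h n)) \<in> O(p) \<and>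
        (\<forall>I\<in>instances Q. \<forall>\<sigma>.
           tosses_at_most V \<sigma> (encode Q I) (g (\<mu> I)) \<and>
           queries_at_most V \<sigma> (encode Q I) (h (\<mu> I))))"

definition p_PCP ::
  "('a \<times> nat \<Rightarrow> nat) \<Rightarrow> (nat \<Rightarrow> real) \<Rightarrow> (nat \<Rightarrow> real) \<Rightarrow> 'a param_problem set" where
  "p_PCP \<mu> r p = {Q. \<exists>V. p_pcp_verifier V Q \<and> restricted \<mu> r p V Q}"

section \<open>Weighted satisfiability\<close>

datatype literal = Pos nat | Neg nat

type_synonym cnf = "literal list list"

fun var_of :: "literal \<Rightarrow> nat" where
  "var_of (Pos x) = x"
| "var_of (Neg x) = x"

fun sat_literal :: "(nat \<Rightarrow> bool) \<Rightarrow> literal \<Rightarrow> bool" where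
  "sat_literal \<alpha> (Pos x) \<longleftrightarrow> \<alpha> x"
| "sat_literal \<alpha> (Neg x) \<longleftrightarrow> \<not> \<alpha> x"

definition satisfies :: "(nat \<Rightarrow> bool) \<Rightarrow> cnf \<Rightarrow> bool" where
  "satisfies \<alpha> \<phi> \<longleftrightarrow> (\<forall>C\<in>set \<phi>. \<exists>l\<in>set C. sat_literal \<alpha> l)"

definition vars :: "cnf \<Rightarrow> nat set" where
  "vars \<phi> = var_of ` (\<Union>C\<in>set \<phi>. set C)"

definition var_count :: "cnf \<Rightarrow> nat" where
  "var_count \<phi> = card (vars \<phi>)"

definition clause_count :: "cnf \<Rightarrow> nat" where
  "clause_count \<phi> = length \<phi>"

definition weight :: "cnf \<Rightarrow> (nat \<Rightarrow> bool) \<Rightarrow> nat" where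
  "weight \<phi> \<alpha> = card {x \<in> vars \<phi>. \<alpha> x}"

definition Gamma_neg_1_2 :: "cnf set" where
  "Gamma_neg_1_2 = {\<phi>. \<forall>C\<in>set \<phi>. length C \<le> 2 \<and> set C \<subseteq> range Neg}"

text \<open>
  A formula is written clause by clause; \<open>Mark 0\<close> opens a clause, \<open>Mark 1\<close> and \<open>Mark 2\<close> open a
  positive and a negative literal, and \<open>Mark 3\<close> precedes the parameter. Numbers are in binary,
  least significant bit first, without leading zeros.
\<close>

definition encode_nat :: "nat \<Rightarrow> sym list" where
  "encode_nat n = map (\<lambda>i. Bit (bit n i)) [0..<floorlog 2 n]"

fun encode_literal :: "literal \<Rightarrow> sym list" where
  "encode_literal (Pos x) = Mark 1 # encode_nat x"
| "encode_literal (Neg x) = Mark 2 # encode_nat x"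

definition encode_clause :: "literal list \<Rightarrow> sym list" where
  "encode_clause C = Mark 0 # concat (map encode_literal C)"

fun encode_instance :: "cnf \<times> nat \<Rightarrow> sym list" where
  "encode_instance (\<phi>, k) = concat (map encode_clause \<phi>) @ Mark 3 # encode_nat k"

definition WSAT :: "cnf set \<Rightarrow> cnf param_problem" where
  "WSAT \<Gamma> =
     \<lparr>instances = {(\<phi>, k). \<phi> \<in> \<Gamma> \<and> 0 < k},
      yes_instances = {(\<phi>, k). \<phi> \<in> \<Gamma> \<and> 0 < k \<and> (\<exists>\<alpha>. satisfies \<alpha> \<phi> \<and> weight \<phi> \<alpha> = k)},
      encode = encode_instance\<rparr>"

end

theory Submission
  imports Defs
begin

text \<open>
  Since the parameter enters the running time through an arbitrary computable function, no
  randomness is needed. Let \<open>L\<close> be the number of literal occurrences and \<open>h \<le> m + 2\<close> its length in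
  binary. Halving \<open>h\<close> up to \<open>k\<close> times, the machine learns that \<open>h < 2\<^sup>k\<close> or that \<open>2\<^sup>k\<^sup>-\<^sup>1 \<le> h\<close>. In
  the first case \<open>L\<close> is bounded in terms of \<open>k\<close> alone, and it tries all \<open>2\<^sup>L\<close> sets of occurrences.
  In the second case \<open>k \<le> 1 + log h\<close>, so that it can read \<open>k\<close> pointers of \<open>h\<close> bits each from the
  proof string with \<open>O(m log m)\<close> queries. In both cases it verifies that the chosen
  occurrences represent a satisfying assignment of weight \<open>k\<close>.
\<close>

section \<open>Zipper programs and their compilation to Turing machines\<close>

text \<open>The obstacle is a parameter that is large compared with \<open>m\<close>: reading
  \<open>k\<close> pointers would then exceed the query bound. In that case the parameter itself
  pays. From \<open>L < 2 ^ h\<close> and \<open>h < 2 ^ k\<close> there are fewer than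
  \<open>2 ^ 2 ^ 2 ^ k\<close> sets to try, a factor that FPT time allows. No positions or
  logarithms are computed. Marks on the tape serve as candidates, and a pass that discards every
  other candidate is the only arithmetic: it counts the occurrences in binary, compares
  \<open>h\<close> with a power of two, and, steered by one bit of a pointer per pass, isolates a
  single occurrence. Occurrences stand for variables because they can be marked in place. A variable
  may occur often, so the final check also has to reject sets that choose a variable twice. Since
  that check is complete, soundness assumes nothing about the proof string: whatever produced the
  set, an accepted one is a solution. Turing machines appear only once, as the target of a compiler
  for a small imperative language; time bounds are proved for its programs.\<close>

type_synonym zipper = "sym list \<times> sym list"

definition top_sym :: "sym list \<Rightarrow> sym" where
  "top_sym xs = (case xs of [] \<Rightarrow> Blank | x # _ \<Rightarrow> x)"

text \<open>Trailing blanks are not stored, so that a head that runs off the end and returns finds the same zipper.\<close>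

definition push :: "sym \<Rightarrow> sym list \<Rightarrow> sym list" where
  "push x xs = (if x = Blank \<and> xs = [] then [] else x # xs)"

fun zscan :: "zipper \<Rightarrow> sym" where
  "zscan (l, r) = top_sym r"

fun zact :: "zipper \<Rightarrow> sym \<times> move \<Rightarrow> zipper" where
  "zact (l, r) (a, Left) = (tl l, push (top_sym l) (push a (tl r)))"
| "zact (l, r) (a, Stay) = (l, push a (tl r))"
| "zact (l, r) (a, Right) = (push a l, tl r)"

definition sym_at :: "sym list \<Rightarrow> nat \<Rightarrow> sym" where
  "sym_at xs n = (if n < length xs then xs ! n else Blank)"

text \<open>The head scans the first symbol of \<open>r\<close>, and \<open>l\<close> lists the
  cells to its left, nearest first. The tape is blank beyond both lists.\<close>

fun represents :: "tape \<Rightarrow> zipper \<Rightarrow> bool" where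
  "represents (t, h) (l, r) \<longleftrightarrow>
     (\<forall>n. t (h + int n) = sym_at r n) \<and> (\<forall>n. t (h - 1 - int n) = sym_at l n)"

lemma top_sym_simps [simp]: "top_sym [] = Blank" "top_sym (x # xs) = x"
  by (simp_all add: top_sym_def)

lemma push_simps [simp]:
  "push x (y # ys) = x # y # ys" "push Blank [] = []" "x \<noteq> Blank \<Longrightarrow> push x xs = x # xs"
  by (simp_all add: push_def)

lemma top_sym_push [simp]: "top_sym (push x xs) = x"
  by (simp add: push_def)

lemma sym_at_0: "sym_at xs 0 = top_sym xs"
  by (cases xs) (simp_all add: sym_at_def)

lemma sym_at_push: "sym_at (push x xs) n = (case n of 0 \<Rightarrow> x | Suc m \<Rightarrow> sym_at xs m)"
  by (auto simp: sym_at_def push_def split: nat.split)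

lemma sym_at_tl: "sym_at (tl xs) n = sym_at xs (Suc n)"
  by (cases xs) (simp_all add: sym_at_def)

lemma represents_scan: "represents t z \<Longrightarrow> scan t = zscan z"
  by (cases t; cases z) (auto simp: sym_at_0[symmetric] dest: spec[of _ 0])

lemma represents_same: "represents t z \<Longrightarrow> represents (act t (scan t, Stay)) z"
  by (cases t; cases z) simp

lemma represents_act:
  assumes "represents t z"
  shows "represents (act t x) (zact z x)"
proof -
  obtain c h where t: "t = (c, h)" by (cases t)
  obtain l r where z: "z = (l, r)" by (cases z)
  obtain a d where x: "x = (a, d)" by (cases x)
  have R: "c (h + int n) = sym_at r n" and L: "c (h - 1 - int n) = sym_at l n" for n
    using assms by (auto simp: t z)
  show ?thesis
  proof (cases d)
    case Left
    have "(c(h := a)) (h - 1 + int n) = sym_at (push (top_sym l) (push a (tl r))) n" for n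
    proof (cases n)
      case 0
      then show ?thesis using L[of 0] by (simp add: sym_at_push sym_at_0)
    next
      case (Suc n')
      show ?thesis
      proof (cases n')
        case 0
        then show ?thesis using Suc by (simp add: sym_at_push)
      next
        case (Suc n'')
        have "c (h + int (Suc n'')) = sym_at r (Suc n'')" by (rule R)
        then show ?thesis using Suc \<open>n = Suc n'\<close>
          by (simp add: sym_at_push sym_at_tl algebra_simps)
      qed
    qed
    moreover have "(c(h := a)) (h - 1 - 1 - int n) = sym_at (tl l) n" for n
      using L[of "Suc n"] by (simp add: sym_at_tl algebra_simps)
    ultimately show ?thesis by (simp add: t z x Left)
  next
    case Stay
    have "(c(h := a)) (h + int n) = sym_at (push a (tl r)) n" for n
      using R[of n] by (cases n) (simp_all add: sym_at_push sym_at_tl)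
    moreover have "(c(h := a)) (h - 1 - int n) = sym_at l n" for n
      using L[of n] by simp
    ultimately show ?thesis by (simp add: t z x Stay)
  next
    case Right
    have "(c(h := a)) (h + 1 + int n) = sym_at (tl r) n" for n
      using R[of "Suc n"] by (simp add: sym_at_tl algebra_simps)
    moreover have "(c(h := a)) (h + 1 - 1 - int n) = sym_at (push a l) n" for n
    proof (cases n)
      case 0
      then show ?thesis by (simp add: sym_at_push)
    next
      case (Suc n')
      then show ?thesis using L[of n'] by (simp add: sym_at_push algebra_simps)
    qed
    ultimately show ?thesis by (simp add: t z x Right)
  qed
qed

section \<open>A structured language over zippers\<close>

type_synonym ops = "(nat \<times> (sym list \<Rightarrow> sym \<times> move)) list"

datatype prog =
    Do ops
  | Ask nat
  | Seq prog prog (infixr ";;" 60)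
  | Cond "sym list \<Rightarrow> bool" prog prog
  | Loop "sym list \<Rightarrow> bool" prog

definition zexec :: "ops \<Rightarrow> zipper list \<Rightarrow> zipper list" where
  "zexec os zs = map (\<lambda>i. case map_of os i of None \<Rightarrow> zs ! i
     | Some f \<Rightarrow> zact (zs ! i) (f (map zscan zs))) [0..<length zs]"

text \<open>\<open>ans q\<close> answers query number \<open>q\<close>, and the second component of
  the state counts the queries. The charges are those of the compiled code: 1 for a test, and 1 more
  where a jump over the else branch or back to the loop head is executed.\<close>

inductive exec :: "(nat \<Rightarrow> bool) \<Rightarrow> prog \<Rightarrow> zipper list \<times> nat \<Rightarrow> nat \<Rightarrow> zipper list \<times> nat \<Rightarrow> bool"
  for ans where
  Do: "exec ans (Do os) (zs, q) 1 (zexec os zs, q)"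
| Ask: "exec ans (Ask j) (zs, q) 1 (zexec [(j, \<lambda>_. (Bit (ans q), Stay))] zs, Suc q)"
| Seq: "exec ans p s t s' \<Longrightarrow> exec ans p' s' t' s'' \<Longrightarrow> exec ans (p ;; p') s (t + t') s''"
| CondT: "P (map zscan zs) \<Longrightarrow> exec ans p (zs, q) t s' \<Longrightarrow> exec ans (Cond P p p') (zs, q) (t + 2) s'"
| CondF: "\<not> P (map zscan zs) \<Longrightarrow> exec ans p' (zs, q) t s' \<Longrightarrow> exec ans (Cond P p p') (zs, q) (t + 1) s'"
| LoopT: "P (map zscan zs) \<Longrightarrow> exec ans p (zs, q) t s' \<Longrightarrow> exec ans (Loop P p) s' t' s'' \<Longrightarrow>
    exec ans (Loop P p) (zs, q) (t + t' + 2) s''"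
| LoopF: "\<not> P (map zscan zs) \<Longrightarrow> exec ans (Loop P p) (zs, q) 1 (zs, q)"

section \<open>Compilation to jump code and to machines\<close>

datatype instr =
    IDo ops
  | IAsk nat
  | IJump "sym list \<Rightarrow> bool" nat

fun code_length :: "prog \<Rightarrow> nat" where
  "code_length (Do os) = 1"
| "code_length (Ask j) = 1"
| "code_length (p ;; p') = code_length p + code_length p'"
| "code_length (Cond P p p') = code_length p + code_length p' + 2"
| "code_length (Loop P p) = code_length p + 2"

text \<open>\<open>IJump P t\<close> falls through if \<open>P\<close> holds and goes to
  \<open>t\<close> otherwise, so a constantly false test is an unconditional jump. Targets are
  absolute, whence the offset \<open>n\<close>.\<close>

fun compile :: "prog \<Rightarrow> nat \<Rightarrow> instr list" where
  "compile (Do os) n = [IDo os]"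
| "compile (Ask j) n = [IAsk j]"
| "compile (p ;; p') n = compile p n @ compile p' (n + code_length p)"
| "compile (Cond P p p') n =
     IJump P (n + code_length p + 2) # compile p (n + 1) @
     IJump (\<lambda>_. False) (n + code_length p + code_length p' + 2) #
     compile p' (n + code_length p + 2)"
| "compile (Loop P p) n =
     IJump P (n + code_length p + 2) # compile p (n + 1) @ [IJump (\<lambda>_. False) n]"

lemma length_compile [simp]: "length (compile p n) = code_length p"
  by (induction p arbitrary: n) auto

text \<open>Program counters become machine states, so this keeps the finite state set closed under
  transitions.\<close>

lemma compile_targets: "IJump P t \<in> set (compile p n) \<Longrightarrow> t \<le> n + code_length p"
  by (induction p arbitrary: n) fastforce+

text \<open>\<open>Ask\<close> writes a bit, which every machine alphabet contains, and tests write
  nothing; only \<open>Do\<close> can leave the alphabet.\<close>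

fun well_formed :: "nat \<Rightarrow> sym set \<Rightarrow> prog \<Rightarrow> bool" where
  "well_formed n A (Do os) \<longleftrightarrow>
     (\<forall>(j, f)\<in>set os. \<forall>as. length as = n \<and> set as \<subseteq> A \<longrightarrow> fst (f as) \<in> A)"
| "well_formed n A (Ask j) \<longleftrightarrow> True"
| "well_formed n A (p ;; p') \<longleftrightarrow> well_formed n A p \<and> well_formed n A p'"
| "well_formed n A (Cond P p p') \<longleftrightarrow> well_formed n A p \<and> well_formed n A p'"
| "well_formed n A (Loop P p) \<longleftrightarrow> well_formed n A p"

lemma compile_well_formed:
  "well_formed n A p \<Longrightarrow> IDo os \<in> set (compile p m) \<Longrightarrow> (j, f) \<in> set os \<Longrightarrow>
   length as = n \<Longrightarrow> set as \<subseteq> A \<Longrightarrow> fst (f as) \<in> A"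
  by (induction p arbitrary: m) fastforce+

definition outs :: "ops \<Rightarrow> sym list \<Rightarrow> (sym \<times> move) list" where
  "outs os as = map (\<lambda>i. case map_of os i of None \<Rightarrow> (as ! i, Stay) | Some f \<Rightarrow> f as) [0..<length as]"

text \<open>The machine has one tape more than the program: the address tape, in second position,
  which programs neither see nor number.\<close>

definition insert_second :: "'a \<Rightarrow> 'a list \<Rightarrow> 'a list" where
  "insert_second a xs = hd xs # a # tl xs"

definition delete_second :: "'a list \<Rightarrow> 'a list" where
  "delete_second xs = hd xs # tl (tl xs)"

lemma delete_insert_second: "xs \<noteq> [] \<Longrightarrow> delete_second (insert_second a xs) = xs"
  by (simp add: insert_second_def delete_second_def)

lemma map_insert_second: "xs \<noteq> [] \<Longrightarrow> map f (insert_second a xs) = insert_second (f a) (map f xs)"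
  by (cases xs) (simp_all add: insert_second_def)

lemma set_insert_second: "xs \<noteq> [] \<Longrightarrow> set (insert_second a xs) = insert a (set xs)"
  by (cases xs) (auto simp: insert_second_def)

lemma length_insert_second: "xs \<noteq> [] \<Longrightarrow> length (insert_second a xs) = Suc (length xs)"
  by (cases xs) (auto simp: insert_second_def)

text \<open>The last instruction turns the final tapes into a verdict: falling through leads to the
  accepting state just behind the code, jumping to the rejecting one after it.\<close>

definition machine_code :: "prog \<Rightarrow> (sym list \<Rightarrow> bool) \<Rightarrow> instr list" where
  "machine_code p P = compile p 0 @ [IJump P (code_length p + 2)]"

fun instr_trans :: "instr \<Rightarrow> nat \<Rightarrow> bool \<Rightarrow> sym list \<Rightarrow> nat \<times> (sym \<times> move) list" where
  "instr_trans (IDo os) q b as =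
     (Suc q, insert_second (as ! 1, Stay) (outs os (delete_second as)))"
| "instr_trans (IAsk j) q b as =
     (Suc q, insert_second (Bit True, Right) (outs [(j, \<lambda>_. (Bit b, Stay))] (delete_second as)))"
| "instr_trans (IJump P t) q b as =
     (if P (delete_second as) then Suc q else t, map (\<lambda>a. (a, Stay)) as)"

definition machine_of :: "nat \<Rightarrow> sym set \<Rightarrow> prog \<Rightarrow> (sym list \<Rightarrow> bool) \<Rightarrow> machine" where
  "machine_of n A p P =
     \<lparr>states = {..code_length p + 2}, start = 0, alphabet = A, tape_count = Suc n,
      mode = (\<lambda>q. if q < length (machine_code p P)
        then (case machine_code p P ! q of IAsk _ \<Rightarrow> Query | _ \<Rightarrow> Compute)
        else Halt (q = code_length p + 1)),
      trans = (\<lambda>q b as. if q < length (machine_code p P)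
        then instr_trans (machine_code p P ! q) q b as
        else (q, map (\<lambda>a. (a, Stay)) as))\<rparr>"

lemma machine_of_simps [simp]:
  "states (machine_of n A p P) = {..code_length p + 2}"
  "start (machine_of n A p P) = 0"
  "alphabet (machine_of n A p P) = A"
  "tape_count (machine_of n A p P) = Suc n"
  by (simp_all add: machine_of_def)

lemma length_outs [simp]: "length (outs os as) = length as"
  by (simp add: outs_def)

lemma length_zexec [simp]: "length (zexec os zs) = length zs"
  by (simp add: zexec_def)

lemma outs_in_alphabet:
  assumes "\<And>j f. (j, f) \<in> set os \<Longrightarrow> fst (f as) \<in> A" "set as \<subseteq> A"
  shows "fst ` set (outs os as) \<subseteq> A"
proof -
  have "fst (case map_of os i of None \<Rightarrow> (as ! i, Stay) | Some f \<Rightarrow> f as) \<in> A" if "i < length as" for i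
    using that assms(2) by (auto split: option.split dest: map_of_SomeD assms(1) nth_mem)
  then show ?thesis by (auto simp: outs_def)
qed

lemma turing_machine_machine_of:
  assumes wf: "well_formed n A p" and n: "1 \<le> n"
    and A: "finite A" "{Blank, Bit False, Bit True} \<subseteq> A"
  shows "turing_machine (machine_of n A p P)"
proof -
  let ?V = "machine_of n A p P"
  have "fst (trans ?V q b as) \<in> states ?V \<and> length (snd (trans ?V q b as)) = Suc n \<and>
    fst ` set (snd (trans ?V q b as)) \<subseteq> A"
    if q: "q \<in> states ?V" and as: "length as = Suc n" "set as \<subseteq> A" for q b as
  proof (cases "q < length (machine_code p P)")
    case False
    then show ?thesis using that by (auto simp: machine_of_def)
  next
    case True
    let ?as = "delete_second as"
    obtain a0 a1 as' where as_eq: "as = a0 # a1 # as'"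
      using as n by (cases as; cases "tl as") auto
    have len: "length ?as = n" "?as \<noteq> []" and sub: "set ?as \<subseteq> A" and a1: "as ! 1 \<in> A"
      using as by (auto simp: as_eq delete_second_def)
    have tr: "trans ?V q b as = instr_trans (machine_code p P ! q) q b as"
      using True by (simp add: machine_of_def)
    have mem: "machine_code p P ! q \<in> set (machine_code p P)"
      using True by simp
    have q': "q \<le> code_length p"
      using True by (simp add: machine_code_def)
    have ne: "outs os ?as \<noteq> []" for os
      using len by (metis length_0_conv length_outs)
    show ?thesis
    proof (cases "machine_code p P ! q")
      case (IDo os)
      then have "IDo os \<in> set (compile p 0)"
        using mem by (simp add: machine_code_def)
      then have "fst ` set (outs os ?as) \<subseteq> A"
        using compile_well_formed[OF wf] len sub by (intro outs_in_alphabet) blast+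
      then show ?thesis using tr IDo q' len ne a1
        by (simp add: set_insert_second length_insert_second)
    next
      case (IAsk j)
      have "fst ` set (outs [(j, \<lambda>_. (Bit b, Stay))] ?as) \<subseteq> A"
        using A sub by (intro outs_in_alphabet) (auto, (cases b; simp)+)
      then show ?thesis using tr IAsk q' len ne A
        by (simp add: set_insert_second length_insert_second)
    next
      case (IJump Q t)
      then have "t \<le> code_length p + 2"
        using mem compile_targets[of Q t p 0] by (auto simp: machine_code_def)
      then show ?thesis using tr IJump q' as by auto
    qed
  qed
  then show ?thesis using n A by (simp add: turing_machine_def)
qed

section \<open>Simulation of programs by the compiled machine\<close>

definition query_tape :: "nat \<Rightarrow> tape" where
  "query_tape q = ((\<lambda>i. if 0 \<le> i \<and> i < int q then Bit True else Blank), int q)"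

text \<open>Addresses are read least significant bit first, so a block of \<open>q\<close> ones
  denotes \<open>2 ^ q - 1\<close>. Fresh addresses thus cost one symbol per query and no binary
  counter. The proof string becomes exponentially long, but p-PCPs put no bound on its
  length.\<close>

lemma address_query_tape: "address (query_tape q) = 2 ^ q - 1"
proof -
  have "(LEAST i. fst (query_tape q) (int i) \<notin> range Bit) = q"
    by (rule Least_equality) (auto simp: query_tape_def not_less[symmetric])
  moreover have "map (\<lambda>i. fst (query_tape q) (int i) = Bit True) [0..<q] = replicate q True"
    by (rule nth_equalityI) (auto simp: query_tape_def)
  moreover have "horner_sum of_bool 2 (replicate q True) = (2 ^ q - 1 :: nat)"
  proof (induction q)
    case (Suc q)
    have "(2::nat) ^ q \<ge> 1" by simp
    then have "1 + 2 * (2 ^ q - 1) = (2 ^ Suc q - 1 :: nat)" unfolding power_Suc by linarith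
    then show ?case using Suc by (simp only: replicate_Suc horner_sum_simps of_bool_eq)
  qed simp
  ultimately show ?thesis by (simp add: address_def)
qed

lemma act_query_tape: "act (query_tape q) (Bit True, Right) = query_tape (Suc q)"
  by (auto simp: query_tape_def fun_eq_iff)

definition config_of :: "nat \<Rightarrow> zipper list \<times> nat \<Rightarrow> config \<Rightarrow> bool" where
  "config_of pc s c \<longleftrightarrow> state c = pc \<and> queries c = snd s \<and> tosses c = 0 \<and> fst s \<noteq> [] \<and>
     (\<exists>ts. tapes c = insert_second (query_tape (snd s)) ts \<and> list_all2 represents ts (fst s))"

lemma list_all2_scan: "list_all2 represents ts zs \<Longrightarrow> map scan ts = map zscan zs"
  by (induction rule: list_all2_induct) (auto dest: represents_scan)

lemma list_all2_exec:
  assumes "list_all2 represents ts zs"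
  shows "list_all2 represents (map2 act ts (outs os (map zscan zs))) (zexec os zs)"
proof (rule list_all2_all_nthI)
  have len: "length ts = length zs" using assms by (rule list_all2_lengthD)
  then show "length (map2 act ts (outs os (map zscan zs))) = length (zexec os zs)" by simp
  fix i assume "i < length (map2 act ts (outs os (map zscan zs)))"
  then have i: "i < length zs" by simp
  have r: "represents (ts ! i) (zs ! i)" using assms i by (simp add: list_all2_conv_all_nth)
  show "represents (map2 act ts (outs os (map zscan zs)) ! i) (zexec os zs ! i)"
    using i len represents_same[OF r] represents_act[OF r] represents_scan[OF r]
    by (auto simp: outs_def zexec_def split: option.split)
qed

lemma map2_insert_second:
  "xs \<noteq> [] \<Longrightarrow> ys \<noteq> [] \<Longrightarrow>
   map2 f (insert_second a xs) (insert_second b ys) = insert_second (f a b) (map2 f xs ys)"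
  by (cases xs; cases ys) (simp_all add: insert_second_def)

text \<open>Compiled machines have no \<open>Toss\<close> states, so every step distribution is a
  point mass and a run is the iteration of a function.\<close>

definition det_step :: "machine \<Rightarrow> bool list \<Rightarrow> config \<Rightarrow> config" where
  "det_step V \<sigma> c = (case mode V (state c) of
        Compute \<Rightarrow> advance V False c
      | Query \<Rightarrow> (advance V (proof_bit \<sigma> (address (tapes c ! 1))) c)
                    \<lparr>queries := Suc (queries c)\<rparr>
      | _ \<Rightarrow> c)"

lemma step_machine_of: "step (machine_of n A p P) \<sigma> c = return_pmf (det_step (machine_of n A p P) \<sigma> c)"
  by (auto simp: step_def det_step_def machine_of_def split: mode.split instr.split if_splits)

text \<open>Each query extends the block of ones on the address tape, so no address is used twice.\<close>

definition answers :: "bool list \<Rightarrow> nat \<Rightarrow> bool" where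
  "answers \<sigma> q = proof_bit \<sigma> (2 ^ q - 1)"

lemma det_step_IDo:
  assumes "config_of pc (zs, q) c" "pc < length (machine_code p P)" "machine_code p P ! pc = IDo os"
  shows "config_of (Suc pc) (zexec os zs, q) (det_step (machine_of n A p P) \<sigma> c)"
proof -
  obtain ts where ts: "tapes c = insert_second (query_tape q) ts" "list_all2 represents ts zs"
    using assms(1) by (auto simp: config_of_def)
  have ne: "zs \<noteq> []" "ts \<noteq> []" using assms(1) ts(2) by (auto simp: config_of_def)
  have sc: "map scan (tapes c) = insert_second (scan (query_tape q)) (map zscan zs)"
    using ts ne list_all2_scan by (simp add: map_insert_second)
  have ne': "outs os (map zscan zs) \<noteq> []" using ne by (metis length_0_conv length_map length_outs)
  have q1: "insert_second (scan (query_tape q)) (map zscan zs) ! 1 = scan (query_tape q)"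
    by (simp add: insert_second_def)
  have same: "act (query_tape q) (scan (query_tape q), Stay) = query_tape q"
    by (auto simp: query_tape_def)
  show ?thesis
    using assms ts ne ne' sc same q1 list_all2_exec[OF ts(2), of os]
    by (auto simp: config_of_def det_step_def advance_def machine_of_def delete_insert_second
        map2_insert_second simp del: One_nat_def intro!: exI[of _ "map2 act ts (outs os (map zscan zs))"])
qed

lemma det_step_IAsk:
  assumes "config_of pc (zs, q) c" "pc < length (machine_code p P)" "machine_code p P ! pc = IAsk j"
  shows "config_of (Suc pc) (zexec [(j, \<lambda>_. (Bit (answers \<sigma> q), Stay))] zs, Suc q)
           (det_step (machine_of n A p P) \<sigma> c)"
proof -
  let ?os = "[(j, \<lambda>_. (Bit (answers \<sigma> q), Stay))]"
  obtain ts where ts: "tapes c = insert_second (query_tape q) ts" "list_all2 represents ts zs"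
    using assms(1) by (auto simp: config_of_def)
  have ne: "zs \<noteq> []" "ts \<noteq> []" using assms(1) ts(2) by (auto simp: config_of_def)
  have sc: "map scan (tapes c) = insert_second (scan (query_tape q)) (map zscan zs)"
    using ts ne list_all2_scan by (simp add: map_insert_second)
  have ne': "outs ?os (map zscan zs) \<noteq> []" using ne by (metis length_0_conv length_map length_outs)
  have t1: "tapes c ! 1 = query_tape q" using ts by (simp add: insert_second_def)
  have bit: "proof_bit \<sigma> (address (tapes c ! 1)) = answers \<sigma> q"
    by (simp only: t1 address_query_tape answers_def)
  show ?thesis
    using assms ts ne ne' sc bit list_all2_exec[OF ts(2), of ?os]
    by (auto simp: config_of_def det_step_def advance_def machine_of_def delete_insert_second
        map2_insert_second act_query_tape simp del: One_nat_def act.simps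
        intro!: exI[of _ "map2 act ts (outs ?os (map zscan zs))"])
qed

lemma det_step_IJump:
  assumes "config_of pc (zs, q) c" "pc < length (machine_code p P)" "machine_code p P ! pc = IJump Q t"
  shows "config_of (if Q (map zscan zs) then Suc pc else t) (zs, q) (det_step (machine_of n A p P) \<sigma> c)"
proof -
  obtain ts where ts: "tapes c = insert_second (query_tape q) ts" "list_all2 represents ts zs"
    using assms(1) by (auto simp: config_of_def)
  have ne: "zs \<noteq> []" "ts \<noteq> []" using assms(1) ts(2) by (auto simp: config_of_def)
  have sc: "map scan (tapes c) = insert_second (scan (query_tape q)) (map zscan zs)"
    using ts ne list_all2_scan by (simp add: map_insert_second)
  have same: "map2 act us (map (\<lambda>a. (a, Stay)) (map scan us)) = us" for us
    by (induction us) auto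
  show ?thesis
    using assms ts ne sc same[of "tapes c"]
    by (auto simp: config_of_def det_step_def advance_def machine_of_def delete_insert_second)
qed

text \<open>The fragment may stand anywhere in the code: \<open>us\<close> and \<open>vs\<close> are
  its surroundings, and \<open>length us = pc\<close> makes the absolute targets right. A loop jumps
  back to the same \<open>pc\<close> in the same surroundings, so the second induction hypothesis
  applies there.\<close>

lemma exec_compile:
  assumes "exec (answers \<sigma>) p' s t s'" "config_of pc s c"
    "machine_code p P = us @ compile p' pc @ vs" "length us = pc"
  shows "config_of (pc + code_length p') s' ((det_step (machine_of n A p P) \<sigma> ^^ t) c)"
  using assms
proof (induction arbitrary: pc c us vs rule: exec.induct)
  case (Do os zs q)
  then show ?case
    using det_step_IDo[OF Do(1), of p P os n A \<sigma>] by (simp add: nth_append)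
next
  case (Ask j zs q)
  then show ?case
    using det_step_IAsk[OF Ask(1), of p P j \<sigma> n A] by (simp add: nth_append)
next
  case (Seq p1 s t s' p2 t' s'')
  let ?F = "det_step (machine_of n A p P) \<sigma>"
  have "config_of (pc + code_length p1) s' ((?F ^^ t) c)"
    using Seq.prems by (intro Seq.IH(1)) auto
  then have "config_of (pc + code_length p1 + code_length p2) s'' ((?F ^^ t') ((?F ^^ t) c))"
    using Seq.prems by (intro Seq.IH(2)[where us = "us @ compile p1 pc"]) auto
  then show ?case by (simp add: funpow_add add.commute[of t] add.assoc)
next
  case (CondT Q zs p1 q t s' p2)
  let ?F = "det_step (machine_of n A p P) \<sigma>"
  have "config_of (Suc pc) (zs, q) (?F c)"
    using det_step_IJump[OF CondT.prems(1), of p P Q "pc + code_length p1 + 2" n A \<sigma>] CondT.prems CondT.hyps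
    by (simp add: nth_append)
  then have "config_of (Suc pc + code_length p1) s' ((?F ^^ t) (?F c))"
    using CondT.prems
    by (intro CondT.IH[where us = "us @ [IJump Q (pc + code_length p1 + 2)]"]) auto
  then have "config_of (pc + code_length p1 + code_length p2 + 2) s' (?F ((?F ^^ t) (?F c)))"
    using det_step_IJump[of "Suc pc + code_length p1" "fst s'" "snd s'" "(?F ^^ t) (?F c)" p P "\<lambda>_. False"
        "pc + code_length p1 + code_length p2 + 2" n A \<sigma>] CondT.prems
    by (simp add: nth_append)
  moreover have "(?F ^^ (t + 2)) c = ?F ((?F ^^ t) (?F c))"
    by (simp add: funpow_swap1)
  ultimately show ?case by (simp add: add_ac)
next
  case (CondF Q zs p2 q t s' p1)
  let ?F = "det_step (machine_of n A p P) \<sigma>"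
  have "config_of (pc + code_length p1 + 2) (zs, q) (?F c)"
    using det_step_IJump[OF CondF.prems(1), of p P Q "pc + code_length p1 + 2" n A \<sigma>] CondF.prems CondF.hyps
    by (simp add: nth_append)
  then have "config_of (pc + code_length p1 + 2 + code_length p2) s' ((?F ^^ t) (?F c))"
    using CondF.prems
    by (intro CondF.IH[where us = "us @ IJump Q (pc + code_length p1 + 2) # compile p1 (pc + 1) @
        [IJump (\<lambda>_. False) (pc + code_length p1 + code_length p2 + 2)]"]) auto
  moreover have "(?F ^^ (t + 1)) c = (?F ^^ t) (?F c)"
    by (simp add: funpow_swap1)
  ultimately show ?case by (simp add: add_ac)
next
  case (LoopT Q zs p1 q t s' t' s'')
  let ?F = "det_step (machine_of n A p P) \<sigma>"
  have "config_of (Suc pc) (zs, q) (?F c)"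
    using det_step_IJump[OF LoopT.prems(1), of p P Q "pc + code_length p1 + 2" n A \<sigma>] LoopT.prems LoopT.hyps
    by (simp add: nth_append)
  then have "config_of (Suc pc + code_length p1) s' ((?F ^^ t) (?F c))"
    using LoopT.prems
    by (intro LoopT.IH(1)[where us = "us @ [IJump Q (pc + code_length p1 + 2)]"]) auto
  then have "config_of pc s' (?F ((?F ^^ t) (?F c)))"
    using det_step_IJump[of "Suc pc + code_length p1" "fst s'" "snd s'" "(?F ^^ t) (?F c)" p P "\<lambda>_. False"
        pc n A \<sigma>] LoopT.prems
    by (simp add: nth_append)
  then have "config_of (pc + code_length (Loop Q p1)) s'' ((?F ^^ t') (?F ((?F ^^ t) (?F c))))"
    using LoopT.prems by (intro LoopT.IH(2)) auto
  moreover have "(?F ^^ (t + t' + 2)) c = (?F ^^ t') (?F ((?F ^^ t) (?F c)))"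
    by (simp add: funpow_add funpow_swap1 add.commute[of t])
  ultimately show ?case by simp
next
  case (LoopF Q zs p1 q)
  then show ?case
    using det_step_IJump[OF LoopF.prems(1), of p P Q "pc + code_length p1 + 2" n A \<sigma>]
    by (simp add: nth_append)
qed

lemma represents_input_tape: "represents (input_tape w) ([], w)"
  by (simp add: input_tape_def sym_at_def)

lemma query_tape_0: "query_tape 0 = input_tape []"
  by (simp add: query_tape_def input_tape_def cong: if_cong) (auto simp: fun_eq_iff)

lemma config_of_initial:
  assumes "1 \<le> n"
  shows "config_of 0 (([], w) # replicate (n - 1) ([], []), 0) (initial (machine_of n A p P) w)"
proof -
  let ?ts = "input_tape w # replicate (n - 1) (input_tape [])"
  have "list_all2 represents ?ts (([], w) # replicate (n - 1) ([], []))"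
    by (auto simp: represents_input_tape list_all2_conv_all_nth nth_Cons split: nat.split)
  moreover have "replicate n x = x # replicate (n - 1) x" for x :: tape
    using assms by (cases n) auto
  ultimately show ?thesis using assms
    by (auto simp: config_of_def initial_def query_tape_0 insert_second_def intro!: exI[of _ ?ts])
qed

lemma run_machine_of:
  "run (machine_of n A p P) \<sigma> w t =
     return_pmf ((det_step (machine_of n A p P) \<sigma> ^^ t) (initial (machine_of n A p P) w))"
  by (induction t) (simp_all add: bind_return_pmf step_machine_of)

lemma queries_det_step: "queries c \<le> queries (det_step V \<sigma> c)"
  by (auto simp: det_step_def advance_def split: mode.split prod.split)

lemma tosses_det_step: "tosses (det_step V \<sigma> c) = tosses c"
  by (auto simp: det_step_def advance_def split: mode.split prod.split)

text \<open>After the \<open>t\<close> steps of the program one more step performs the final test,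
  hence \<open>t < T\<close>. From then on the configuration is fixed, so the acceptance probability
  is 0 or 1.\<close>

lemma machine_of_correct:
  fixes n A p P w \<sigma>
  defines "V \<equiv> machine_of n A p P"
  assumes n: "1 \<le> n"
    and ex: "exec (answers \<sigma>) p (([], w) # replicate (n - 1) ([], []), 0) t (zs, q)"
  shows "t < T \<Longrightarrow> halts_within V \<sigma> w T"
    and "tosses_at_most V \<sigma> w b"
    and "queries_at_most V \<sigma> w q"
    and "accept_prob V \<sigma> w = of_bool (P (map zscan zs))"
proof -
  let ?F = "det_step V \<sigma>" and ?c = "initial V w"
  let ?pc = "if P (map zscan zs) then Suc (code_length p) else code_length p + 2"
  have "config_of (0 + code_length p) (zs, q) ((?F ^^ t) ?c)"
    unfolding V_def using config_of_initial[OF n]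
    by (intro exec_compile[OF ex, where us = "[]"]) (auto simp: machine_code_def)
  then have "config_of ?pc (zs, q) (?F ((?F ^^ t) ?c))"
    unfolding V_def by (intro det_step_IJump) (auto simp: machine_code_def nth_append)
  then have fin: "state ((?F ^^ Suc t) ?c) = ?pc" "queries ((?F ^^ Suc t) ?c) = q"
    by (auto simp: config_of_def)
  have mode: "mode V ?pc = Halt (P (map zscan zs))"
    by (simp add: V_def machine_of_def machine_code_def)
  have stay: "(?F ^^ (Suc t + d)) ?c = (?F ^^ Suc t) ?c" for d
  proof (induction d)
    case (Suc d)
    have "(?F ^^ (Suc t + Suc d)) ?c = ?F ((?F ^^ (Suc t + d)) ?c)" by simp
    also have "\<dots> = ?F ((?F ^^ Suc t) ?c)" by (simp only: Suc)
    also have "\<dots> = (?F ^^ Suc t) ?c"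
      using fin mode by (simp add: det_step_def)
    finally show ?case .
  qed simp
  have after: "(?F ^^ i) ?c = (?F ^^ Suc t) ?c" if "t < i" for i
    using stay[of "i - Suc t"] that by simp
  have run: "run V \<sigma> w i = return_pmf ((?F ^^ i) ?c)" for i
    unfolding V_def by (rule run_machine_of)
  show "halts_within V \<sigma> w T" if "t < T"
    using after[OF that] fin mode by (simp add: halts_within_def run del: funpow.simps)
  have "tosses ((?F ^^ i) ?c) = 0" for i
    by (induction i) (simp_all add: tosses_det_step initial_def)
  then show "tosses_at_most V \<sigma> w b"
    by (simp add: tosses_at_most_def run)
  \<comment> \<open>The query counter never decreases, so its final value \<open>q\<close> bounds it
    at all times.\<close>
  have "queries ((?F ^^ i) ?c) \<le> queries ((?F ^^ (i + d)) ?c)" for i d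
    by (induction d) (auto intro: order_trans queries_det_step)
  then have "queries ((?F ^^ i) ?c) \<le> queries ((?F ^^ (i + Suc t)) ?c)" for i .
  then have "queries ((?F ^^ i) ?c) \<le> q" for i
    using fin(2) after[of "i + Suc t"] by (metis less_add_Suc2 add.commute add_Suc_right less_iff_Suc_add)
  then show "queries_at_most V \<sigma> w q"
    by (simp add: queries_at_most_def run)
  show "accept_prob V \<sigma> w = of_bool (P (map zscan zs))"
  proof -
    let ?p = "\<lambda>i. measure_pmf.prob (run V \<sigma> w i) {c. mode V (state c) = Halt True}"
    have val: "?p i = of_bool (mode V (state ((?F ^^ i) ?c)) = Halt True)" for i
      by (simp add: run measure_return_pmf indicator_def)
    have top: "?p (Suc t) = of_bool (P (map zscan zs))"
      unfolding val using fin mode by simp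
    have "?p i \<le> of_bool (P (map zscan zs))" for i
    proof (cases "P (map zscan zs)")
      case False
      have "mode V (state ((?F ^^ i) ?c)) \<noteq> Halt True"
      proof
        assume a: "mode V (state ((?F ^^ i) ?c)) = Halt True"
        \<comment> \<open>A halting configuration is a fixed point of \<open>?F\<close>, so
          accepting at any time \<open>i\<close> would make the final configuration
          accepting.\<close>
        have "(?F ^^ (i + d)) ?c = (?F ^^ i) ?c" for d
        proof (induction d)
          case (Suc d)
          have "(?F ^^ (i + Suc d)) ?c = ?F ((?F ^^ (i + d)) ?c)" by simp
          also have "\<dots> = ?F ((?F ^^ i) ?c)" by (simp only: Suc)
          also have "\<dots> = (?F ^^ i) ?c" by (simp only: det_step_def a mode.case)
          finally show ?case .
        qed simp
        from this[of "Suc t"] after[of "i + Suc t"] have "(?F ^^ i) ?c = (?F ^^ Suc t) ?c"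
          by (simp del: funpow.simps)
        then show False using a fin mode False by simp
      qed
      then show ?thesis unfolding val by simp
    qed simp
    then show ?thesis
      unfolding accept_prob_def
      by (intro cSup_eq_maximum) (use top in \<open>auto intro: rev_image_eqI[of "Suc t"]\<close>)
  qed
qed

section \<open>Executing programs in bounded time\<close>

text \<open>An upper bound replaces the exact step count, so that estimates can be rounded at every
  composition.\<close>

definition runs :: "(nat \<Rightarrow> bool) \<Rightarrow> prog \<Rightarrow> zipper list \<times> nat \<Rightarrow> zipper list \<times> nat \<Rightarrow> nat \<Rightarrow> bool" where
  "runs ans p s s' T \<longleftrightarrow> (\<exists>t\<le>T. exec ans p s t s')"

lemma runs_Do: "zexec os zs = zs' \<Longrightarrow> 1 \<le> T \<Longrightarrow> runs ans (Do os) (zs, q) (zs', q) T"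
  unfolding runs_def using exec.Do by blast

lemma runs_Ask:
  "zexec [(j, \<lambda>_. (Bit (ans q), Stay))] zs = zs' \<Longrightarrow> 1 \<le> T \<Longrightarrow> runs ans (Ask j) (zs, q) (zs', Suc q) T"
  unfolding runs_def using exec.Ask by blast

lemma runs_Seq:
  "runs ans p s s' U \<Longrightarrow> runs ans p' s' s'' V \<Longrightarrow> U + V \<le> T \<Longrightarrow> runs ans (p ;; p') s s'' T"
proof -
  assume "runs ans p s s' U" "runs ans p' s' s'' V" "U + V \<le> T"
  then obtain t u where t: "t \<le> U" "exec ans p s t s'" "u \<le> V" "exec ans p' s' u s''"
    by (auto simp: runs_def)
  then have "t + u \<le> T" using \<open>U + V \<le> T\<close> by linarith
  then show ?thesis using exec.Seq[OF t(2,4)] by (auto simp: runs_def)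
qed

lemmas runs_Seqs = runs_Seq[OF _ _ order_refl]

lemma runs_CondT:
  "P (map zscan zs) \<Longrightarrow> runs ans p (zs, q) s' U \<Longrightarrow> U + 2 \<le> T \<Longrightarrow> runs ans (Cond P p p') (zs, q) s' T"
  unfolding runs_def by (metis exec.CondT add_le_mono1 le_trans)

lemma runs_CondF:
  "\<not> P (map zscan zs) \<Longrightarrow> runs ans p' (zs, q) s' U \<Longrightarrow> U + 1 \<le> T \<Longrightarrow> runs ans (Cond P p p') (zs, q) s' T"
  unfolding runs_def by (metis exec.CondF add_le_mono1 le_trans)

lemma runs_LoopT:
  assumes "P (map zscan zs)" "runs ans p (zs, q) s' U" "runs ans (Loop P p) s' s'' V" "U + V + 2 \<le> T"
  shows "runs ans (Loop P p) (zs, q) s'' T"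
proof -
  obtain t1 t2 where t: "t1 \<le> U" "exec ans p (zs, q) t1 s'" "t2 \<le> V" "exec ans (Loop P p) s' t2 s''"
    using assms(2,3) by (auto simp: runs_def)
  have "exec ans (Loop P p) (zs, q) (t1 + t2 + 2) s''"
    using assms(1) t by (intro exec.LoopT)
  moreover have "t1 + t2 + 2 \<le> T" using t assms(4) by linarith
  ultimately show ?thesis by (auto simp: runs_def)
qed

lemma runs_LoopF: "\<not> P (map zscan zs) \<Longrightarrow> 1 \<le> T \<Longrightarrow> runs ans (Loop P p) (zs, q) (zs, q) T"
  unfolding runs_def using exec.LoopF by blast

text \<open>A loop around one instruction costs 3 steps per round (test, action, jump back) and 1
  for the last test. This is the source of the bounds \<open>3 * length xs + 1\<close>
  below.\<close>

lemma runs_LoopDo: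
  "P (map zscan zs) \<Longrightarrow> runs ans (Loop P (Do os)) (zexec os zs, q) s' U \<Longrightarrow> U + 3 \<le> T \<Longrightarrow>
   runs ans (Loop P (Do os)) (zs, q) s' T"
  by (rule runs_LoopT[OF _ runs_Do[OF refl order_refl]]) auto

lemma zexec_Nil [simp]: "zexec [] zs = zs"
  by (simp add: zexec_def map_nth)

lemma zexec_Cons [simp]:
  "zexec ((j, f) # os) zs = (zexec os zs)[j := zact (zs ! j) (f (map zscan zs))]"
  by (rule nth_equalityI) (auto simp: zexec_def nth_list_update)

text \<open>\<open>[Blank]\<close> is the one list that changes when its first cell is rewritten
  with its own symbol, because \<open>push\<close> does not store a lone blank. Hence the side
  conditions \<open>r \<noteq> [Blank]\<close> below.\<close>

lemma push_top_tl [simp]: "r \<noteq> [Blank] \<Longrightarrow> push (top_sym r) (tl r) = r"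
  by (cases r) (auto simp: push_def)

definition reg :: "sym \<Rightarrow> zipper" where
  "reg x = ([], push x [])"

abbreviation flag :: "bool \<Rightarrow> zipper" where
  "flag b \<equiv> reg (Bit b)"

abbreviation unary :: "nat \<Rightarrow> sym list" where
  "unary n \<equiv> replicate n (Mark 0)"

lemma zscan_reg [simp]: "zscan (reg x) = x"
  by (simp add: reg_def)

lemma zact_reg [simp]: "zact (reg x) (y, Stay) = reg y"
  by (simp add: reg_def push_def)

text \<open>
  \<open>tI\<close> is the input tape and \<open>tW\<close> a copy of it in which literals are opened by \<open>Mark 2\<close>, by \<open>Mark 4\<close>
  (still a candidate for the current pointer) or by \<open>Mark 5\<close> (chosen). \<open>tR\<close> holds \<open>h\<close> cells, \<open>tK\<close> the
  parameter in unary, and the other tapes are one-cell registers: \<open>tA\<close> for the verdict, \<open>tB\<close> for a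
  parity or for the clause being scanned, \<open>tC\<close> for a carry, \<open>tD\<close> for a match found.
\<close>

abbreviation tI :: nat where "tI \<equiv> 0"
abbreviation tW :: nat where "tW \<equiv> Suc 0"
abbreviation tR :: nat where "tR \<equiv> Suc (Suc 0)"
abbreviation tK :: nat where "tK \<equiv> Suc (Suc (Suc 0))"
abbreviation tA :: nat where "tA \<equiv> Suc (Suc (Suc (Suc 0)))"
abbreviation tB :: nat where "tB \<equiv> Suc (Suc (Suc (Suc (Suc 0))))"
abbreviation tC :: nat where "tC \<equiv> Suc (Suc (Suc (Suc (Suc (Suc 0)))))"
abbreviation tD :: nat where "tD \<equiv> Suc (Suc (Suc (Suc (Suc (Suc (Suc 0))))))"

section \<open>Moving heads and setting registers\<close>

definition move_head :: "nat \<Rightarrow> move \<Rightarrow> prog" where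
  "move_head j d = Do [(j, \<lambda>as. (as ! j, d))]"

lemma runs_move_head:
  "zs' = zs[j := zact (zs ! j) (zscan (zs ! j), d)] \<Longrightarrow> j < length zs \<Longrightarrow> 1 \<le> T \<Longrightarrow>
   runs ans (move_head j d) (zs, q) (zs', q) T"
  unfolding move_head_def by (rule runs_Do) auto

definition set_reg :: "nat \<Rightarrow> bool \<Rightarrow> prog" where
  "set_reg j b = Do [(j, \<lambda>_. (Bit b, Stay))]"

lemma runs_set_reg:
  "zs' = zs[j := zact (zs ! j) (Bit b, Stay)] \<Longrightarrow> 1 \<le> T \<Longrightarrow>
   runs ans (set_reg j b) (zs, q) (zs', q) T"
  unfolding set_reg_def by (rule runs_Do) auto

lemma runs_left_until:
  assumes "j < length zs" "zs ! j = (rev ys @ m # l, r)" "zs' = zs[j := (l, m # ys @ r)]"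
    "m \<noteq> Blank" "m \<notin> set ys" "Blank \<notin> set ys" "top_sym r \<noteq> m" "r \<noteq> [Blank]" "3 * length ys + 4 \<le> T"
  shows "runs ans (Loop (\<lambda>as. as ! j \<noteq> m) (move_head j Left)) (zs, q) (zs', q) T"
  using assms
proof (induction ys arbitrary: zs zs' r T rule: rev_induct)
  case Nil
  show ?case unfolding move_head_def
    apply (rule runs_LoopDo[where U = 1])
    using Nil apply (simp_all)
    apply (rule runs_LoopF)
    using Nil apply (simp_all)
    done
next
  case (snoc y ys)
  show ?case unfolding move_head_def
    apply (rule runs_LoopDo[where U = "3 * length ys + 4"])
    using snoc.prems apply (simp_all)
    unfolding move_head_def[symmetric]
    apply (rule snoc.IH[where r = "y # r"])
    using snoc.prems apply (auto)
    done
qed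

text \<open>The first move steps off a blank that the head may scan behind the right end; without it
  the loop would stop at once. The last move returns from the blank left of the first cell.\<close>

definition rewind :: "nat \<Rightarrow> prog" where
  "rewind j = move_head j Left ;; Loop (\<lambda>as. as ! j \<noteq> Blank) (move_head j Left) ;; move_head j Right"

lemma runs_left_end:
  assumes "j < length zs" "zs ! j = (rev ys, y # r)" "zs' = zs[j := ([], Blank # ys @ y # r)]"
    "y \<noteq> Blank" "Blank \<notin> set ys" "3 * length ys + 4 \<le> T"
  shows "runs ans (Loop (\<lambda>as. as ! j \<noteq> Blank) (move_head j Left)) (zs, q) (zs', q) T"
  using assms
proof (induction ys arbitrary: zs zs' y r T rule: rev_induct)
  case Nil
  show ?case unfolding move_head_def
    apply (rule runs_LoopDo[where U = 1])
    using Nil apply (simp_all)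
    apply (rule runs_LoopF)
    using Nil apply (simp_all)
    done
next
  case (snoc x ys)
  show ?case unfolding move_head_def
    apply (rule runs_LoopDo[where U = "3 * length ys + 4"])
    using snoc.prems apply (simp_all)
    unfolding move_head_def[symmetric]
    apply (rule snoc.IH[where r = "y # r" and y = x])
    using snoc.prems apply (auto)
    done
qed

lemma runs_rewind:
  assumes j: "j < length zs" "zs ! j = (rev xs, r)" and zs': "zs' = zs[j := ([], xs @ r)]"
    and ne: "Blank \<notin> set xs" "r \<noteq> [Blank]" and T: "3 * length xs + 6 \<le> T"
  shows "runs ans (rewind j) (zs, q) (zs', q) T"
proof (cases xs rule: rev_cases)
  case Nil
  let ?zs1 = "zs[j := ([], push Blank r)]"
  show ?thesis unfolding rewind_def
  proof (rule runs_Seq[OF _ runs_Seq])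
    show "runs ans (move_head j Left) (zs, q) (?zs1, q) 1"
      using j ne Nil by (intro runs_move_head) auto
    show "runs ans (Loop (\<lambda>as. as ! j \<noteq> Blank) (move_head j Left)) (?zs1, q) (?zs1, q) 1"
      using j by (intro runs_LoopF) auto
    show "runs ans (move_head j Right) (?zs1, q) (zs', q) 1"
      using j zs' Nil by (intro runs_move_head) (auto simp: push_def)
  qed (use T in auto)
next
  case (snoc ys y)
  let ?zs1 = "zs[j := (rev ys, y # r)]" and ?zs2 = "zs[j := ([], Blank # ys @ y # r)]"
  show ?thesis unfolding rewind_def
  proof (rule runs_Seq[OF _ runs_Seq])
    show "runs ans (move_head j Left) (zs, q) (?zs1, q) 1"
      using j ne snoc by (intro runs_move_head) auto
    show "runs ans (Loop (\<lambda>as. as ! j \<noteq> Blank) (move_head j Left)) (?zs1, q) (?zs2, q) (3 * length ys + 4)"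
      using j ne snoc by (intro runs_left_end[where y = y]) auto
    show "runs ans (move_head j Right) (?zs2, q) (zs', q) 1"
      using j zs' snoc by (intro runs_move_head) (auto simp: push_def)
  qed (use T snoc in auto)
qed

text \<open>\<open>Mark 3\<close> ends the formula on the work tape and \<open>Blank\<close> ends
  the ruler, so one halving routine serves both tapes.\<close>

definition stop :: "sym \<Rightarrow> bool" where
  "stop x \<longleftrightarrow> x = Blank \<or> x = Mark 3"

abbreviation no_stop :: "sym list \<Rightarrow> bool" where
  "no_stop xs \<equiv> \<forall>x\<in>set xs. \<not> stop x"

definition sweep :: "(sym \<Rightarrow> sym) \<Rightarrow> prog" where
  "sweep f = Loop (\<lambda>as. \<not> stop (as ! tW)) (Do [(tW, \<lambda>as. (f (as ! tW), Right))]) ;; rewind tW"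

lemma runs_sweep_loop:
  assumes "\<forall>x\<in>set xs. \<not> stop x \<and> f x \<noteq> Blank" "stop (top_sym r)" "3 * length xs + 1 \<le> T"
  shows "runs ans (Loop (\<lambda>as. \<not> stop (as ! tW)) (Do [(tW, \<lambda>as. (f (as ! tW), Right))]))
    ([i, (l, xs @ r), rr, k, a, b, c, d], q) ([i, (rev (map f xs) @ l, r), rr, k, a, b, c, d], q) T"
  using assms
proof (induction xs arbitrary: l T)
  case Nil
  then show ?case by (auto intro: runs_LoopF)
next
  case (Cons x xs)
  show ?case
    apply (rule runs_LoopDo[where U = "3 * length xs + 1"])
    using Cons.prems Cons.IH[of _ "f x # l"] apply (simp_all)
    done
qed

lemma runs_sweep:
  assumes "\<forall>x\<in>set xs. \<not> stop x \<and> f x \<noteq> Blank" "stop (top_sym r)" "r \<noteq> [Blank]" "6 * length xs + 7 \<le> T"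
  shows "runs ans (sweep f)
    ([i, ([], xs @ r), rr, k, a, b, c, d], q) ([i, ([], map f xs @ r), rr, k, a, b, c, d], q) T"
  unfolding sweep_def
  apply (rule runs_Seq)
    apply (rule runs_sweep_loop[OF assms(1,2) order_refl])
   apply (rule runs_rewind[where xs = "map f xs" and r = r, OF _ _ _ _ _ order_refl])
  using assms apply auto
  done

text \<open>The candidates marked \<open>Mark 4\<close> survive alternately, and \<open>p\<close>
  says whether the first one does. A sequence of such bits is an address of a candidate, given
  without ever computing its position.\<close>

fun halve :: "bool \<Rightarrow> sym list \<Rightarrow> sym list" where
  "halve p [] = []"
| "halve p (x # xs) =
     (if x = Mark 4 then (if p then Mark 4 else Mark 2) # halve (\<not> p) xs else x # halve p xs)"

text \<open>\<open>tB\<close> holds the alternating parity. \<open>tA\<close> is raised when the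
  pass meets a candidate, so it reports whether any was present before the halving.\<close>

definition halve_loop :: "nat \<Rightarrow> prog" where
  "halve_loop j =
     Loop (\<lambda>as. \<not> stop (as ! j))
       (Do [(j, \<lambda>as. (if as ! j = Mark 4 \<and> as ! tB \<noteq> Bit True then Mark 2 else as ! j, Right)),
            (tA, \<lambda>as. (if as ! j = Mark 4 then Bit True else as ! tA, Stay)),
            (tB, \<lambda>as. (if as ! j = Mark 4 then Bit (as ! tB \<noteq> Bit True) else as ! tB, Stay))])"

definition halve_tape :: "nat \<Rightarrow> prog" where
  "halve_tape j = halve_loop j ;; rewind j"

lemma length_halve [simp]: "length (halve p xs) = length xs"
  by (induction xs arbitrary: p) auto

lemma Blank_halve: "Blank \<notin> set xs \<Longrightarrow> Blank \<notin> set (halve p xs)"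
  by (induction xs arbitrary: p) auto

lemma runs_halve_loop:
  assumes "no_stop xs" "stop (top_sym r)" "3 * length xs + 1 \<le> T"
    and "length zs = 8" "j = tW \<or> j = tR" "zs ! j = (l, xs @ r)" "zs ! tA = flag a" "zs ! tB = flag p"
  shows "\<exists>p'. runs ans (halve_loop j)
    (zs, q) (zs[j := (rev (halve p xs) @ l, r), tA := flag (a \<or> Mark 4 \<in> set xs), tB := flag p'], q) T"
  using assms
proof (induction xs arbitrary: l zs a p T)
  case Nil
  have "zs[j := (l, r), tA := flag a, tB := flag p] = zs"
    using Nil by (metis append_Nil list_update_id)
  then show ?case using Nil by (intro exI[of _ p]) (auto simp: halve_loop_def intro!: runs_LoopF)
next
  case (Cons x xs)
  let ?p = "if x = Mark 4 then \<not> p else p" and ?a = "a \<or> x = Mark 4"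
  let ?l = "(if x = Mark 4 \<and> \<not> p then Mark 2 else x) # l"
  let ?zs = "zs[j := (?l, xs @ r), tA := flag ?a, tB := flag ?p]"
  have xB: "x \<noteq> Blank" using Cons.prems(1) by (auto simp: stop_def)
  have jj: "j \<noteq> tA" "j \<noteq> tB" "j < 8" using Cons.prems by auto
  obtain p' where IH: "runs ans (halve_loop j)
    (?zs, q) (?zs[j := (rev (halve ?p xs) @ ?l, r), tA := flag (?a \<or> Mark 4 \<in> set xs), tB := flag p'], q)
    (3 * length xs + 1)"
    using Cons.IH[of "3 * length xs + 1" ?zs ?l ?a ?p] Cons.prems jj by (auto simp: nth_list_update)
  obtain i w rr k a' b' c d where zs: "zs = [i, w, rr, k, a', b', c, d]"
    using Cons.prems(4) by (auto simp: length_Suc_conv numeral_eq_Suc)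
  show ?case unfolding halve_loop_def
    apply (rule exI[of _ p'])
    apply (rule runs_LoopDo[where U = "3 * length xs + 1"])
    using Cons.prems(1,6) jj(3) Cons.prems(4) apply (simp)
    using IH[unfolded halve_loop_def] jj(3) Cons.prems xB unfolding zs
     apply (elim disjE; cases "x = Mark 4"; cases p; simp)
    using Cons.prems apply simp
    done
qed

lemma runs_halve_tape:
  assumes "no_stop xs" "stop (top_sym r)" "r \<noteq> [Blank]" "6 * length xs + 7 \<le> T"
    and "length zs = 8" "j = tW \<or> j = tR" "zs ! j = ([], xs @ r)" "zs ! tA = flag a" "zs ! tB = flag p"
  shows "\<exists>p'. runs ans (halve_tape j) (zs, q)
    (zs[j := ([], halve p xs @ r), tA := flag (a \<or> Mark 4 \<in> set xs), tB := flag p'], q) T"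
proof -
  obtain p' where *: "runs ans (halve_loop j)
    (zs, q) (zs[j := (rev (halve p xs) @ [], r), tA := flag (a \<or> Mark 4 \<in> set xs), tB := flag p'], q)
    (3 * length xs + 1)"
    using runs_halve_loop[OF assms(1,2) order_refl assms(5-)] by blast
  obtain i w rr k a' b' c d where zs: "zs = [i, w, rr, k, a', b', c, d]"
    using assms(5) by (auto simp: length_Suc_conv numeral_eq_Suc)
  have "Blank \<notin> set (halve p xs)"
    using assms(1) by (intro Blank_halve) (auto simp: stop_def)
  then show ?thesis unfolding halve_tape_def
    apply (intro exI[of _ p'] runs_Seq[OF *])
     apply (rule runs_rewind[where xs = "halve p xs" and r = r, OF _ _ _ _ _ order_refl])
    using assms apply (auto simp: zs)
    done
qed

section \<open>Copying, counting and comparing lengths\<close>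

lemma reg_Blank: "([], []) = reg Blank"
  by (simp add: reg_def)

fun is_bit :: "sym \<Rightarrow> bool" where
  "is_bit (Bit b) = True"
| "is_bit _ = False"

lemma is_bit_iff: "is_bit x \<longleftrightarrow> x = Bit True \<or> x = Bit False"
  by (cases x) auto

definition revive :: "sym \<Rightarrow> sym" where
  "revive x = (if x = Mark 2 then Mark 4 else x)"

definition pick_alive :: "sym \<Rightarrow> sym" where
  "pick_alive x = (if x = Mark 4 then Mark 5 else x)"

definition copy_input :: prog where
  "copy_input =
     Loop (\<lambda>as. as ! tI \<noteq> Blank)
       (Do [(tI, \<lambda>as. (as ! tI, Right)), (tW, \<lambda>as. (revive (as ! tI), Right))]) ;;
     rewind tI ;; rewind tW"

lemma runs_copy_loop:
  assumes "Blank \<notin> set xs" "3 * length xs + 1 \<le> T"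
  shows "runs ans (Loop (\<lambda>as. as ! tI \<noteq> Blank)
       (Do [(tI, \<lambda>as. (as ! tI, Right)), (tW, \<lambda>as. (revive (as ! tI), Right))]))
    ([(l, xs), (lw, []), rr, k, a, b, c, d], q)
    ([(rev xs @ l, []), (rev (map revive xs) @ lw, []), rr, k, a, b, c, d], q) T"
  using assms
proof (induction xs arbitrary: l lw T)
  case Nil
  then show ?case by (auto intro: runs_LoopF)
next
  case (Cons x xs)
  then have x: "x \<noteq> Blank" "revive x \<noteq> Blank" by (auto simp: revive_def)
  show ?case
    apply (rule runs_LoopDo[where U = "3 * length xs + 1"])
    using x Cons.prems Cons.IH[of _ "x # l" "revive x # lw"] by simp_all
qed

lemma runs_copy_input:
  assumes "Blank \<notin> set w" "9 * length w + 13 \<le> T"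
  shows "runs ans copy_input
    ([([], w), ([], []), rr, k, a, b, c, d], q)
    ([([], w), ([], map revive w), rr, k, a, b, c, d], q) T"
proof -
  have "Blank \<notin> set (map revive w)" using assms(1) by (auto simp: revive_def)
  then have 3: "runs ans (rewind tW) ([([], w), (rev (map revive w), []), rr, k, a, b, c, d], q)
    ([([], w), ([], map revive w), rr, k, a, b, c, d], q) (3 * length w + 6)"
    by (intro runs_rewind[where xs = "map revive w" and r = "[]"]) auto
  have 2: "runs ans (rewind tI) ([(rev w, []), (rev (map revive w), []), rr, k, a, b, c, d], q)
    ([([], w), (rev (map revive w), []), rr, k, a, b, c, d], q) (3 * length w + 6)"
    by (intro runs_rewind[where xs = w and r = "[]"]) (use assms in auto)
  have 1: "runs ans (Loop (\<lambda>as. as ! tI \<noteq> Blank)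
    (Do [(tI, \<lambda>as. (as ! tI, Right)), (tW, \<lambda>as. (revive (as ! tI), Right))]))
    ([([], w), ([], []), rr, k, a, b, c, d], q)
    ([(rev w, []), (rev (map revive w), []), rr, k, a, b, c, d], q) (3 * length w + 1)"
    using runs_copy_loop[OF assms(1) order_refl, of ans "[]" "[]" rr k a b c d q] by simp
  show ?thesis unfolding copy_input_def
    by (rule runs_Seq[OF 1 runs_Seqs[OF 2 3]]) (use assms in simp)
qed

section \<open>Writing the parameter in unary\<close>

definition decrement :: prog where
  "decrement =
     move_head tW Right ;;
     Loop (\<lambda>as. as ! tW = Bit False) (Do [(tW, \<lambda>_. (Bit True, Right))]) ;;
     Do [(tW, \<lambda>as. (if as ! tW = Bit True then Bit False else as ! tW, Stay)),
         (tK, \<lambda>as. if as ! tW = Bit True then (Mark 0, Right) else (as ! tK, Stay)),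
         (tA, \<lambda>as. (Bit (as ! tW = Bit True), Stay))] ;;
     Loop (\<lambda>as. as ! tW \<noteq> Mark 3) (move_head tW Left)"

text \<open>The number of rounds is \<open>k + 1\<close>, possibly exponential in the length of the
  binary parameter; FPT time permits this because the cost depends on \<open>k\<close>.\<close>

definition to_unary :: prog where
  "to_unary =
     Loop (\<lambda>as. as ! tW \<noteq> Mark 3) (move_head tW Right) ;;
     set_reg tA True ;;
     Loop (\<lambda>as. as ! tA = Bit True) decrement ;;
     rewind tW ;; rewind tK"

lemma runs_right_until:
  assumes "Mark 3 \<notin> set xs" "Blank \<notin> set xs" "3 * length xs + 1 \<le> T"
  shows "runs ans (Loop (\<lambda>as. as ! tW \<noteq> Mark 3) (move_head tW Right))
    ([i, (l, xs @ Mark 3 # r), rr, k, a, b, c, d], q)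
    ([i, (rev xs @ l, Mark 3 # r), rr, k, a, b, c, d], q) T"
  using assms unfolding move_head_def
proof (induction xs arbitrary: l T)
  case Nil
  then show ?case by (auto intro: runs_LoopF)
next
  case (Cons x xs)
  show ?case
    apply (rule runs_LoopDo[where U = "3 * length xs + 1"])
    using Cons.prems Cons.IH[of "3 * length xs + 1" "x # l"] by auto
qed

lemma runs_borrow_loop:
  assumes "top_sym r \<noteq> Bit False" "3 * j + 1 \<le> T"
  shows "runs ans (Loop (\<lambda>as. as ! tW = Bit False) (Do [(tW, \<lambda>_. (Bit True, Right))]))
    ([i, (l, replicate j (Bit False) @ r), rr, k, a, b, c, d], q)
    ([i, (replicate j (Bit True) @ l, r), rr, k, a, b, c, d], q) T"
  using assms
proof (induction j arbitrary: l T)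
  case 0
  then show ?case by (auto intro: runs_LoopF)
next
  case (Suc j)
  show ?case
    apply (rule runs_LoopDo[where U = "3 * j + 1"])
    using Suc.prems Suc.IH[of _ "Bit True # l"] by (simp_all add: replicate_app_Cons_same)
qed

lemma bits_cases:
  obtains (zero) "bs = replicate (length bs) False"
  | (pos) j cs where "bs = replicate j False @ True # cs"
proof (cases "True \<in> set bs")
  case True
  then obtain ys cs where bs: "bs = ys @ True # cs" "True \<notin> set ys" by (auto dest: split_list_first)
  then have "ys = replicate (length ys) False" by (intro replicate_eqI) auto
  then show ?thesis using bs pos[of "length ys" cs] by simp
next
  case False
  then have "bs = replicate (length bs) False" by (intro replicate_eqI) auto
  then show ?thesis by (rule zero)
qed

lemma value_replicate_False [simp]:
  "horner_sum of_bool 2 (replicate j False @ bs) = 2 ^ j * (horner_sum of_bool 2 bs :: nat)"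
  by (induction j) auto

lemma value_borrow:
  "horner_sum of_bool 2 (replicate j False @ True # cs) =
   Suc (horner_sum of_bool 2 (replicate j True @ False # cs))"
  by (induction j) auto

text \<open>Subtracting 1 turns the low zeros into ones and clears the first one. If
  \<open>r = []\<close> the number was zero: it wraps around to all ones, \<open>tK\<close> gets no
  mark, and the lowered \<open>tA\<close> ends the conversion.\<close>

lemma runs_decrement:
  assumes "r = [] \<or> hd r = Bit True" "6 * j + 7 \<le> T"
  shows "runs ans decrement
    ([i, (l, Mark 3 # replicate j (Bit False) @ r), rr, (lk, []), reg a, b, c, d], q)
    ([i, (l, Mark 3 # replicate j (Bit True) @ (if r = [] then [] else Bit False # tl r)), rr,
      (if r = [] then lk else Mark 0 # lk, []), flag (r \<noteq> []), b, c, d], q) T"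
proof -
  let ?r = "if r = [] then [] else Bit False # tl r" and ?k = "(if r = [] then lk else Mark 0 # lk, [])"
  have r: "top_sym r \<noteq> Bit False" "r \<noteq> [Blank]" using assms by (cases r; auto)+
  have 1: "runs ans (move_head tW Right) ([i, (l, Mark 3 # replicate j (Bit False) @ r), rr, (lk, []), reg a, b, c, d], q)
    ([i, (Mark 3 # l, replicate j (Bit False) @ r), rr, (lk, []), reg a, b, c, d], q) 1"
    by (rule runs_move_head) simp_all
  note 2 = runs_borrow_loop[OF r(1) order_refl]
  have 3: "runs ans (Do [(tW, \<lambda>as. (if as ! tW = Bit True then Bit False else as ! tW, Stay)),
    (tK, \<lambda>as. if as ! tW = Bit True then (Mark 0, Right) else (as ! tK, Stay)),
    (tA, \<lambda>as. (Bit (as ! tW = Bit True), Stay))])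
    ([i, (replicate j (Bit True) @ Mark 3 # l, r), rr, (lk, []), reg a, b, c, d], q)
    ([i, (replicate j (Bit True) @ Mark 3 # l, ?r), rr, ?k, flag (r \<noteq> []), b, c, d], q) 1" (is "runs _ _ _ ?s3 _")
    by (rule runs_Do) (use assms in \<open>cases r; auto\<close>)+
  have 4: "runs ans (Loop (\<lambda>as. as ! tW \<noteq> Mark 3) (move_head tW Left)) ?s3
    ([i, (l, Mark 3 # replicate j (Bit True) @ ?r), rr, ?k, flag (r \<noteq> []), b, c, d], q) (3 * j + 4)"
    by (rule runs_left_until[where ys = "replicate j (Bit True)" and r = ?r]) auto
  show ?thesis unfolding decrement_def
    by (rule runs_Seq[OF 1 runs_Seqs[OF 2 runs_Seqs[OF 3 4]]]) (use assms in simp)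
qed

text \<open>There are \<open>Suc v\<close> rounds since the last one only discovers the zero. The
  bits behind \<open>Mark 3\<close> are destroyed, hence the existential \<open>bs'\<close>; later
  passes over the work tape stop at \<open>Mark 3\<close>, and the input tape keeps the
  original.\<close>

lemma runs_decrement_loop:
  assumes "v = horner_sum of_bool 2 bs" "Suc v * (6 * length bs + 10) \<le> T"
  shows "\<exists>bs'. runs ans (Loop (\<lambda>as. as ! tA = Bit True) decrement)
    ([i, (l, Mark 3 # map Bit bs), rr, (lk, []), flag True, b, c, d], q)
    ([i, (l, Mark 3 # map Bit bs'), rr, (unary v @ lk, []), flag False, b, c, d], q) T"
  (is "\<exists>bs'. runs _ ?L _ _ _")
  using assms
proof (induction v arbitrary: bs lk T)
  case 0
  show ?case
  proof (cases rule: bits_cases[of bs])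
    case zero
    let ?n = "length bs"
    have m: "map Bit bs = replicate ?n (Bit False) @ []" by (subst zero) simp
    note D = runs_decrement[of "[]" ?n "6 * ?n + 7" ans i l rr lk "Bit True" b c d q, simplified]
    have "runs ans ?L
      ([i, (l, Mark 3 # map Bit bs), rr, (lk, []), flag True, b, c, d], q)
      ([i, (l, Mark 3 # replicate ?n (Bit True)), rr, (lk, []), flag False, b, c, d], q) T"
      unfolding m
    proof (rule runs_LoopT[where U = "6 * ?n + 7" and V = 1])
      show "runs ans decrement
        ([i, (l, Mark 3 # replicate ?n (Bit False) @ []), rr, (lk, []), flag True, b, c, d], q)
        ([i, (l, Mark 3 # replicate ?n (Bit True)), rr, (lk, []), flag False, b, c, d], q) (6 * ?n + 7)"
        using D by simp
      show "runs ans ?L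
        ([i, (l, Mark 3 # replicate ?n (Bit True)), rr, (lk, []), flag False, b, c, d], q)
        ([i, (l, Mark 3 # replicate ?n (Bit True)), rr, (lk, []), flag False, b, c, d], q) 1"
        by (rule runs_LoopF) simp_all
    qed (use 0 in simp_all)
    then show ?thesis by (intro exI[of _ "replicate ?n True"]) simp
  next
    case (pos j cs)
    then show ?thesis using 0 by simp
  qed
next
  case (Suc v)
  show ?case
  proof (cases rule: bits_cases[of bs])
    case zero
    then have "horner_sum of_bool 2 bs = (0::nat)"
      using value_replicate_False[of "length bs" "[]"] by simp
    then show ?thesis using Suc by simp
  next
    case (pos j cs)
    let ?bs = "replicate j True @ False # cs"
    have v: "v = horner_sum of_bool 2 ?bs" using Suc.prems(1) value_borrow[of j cs] pos by simp
    have len: "length ?bs = length bs" "j < length bs" using pos by simp_all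
    have m: "map Bit bs = replicate j (Bit False) @ Bit True # map Bit cs" using pos by simp
    note D = runs_decrement[of "Bit True # map Bit cs" j "6 * j + 7" ans i l rr lk "Bit True" b c d q, simplified]
    obtain bs' where IH: "runs ans ?L
    ([i, (l, Mark 3 # map Bit ?bs), rr, (Mark 0 # lk, []), flag True, b, c, d], q)
    ([i, (l, Mark 3 # map Bit bs'), rr, (unary v @ Mark 0 # lk, []), flag False, b, c, d], q)
     (Suc v * (6 * length bs + 10))"
      using Suc.IH[OF v order_refl, of "Mark 0 # lk"] unfolding len by blast
    have "runs ans ?L
      ([i, (l, Mark 3 # map Bit bs), rr, (lk, []), flag True, b, c, d], q)
      ([i, (l, Mark 3 # map Bit bs'), rr, (unary (Suc v) @ lk, []), flag False, b, c, d], q) T"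
      unfolding m
    proof (rule runs_LoopT[OF _ D])
      show "runs ans ?L
        ([i, (l, Mark 3 # replicate j (Bit True) @ Bit False # map Bit cs), rr, (Mark 0 # lk, []), flag True, b, c, d], q)
        ([i, (l, Mark 3 # map Bit bs'), rr, (unary (Suc v) @ lk, []), flag False, b, c, d], q)
        (Suc v * (6 * length bs + 10))"
        using IH by (simp add: replicate_app_Cons_same)
    qed (use Suc.prems(2) len in simp_all)
    then show ?thesis by blast
  qed
qed

lemma runs_to_unary:
  assumes "Mark 3 \<notin> set xs" "Blank \<notin> set xs" "v = horner_sum of_bool 2 bs"
    "6 * length xs + Suc v * (6 * length bs + 14) + 16 \<le> T"
  shows "\<exists>bs'. runs ans to_unary
    ([i, ([], xs @ Mark 3 # map Bit bs), rr, ([], []), reg a, b, c, d], q)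
    ([i, ([], xs @ Mark 3 # map Bit bs'), rr, ([], unary v), flag False, b, c, d], q) T"
proof -
  obtain bs' where 3: "runs ans (Loop (\<lambda>as. as ! tA = Bit True) decrement)
    ([i, (rev xs @ [], Mark 3 # map Bit bs), rr, ([], []), flag True, b, c, d], q)
    ([i, (rev xs @ [], Mark 3 # map Bit bs'), rr, (unary v @ [], []), flag False, b, c, d], q)
    (Suc v * (6 * length bs + 10))"
    using runs_decrement_loop[OF assms(3) order_refl, of ans i "rev xs @ []" rr "[]" b c d q] by (elim exE) (rule that)
  note 1 = runs_right_until[OF assms(1,2) order_refl, of ans i "[]" "map Bit bs" rr "([], [])" "reg a" b c d q]
  have 2: "runs ans (set_reg tA True)
    ([i, (rev xs @ [], Mark 3 # map Bit bs), rr, ([], []), reg a, b, c, d], q)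
    ([i, (rev xs @ [], Mark 3 # map Bit bs), rr, ([], []), flag True, b, c, d], q) 1"
    by (rule runs_set_reg) simp_all
  have 4: "runs ans (rewind tW)
    ([i, (rev xs @ [], Mark 3 # map Bit bs'), rr, (unary v @ [], []), flag False, b, c, d], q)
    ([i, ([], xs @ Mark 3 # map Bit bs'), rr, (unary v, []), flag False, b, c, d], q)
    (3 * length xs + 6)" (is "runs _ _ _ ?s4 _")
    by (rule runs_rewind[where xs = xs]) (use assms in auto)
  have 5: "runs ans (rewind tK) ?s4
    ([i, ([], xs @ Mark 3 # map Bit bs'), rr, ([], unary v), flag False, b, c, d], q)
    (3 * v + 6)"
    by (rule runs_rewind[where xs = "unary v"]) auto
  have "runs ans to_unary
    ([i, ([], xs @ Mark 3 # map Bit bs), rr, ([], []), reg a, b, c, d], q)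
    ([i, ([], xs @ Mark 3 # map Bit bs'), rr, ([], unary v), flag False, b, c, d], q) T"
    unfolding to_unary_def
    by (rule runs_Seq[OF 1 runs_Seqs[OF 2 runs_Seqs[OF 3 runs_Seqs[OF 4 5]]]])
       (use assms(4) in \<open>simp add: algebra_simps\<close>)
  then show ?thesis by blast
qed

section \<open>Measuring the number of occurrences by a ruler\<close>

definition kill :: "sym \<Rightarrow> sym" where
  "kill x = (if x = Mark 4 then Mark 2 else x)"

lemma count_halve: "count_list (halve p xs) (Mark 4) = (count_list xs (Mark 4) + of_bool p) div 2"
  by (induction xs arbitrary: p) auto

lemma kill_halve [simp]: "map kill (halve p xs) = map kill xs"
proof (induction xs arbitrary: p)
  case (Cons x xs)
  then show ?case by (simp add: kill_def)
qed simp

lemma kill_id: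
  assumes "Mark 4 \<notin> set xs"
  shows "map kill xs = xs"
  by (rule map_idI) (use assms in \<open>auto simp: kill_def\<close>)

lemma set_halve: "set (halve p xs) \<subseteq> insert (Mark 2) (set xs)"
proof (induction xs arbitrary: p)
  case (Cons x xs)
  from Cons[of p] Cons[of "\<not> p"] show ?case by auto
qed simp

lemma halve_id: "Mark 4 \<notin> set xs \<Longrightarrow> halve p xs = xs"
proof (induction xs arbitrary: p)
  case (Cons x xs)
  then have "x \<noteq> Mark 4" by auto
  with Cons show ?case by simp
qed simp

lemma not_stop_halve: "no_stop xs \<Longrightarrow> no_stop (halve p xs)"
  using set_halve[of p xs] by (auto simp: stop_def)

lemma runs_set_A: "runs ans (set_reg tA v) ([i, w, rr, k, reg a, b, c, d], q) ([i, w, rr, k, flag v, b, c, d], q) 1"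
  by (rule runs_set_reg) simp_all

lemma runs_set_B: "runs ans (set_reg tB v) ([i, w, rr, k, a, reg b, c, d], q) ([i, w, rr, k, a, flag v, c, d], q) 1"
  by (rule runs_set_reg) simp_all

lemma runs_set_C: "runs ans (set_reg tC v) ([i, w, rr, k, a, b, reg c, d], q) ([i, w, rr, k, a, b, flag v, d], q) 1"
  by (rule runs_set_reg) simp_all

lemma runs_set_D: "runs ans (set_reg tD v) ([i, w, rr, k, a, b, c, reg d], q) ([i, w, rr, k, a, b, c, flag v], q) 1"
  by (rule runs_set_reg) simp_all

lemma runs_halve_W:
  assumes "no_stop xs" "stop (top_sym r)" "r \<noteq> [Blank]"
  shows "\<exists>p'. runs ans (halve_tape tW) ([i, ([], xs @ r), rr, k, flag a, flag p, c, d], q)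
    ([i, ([], halve p xs @ r), rr, k, flag (a \<or> Mark 4 \<in> set xs), flag p', c, d], q) (6 * length xs + 7)"
  using runs_halve_tape[where ans = ans and q = q and j = tW and a = a and p = p and
      zs = "[i, ([], xs @ r), rr, k, flag a, flag p, c, d]", OF assms order_refl]
  by simp

lemma runs_halve_R:
  assumes "no_stop ys"
  shows "\<exists>p'. runs ans (halve_tape tR) ([i, w, ([], ys), k, flag a, flag p, c, d], q)
    ([i, w, ([], halve p ys), k, flag (a \<or> Mark 4 \<in> set ys), flag p', c, d], q) (6 * length ys + 7)"
  using runs_halve_tape[where ans = ans and q = q and j = tR and a = a and p = p and r = "[]" and
      zs = "[i, w, ([], ys @ []), k, flag a, flag p, c, d]", OF assms _ _ order_refl]
  by (simp add: stop_def)

text \<open>Halving with parity \<open>False\<close> rounds the number of candidates down, and a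
  cell is appended whenever there was a candidate before. The ruler therefore ends up as long as the
  binary representation of the initial number.\<close>

definition ruler_step :: prog where
  "ruler_step = set_reg tA False ;; set_reg tB False ;; halve_tape tW ;;
     Do [(tR, \<lambda>as. if as ! tA = Bit True then (Mark 4, Right) else (as ! tR, Stay))]"

definition make_ruler :: prog where
  "make_ruler = set_reg tA True ;; Loop (\<lambda>as. as ! tA = Bit True) ruler_step ;; rewind tR"

lemma runs_ruler_step:
  assumes "no_stop xs" "stop (top_sym r)" "r \<noteq> [Blank]"
  shows "\<exists>p'. runs ans ruler_step
    ([i, ([], xs @ r), (lr, []), k, reg a, reg b, c, d], q)
    ([i, ([], halve False xs @ r), (if Mark 4 \<in> set xs then Mark 4 # lr else lr, []), k,
      flag (Mark 4 \<in> set xs), flag p', c, d], q) (6 * length xs + 10)"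
proof -
  obtain p' where 3: "runs ans (halve_tape tW)
    ([i, ([], xs @ r), (lr, []), k, flag False, flag False, c, d], q)
    ([i, ([], halve False xs @ r), (lr, []), k, flag (False \<or> Mark 4 \<in> set xs), flag p', c, d], q)
    (6 * length xs + 7)" (is "runs _ _ _ ?s3 _")
    using runs_halve_W[OF assms, of ans i "(lr, [])" k False False c d q] by (elim exE) (rule that)
  have 4: "runs ans (Do [(tR, \<lambda>as. if as ! tA = Bit True then (Mark 4, Right) else (as ! tR, Stay))]) ?s3
    ([i, ([], halve False xs @ r), (if Mark 4 \<in> set xs then Mark 4 # lr else lr, []), k,
    flag (Mark 4 \<in> set xs), flag p', c, d], q) 1"
    by (rule runs_Do) auto
  show ?thesis unfolding ruler_step_def
    by (rule exI, rule runs_Seq[OF runs_set_A runs_Seqs[OF runs_set_B runs_Seqs[OF 3 4]]]) simp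
qed

lemma runs_ruler_loop:
  assumes "no_stop xs" "stop (top_sym r)" "r \<noteq> [Blank]"
    "Suc (floorlog 2 (count_list xs (Mark 4))) * (6 * length xs + 13) \<le> T"
  shows "\<exists>b'. runs ans (Loop (\<lambda>as. as ! tA = Bit True) ruler_step)
    ([i, ([], xs @ r), (lr, []), k, flag True, reg b, c, d], q)
    ([i, ([], map kill xs @ r), (replicate (floorlog 2 (count_list xs (Mark 4))) (Mark 4) @ lr, []), k,
      flag False, reg b', c, d], q) T"
  using assms
proof (induction "count_list xs (Mark 4)" arbitrary: xs lr b T rule: less_induct)
  case less
  let ?c = "count_list xs (Mark 4)" and ?L = "Loop (\<lambda>as. as ! tA = Bit True) ruler_step"
  obtain p' where step: "runs ans ruler_step
    ([i, ([], xs @ r), (lr, []), k, flag True, reg b, c, d], q)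
    ([i, ([], halve False xs @ r), (if Mark 4 \<in> set xs then Mark 4 # lr else lr, []), k,
    flag (Mark 4 \<in> set xs), flag p', c, d], q) (6 * length xs + 10)"
    using runs_ruler_step[OF less.prems(1-3), of ans i lr k "Bit True" b c d q] by (elim exE) (rule that)
  show ?case
  proof (cases "Mark 4 \<in> set xs")
    case False
    then have c0: "?c = 0" by (simp add: count_list_0_iff)
    have eq: "halve False xs = xs" "map kill xs = xs" using False kill_id halve_id by auto
    have "runs ans ?L ([i, ([], xs @ r), (lr, []), k, flag True, reg b, c, d], q)
      ([i, ([], xs @ r), (lr, []), k, flag False, flag p', c, d], q) T"
    proof (rule runs_LoopT)
      show "runs ans ruler_step ([i, ([], xs @ r), (lr, []), k, flag True, reg b, c, d], q)
        ([i, ([], xs @ r), (lr, []), k, flag False, flag p', c, d], q) (6 * length xs + 10)"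
        using step False eq by simp
      show "runs ans ?L ([i, ([], xs @ r), (lr, []), k, flag False, flag p', c, d], q)
        ([i, ([], xs @ r), (lr, []), k, flag False, flag p', c, d], q) 1"
        by (rule runs_LoopF) simp_all
    qed (use less.prems(4) in simp_all)
    then show ?thesis using c0 eq by (auto simp: floorlog_def)
  next
    case True
    then have c0: "0 < ?c" by (metis count_list_0_iff neq0_conv)
    have c2: "count_list (halve False xs) (Mark 4) = ?c div 2" by (simp add: count_halve)
    have fl: "floorlog 2 ?c = Suc (floorlog 2 (?c div 2))" using c0 compute_floorlog[of 2 ?c] by simp
    have "\<exists>b'. runs ans ?L
      ([i, ([], halve False xs @ r), (Mark 4 # lr, []), k, flag True, flag p', c, d], q)
      ([i, ([], map kill xs @ r), (replicate (floorlog 2 ?c) (Mark 4) @ lr, []), k,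
      flag False, reg b', c, d], q) (Suc (floorlog 2 (?c div 2)) * (6 * length xs + 13))" (is "\<exists>b'. ?R b'")
      using less.hyps[of "halve False xs" "Suc (floorlog 2 (?c div 2)) * (6 * length xs + 13)" "Mark 4 # lr" "Bit p'"]
        c0 c2 fl less.prems(2,3) not_stop_halve[OF less.prems(1)] by (simp add: replicate_app_Cons_same)
    then obtain b' where IH: "?R b'" ..
    have step': "runs ans ruler_step ([i, ([], xs @ r), (lr, []), k, flag True, reg b, c, d], q)
      ([i, ([], halve False xs @ r), (Mark 4 # lr, []), k, flag True, flag p', c, d], q) (6 * length xs + 10)"
      using step True by simp
    show ?thesis
      by (rule exI, rule runs_LoopT[OF _ step' IH]) (use less.prems(4) fl in simp_all)
  qed
qed

lemma runs_make_ruler: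
  assumes "no_stop xs" "stop (top_sym r)" "r \<noteq> [Blank]"
    "h = floorlog 2 (count_list xs (Mark 4))"
    "Suc h * (6 * length xs + 16) + 7 \<le> T"
  shows "\<exists>b'. runs ans make_ruler
    ([i, ([], xs @ r), ([], []), k, reg a, reg b, c, d], q)
    ([i, ([], map kill xs @ r), ([], replicate h (Mark 4)), k, flag False, reg b', c, d], q) T"
proof -
  obtain b' where 2: "runs ans (Loop (\<lambda>as. as ! tA = Bit True) ruler_step)
    ([i, ([], xs @ r), ([], []), k, flag True, reg b, c, d], q)
    ([i, ([], map kill xs @ r), (replicate h (Mark 4) @ [], []), k,
    flag False, reg b', c, d], q) (Suc h * (6 * length xs + 13))" (is "runs _ _ _ ?s2 _")
    using runs_ruler_loop[OF assms(1,2,3) order_refl, of ans i "[]" k b c d q] unfolding assms(4)[symmetric]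
    by (elim exE) (rule that)
  have 3: "runs ans (rewind tR) ?s2 ([i, ([], map kill xs @ r), ([], replicate h (Mark 4)), k,
    flag False, reg b', c, d], q) (3 * h + 6)"
    by (rule runs_rewind[where xs = "replicate h (Mark 4)"]) auto
  show ?thesis unfolding make_ruler_def
    by (rule exI, rule runs_Seq[OF runs_set_A runs_Seqs[OF 2 3]])
       (use assms(5) in \<open>simp add: algebra_simps\<close>)
qed

section \<open>Comparing the ruler with a power of two\<close>

definition compare_step :: prog where
  "compare_step = set_reg tA False ;; set_reg tB False ;; halve_tape tR ;; move_head tK Right"

abbreviation compare_loop :: prog where
  "compare_loop \<equiv> Loop (\<lambda>as. as ! tA = Bit True \<and> as ! tK \<noteq> Blank) compare_step"

definition compare_ruler :: prog where
  "compare_ruler = set_reg tA True ;; compare_loop ;; rewind tK"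

lemma runs_compare_step:
  assumes "no_stop ys"
  shows "\<exists>p'. runs ans compare_step
    ([i, w, ([], ys), (lk, Mark 0 # rk), reg a, reg b, c, d], q)
    ([i, w, ([], halve False ys), (Mark 0 # lk, rk), flag (Mark 4 \<in> set ys), flag p', c, d], q)
    (6 * length ys + 10)"
proof -
  obtain p' where 3: "runs ans (halve_tape tR)
    ([i, w, ([], ys), (lk, Mark 0 # rk), flag False, flag False, c, d], q)
    ([i, w, ([], halve False ys), (lk, Mark 0 # rk), flag (False \<or> Mark 4 \<in> set ys), flag p', c, d], q)
    (6 * length ys + 7)" (is "runs _ _ _ ?s3 _")
    using runs_halve_R[OF assms, of ans i w "(lk, Mark 0 # rk)" False False c d q] by (elim exE) (rule that)
  have 4: "runs ans (move_head tK Right) ?s3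
    ([i, w, ([], halve False ys), (Mark 0 # lk, rk), flag (Mark 4 \<in> set ys), flag p', c, d], q) 1"
    by (rule runs_move_head) auto
  show ?thesis unfolding compare_step_def
    by (rule exI, rule runs_Seq[OF runs_set_A runs_Seqs[OF runs_set_B runs_Seqs[OF 3 4]]]) simp
qed

text \<open>The flag describes the ruler before the halving of its round, so surviving
  \<open>n\<close> rounds gives only the exponent \<open>n - 1\<close>. The two final implications
  overlap; they are what the pointer branch and the search branch need, respectively.
  \<open>m' + n' = m + n\<close> lets the tape \<open>tK\<close> be restored after an early
  exit.\<close>

lemma runs_compare_loop:
  assumes "no_stop ys" "n * (6 * length ys + 13) + 1 \<le> T"
  shows "\<exists>ys' n' m' a b'. runs ans compare_loop
    ([i, w, ([], ys), (unary m, unary n), flag True, reg b, c, d], q)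
    ([i, w, ([], ys'), (unary m', unary n'), flag a, reg b', c, d], q) T \<and>
    m' + n' = m + n \<and> length ys' = length ys \<and> (no_stop ys') \<and>
    (a \<longrightarrow> n = 0 \<or> 2 ^ (n - 1) \<le> count_list ys (Mark 4)) \<and> (\<not> a \<longrightarrow> count_list ys (Mark 4) < 2 ^ n)"
  using assms
proof (induction n arbitrary: ys m b T)
  case 0
  have run: "runs ans compare_loop
    ([i, w, ([], ys), (unary m, unary 0), flag True, reg b, c, d], q)
    ([i, w, ([], ys), (unary m, unary 0), flag True, reg b, c, d], q) T"
    by (rule runs_LoopF) (use 0 in auto)
  show ?case
    by (rule exI[of _ ys], rule exI[of _ 0], rule exI[of _ m], rule exI[of _ True], rule exI[of _ b])
       (use 0 run in simp)
next
  case (Suc n)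
  let ?c = "count_list ys (Mark 4)"
  let ?s = "([i, w, ([], ys), (unary m, unary (Suc n)), flag True, reg b, c, d], q)"
  obtain p' where body: "runs ans compare_step
    ([i, w, ([], ys), (unary m, Mark 0 # unary n), flag True, reg b, c, d], q)
    ([i, w, ([], halve False ys), (Mark 0 # unary m, unary n), flag (Mark 4 \<in> set ys), flag p', c, d], q)
    (6 * length ys + 10)"
    using runs_compare_step[OF Suc.prems(1), of ans i w "unary m" "unary n" "Bit True" b c d q]
    by (elim exE) (rule that)
  have c2: "count_list (halve False ys) (Mark 4) = ?c div 2" by (simp add: count_halve)
  show ?case
  proof (cases "Mark 4 \<in> set ys")
    case False
    then have c0: "?c = 0" by (simp add: count_list_0_iff)
    let ?s' = "([i, w, ([], halve False ys), (unary (Suc m), unary n), flag False, flag p', c, d], q)"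
    have 1: "runs ans compare_step ?s ?s' (6 * length ys + 10)" using body False by simp
    have 2: "runs ans compare_loop ?s' ?s' 1" by (rule runs_LoopF) simp_all
    have run: "runs ans compare_loop ?s ?s' T"
      by (rule runs_LoopT[OF _ 1 2]) (use Suc.prems(2) in simp_all)
    have e1: "Suc m + n = m + Suc n" and e2: "length (halve False ys) = length ys"
      and e3: "no_stop (halve False ys)"
      and e4: "False \<longrightarrow> Suc n = 0 \<or> 2 ^ (Suc n - 1) \<le> ?c" and e5: "\<not> False \<longrightarrow> ?c < 2 ^ Suc n"
      using c0 not_stop_halve[OF Suc.prems(1)] by auto
    show ?thesis
      by (rule exI, rule exI, rule exI, rule exI, rule exI, rule conjI[OF run conjI[OF e1 conjI[OF e2 conjI[OF e3 conjI[OF e4 e5]]]]])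
  next
    case True
    then have c0: "0 < ?c" by (metis count_list_0_iff neq0_conv)
    let ?s' = "([i, w, ([], halve False ys), (unary (Suc m), unary n), flag True, flag p', c, d], q)"
    obtain ys' n' m' a b' where IH: "runs ans compare_loop ?s'
      ([i, w, ([], ys'), (unary m', unary n'), flag a, reg b', c, d], q)
      (n * (6 * length ys + 13) + 1)"
      "m' + n' = Suc m + n" "length ys' = length ys" "no_stop ys'"
      "a \<longrightarrow> n = 0 \<or> 2 ^ (n - 1) \<le> ?c div 2" "\<not> a \<longrightarrow> ?c div 2 < 2 ^ n"
      using Suc.IH[OF not_stop_halve[OF Suc.prems(1), of False] order_refl, of "Suc m" "Bit p'"]
      unfolding c2 length_halve by (elim exE conjE) (rule that)
    have 1: "runs ans compare_step ?s ?s' (6 * length ys + 10)" using body True by simp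
    have run: "runs ans compare_loop ?s
     ([i, w, ([], ys'), (unary m', unary n'), flag a, reg b', c, d], q) T"
      by (rule runs_LoopT[OF _ 1 IH(1)]) (use Suc.prems(2) in simp_all)
    have e4: "a \<longrightarrow> Suc n = 0 \<or> 2 ^ (Suc n - 1) \<le> ?c"
    proof
      assume a
      then have "n = 0 \<or> 2 * 2 ^ (n - 1) \<le> ?c" using IH(5) by auto
      then show "Suc n = 0 \<or> 2 ^ (Suc n - 1) \<le> ?c" using c0 by (cases n) auto
    qed
    have e5: "\<not> a \<longrightarrow> ?c < 2 ^ Suc n" using IH(6) by auto
    have e1: "m' + n' = m + Suc n" using IH(2) by simp
    note e2 = IH(3) and e3 = IH(4)
    show ?thesis
      by (rule exI, rule exI, rule exI, rule exI, rule exI, rule conjI[OF run conjI[OF e1 conjI[OF e2 conjI[OF e3 conjI[OF e4 e5]]]]])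
  qed
qed

lemma runs_compare_ruler:
  assumes "n * (6 * L + 16) + 10 \<le> T"
  shows "\<exists>ys' a b'. runs ans compare_ruler
    ([i, w, ([], replicate L (Mark 4)), ([], unary n), reg a0, reg b, c, d], q)
    ([i, w, ([], ys'), ([], unary n), flag a, reg b', c, d], q) T \<and>
    length ys' = L \<and> (no_stop ys') \<and>
    (a \<longrightarrow> n = 0 \<or> 2 ^ (n - 1) \<le> L) \<and> (\<not> a \<longrightarrow> L < 2 ^ n)"
proof -
  let ?ys = "replicate L (Mark 4)"
  have ns: "no_stop ?ys" by (auto simp: stop_def)
  have cnt: "count_list ?ys (Mark 4) = L" by (induction L) auto
  obtain ys' n' m' a b' where 1: "runs ans compare_loop
    ([i, w, ([], ?ys), (unary 0, unary n), flag True, reg b, c, d], q)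
    ([i, w, ([], ys'), (unary m', unary n'), flag a, reg b', c, d], q) (n * (6 * length ?ys + 13) + 1)" (is "runs _ _ _ ?s1 _")
    and 2: "m' + n' = 0 + n" "length ys' = length ?ys" "no_stop ys'"
      "a \<longrightarrow> n = 0 \<or> 2 ^ (n - 1) \<le> L" "\<not> a \<longrightarrow> L < 2 ^ n"
    using runs_compare_loop[OF ns order_refl, where ans = ans and i = i and w = w and m = 0 and b = b and c = c and d = d and q = q and n = n]
    unfolding cnt by (elim exE conjE) (rule that)
  have split: "unary n = unary m' @ unary n'"
    using 2(1) by (simp add: replicate_add[symmetric])
  have m': "m' \<le> n" using 2(1) by simp
  have 3: "runs ans (rewind tK) ?s1
    ([i, w, ([], ys'), ([], unary n), flag a, reg b', c, d], q) (3 * m' + 6)"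
    by (rule runs_rewind[where xs = "unary m'" and r = "unary n'"])
       (cases n'; auto simp: split)+
  have 0: "runs ans (set_reg tA True)
    ([i, w, ([], ?ys), ([], unary n), reg a0, reg b, c, d], q)
    ([i, w, ([], ?ys), (unary 0, unary n), flag True, reg b, c, d], q) 1"
    using runs_set_A by simp
  have run: "runs ans compare_ruler
    ([i, w, ([], ?ys), ([], unary n), reg a0, reg b, c, d], q)
    ([i, w, ([], ys'), ([], unary n), flag a, reg b', c, d], q) T"
    unfolding compare_ruler_def
    by (rule runs_Seq[OF 0 runs_Seqs[OF 1 3]])
       (use m' assms in \<open>simp add: algebra_simps\<close>)
  show ?thesis
    by (rule exI, rule exI, rule exI, rule conjI[OF run]) (use 2 in simp)
qed

section \<open>Checking, guessing and searching\<close>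

fun occs :: "sym list \<Rightarrow> sym list list" where
  "occs [] = []"
| "occs (x # xs) = (if x = Mark 5 then [takeWhile is_bit xs] else []) @ occs xs"

lemma occs_bits: "\<forall>x\<in>set bs. is_bit x \<Longrightarrow> occs (bs @ xs) = occs xs"
  by (induction bs) auto

lemma bits_no_mark: "\<forall>x\<in>set bs. is_bit x \<Longrightarrow> Mark m \<notin> set bs" "\<forall>x\<in>set bs. is_bit x \<Longrightarrow> Blank \<notin> set bs"
  by (metis is_bit.simps(3), metis is_bit.simps(2))

lemma top_dropWhile_is_bit: "\<not> is_bit (top_sym (dropWhile is_bit xs @ Mark m # r))"
  by (induction xs) auto

definition match_words :: prog where
  "match_words = Loop (\<lambda>as. as ! tI = as ! tW \<and> is_bit (as ! tI))
     (Do [(tI, \<lambda>as. (as ! tI, Right)), (tW, \<lambda>as. (as ! tW, Right))])"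

text \<open>The heads stop behind a common prefix \<open>p\<close>, at a difference or at the end of
  a word. Since both words are followed by a non-bit, they agree exactly when both heads then scan
  non-bits.\<close>

lemma runs_match_words:
  assumes "\<forall>x\<in>set bs. is_bit x" "\<forall>x\<in>set cs. is_bit x" "\<not> is_bit (top_sym ri)" "\<not> is_bit (top_sym rw)"
    "3 * length bs + 1 \<le> T"
  shows "\<exists>p bs' cs'. bs = p @ bs' \<and> cs = p @ cs' \<and> (bs' = [] \<and> cs' = [] \<longleftrightarrow> bs = cs) \<and>
    runs ans match_words ([(li, bs @ ri), (lw, cs @ rw), rr, k, a, b, c, d], q)
      ([(rev p @ li, bs' @ ri), (rev p @ lw, cs' @ rw), rr, k, a, b, c, d], q) T"
  using assms
proof (induction bs arbitrary: cs li lw T)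
  case Nil
  have "runs ans match_words ([(li, [] @ ri), (lw, cs @ rw), rr, k, a, b, c, d], q)
    ([(rev [] @ li, [] @ ri), (rev [] @ lw, cs @ rw), rr, k, a, b, c, d], q) T"
    unfolding match_words_def by simp (rule runs_LoopF, use Nil in auto)
  then show ?case
    by (rule_tac exI[of _ "[]"], rule_tac exI[of _ "[]"], rule_tac exI[of _ cs]) auto
next
  case (Cons x bs)
  show ?case
  proof (cases "cs \<noteq> [] \<and> hd cs = x")
    case False
    have ne: "x \<noteq> top_sym (cs @ rw)" using Cons.prems False by (cases cs) auto
    have run: "runs ans match_words ([(li, (x # bs) @ ri), (lw, cs @ rw), rr, k, a, b, c, d], q)
      ([(rev [] @ li, (x # bs) @ ri), (rev [] @ lw, cs @ rw), rr, k, a, b, c, d], q) T"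
      unfolding match_words_def by simp (rule runs_LoopF, use Cons.prems ne in auto)
    show ?thesis
      by (rule exI[of _ "[]"], rule exI[of _ "x # bs"], rule exI[of _ cs]) (use False run in auto)
  next
    case True
    then obtain cs1 where cs: "cs = x # cs1" by (cases cs) auto
    have x: "is_bit x" "x \<noteq> Blank" using Cons.prems(1) by auto
    have "\<exists>p bs' cs'. bs = p @ bs' \<and> cs1 = p @ cs' \<and> (bs' = [] \<and> cs' = [] \<longleftrightarrow> bs = cs1) \<and>
      runs ans match_words ([(x # li, bs @ ri), (x # lw, cs1 @ rw), rr, k, a, b, c, d], q)
      ([(rev p @ x # li, bs' @ ri), (rev p @ x # lw, cs' @ rw), rr, k, a, b, c, d], q) (3 * length bs + 1)"
      by (rule Cons.IH) (use Cons.prems cs in auto)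
    then obtain p bs' cs' where IH: "bs = p @ bs'" "cs1 = p @ cs'" "(bs' = [] \<and> cs' = []) = (bs = cs1)"
      "runs ans match_words ([(x # li, bs @ ri), (x # lw, cs1 @ rw), rr, k, a, b, c, d], q)
      ([(rev p @ x # li, bs' @ ri), (rev p @ x # lw, cs' @ rw), rr, k, a, b, c, d], q) (3 * length bs + 1)"
      by (elim exE conjE) (rule that)
    have run: "runs ans match_words ([(li, (x # bs) @ ri), (lw, cs @ rw), rr, k, a, b, c, d], q)
      ([(rev (x # p) @ li, bs' @ ri), (rev (x # p) @ lw, cs' @ rw), rr, k, a, b, c, d], q) T"
      unfolding match_words_def
      by (rule runs_LoopDo[where U = "3 * length bs + 1"])
         (use IH(4) Cons.prems x cs in \<open>auto simp: match_words_def\<close>)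
    show ?thesis
      by (rule exI[of _ "x # p"], rule exI[of _ bs'], rule exI[of _ cs']) (use IH(1-3) cs run in auto)
  qed
qed

text \<open>\<open>tD\<close> remembers a first match and a second one lowers the verdict
  \<open>tA\<close>, which detects a variable chosen twice. Only the input head returns to its
  literal: the work head has passed over nothing but bits and so has missed no marker.\<close>

definition match_one :: prog where
  "match_one = move_head tI Right ;; move_head tW Right ;; match_words ;;
     Do [(tA, \<lambda>as. (if \<not> is_bit (as ! tI) \<and> \<not> is_bit (as ! tW) \<and> as ! tD = Bit True
            then Bit False else as ! tA, Stay)),
         (tD, \<lambda>as. (if \<not> is_bit (as ! tI) \<and> \<not> is_bit (as ! tW) then Bit True else as ! tD, Stay))] ;;
     move_head tI Left ;; Loop (\<lambda>as. as ! tI \<noteq> Mark 2) (move_head tI Left)"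

lemma runs_match_one:
  assumes "\<forall>x\<in>set bs. is_bit x" "\<forall>x\<in>set cs. is_bit x" "\<not> is_bit (top_sym ri)" "\<not> is_bit (top_sym rw)"
    "ri \<noteq> [Blank]"
  shows "\<exists>p cs'. cs = p @ cs' \<and>
    runs ans match_one ([(li, Mark 2 # bs @ ri), (lw, Mark 5 # cs @ rw), rr, k, flag a, b, c, flag d], q)
      ([(li, Mark 2 # bs @ ri), (rev p @ Mark 5 # lw, cs' @ rw), rr, k,
        flag (a \<and> \<not> (d \<and> bs = cs)), b, c, flag (d \<or> bs = cs)], q) (6 * length bs + 12)"
proof -
  have 1: "runs ans (move_head tI Right)
    ([(li, Mark 2 # bs @ ri), (lw, Mark 5 # cs @ rw), rr, k, flag a, b, c, flag d], q)
    ([(Mark 2 # li, bs @ ri), (lw, Mark 5 # cs @ rw), rr, k, flag a, b, c, flag d], q) 1" (is "runs _ _ _ ?s1 _")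
    by (rule runs_move_head) auto
  have 2: "runs ans (move_head tW Right) ?s1
    ([(Mark 2 # li, bs @ ri), (Mark 5 # lw, cs @ rw), rr, k, flag a, b, c, flag d], q) 1" (is "runs _ _ _ ?s2 _")
    by (rule runs_move_head) auto
  obtain p bs' cs' where p: "bs = p @ bs'" "cs = p @ cs'" "(bs' = [] \<and> cs' = []) = (bs = cs)"
    and 3: "runs ans match_words ?s2
      ([(rev p @ Mark 2 # li, bs' @ ri), (rev p @ Mark 5 # lw, cs' @ rw), rr, k, flag a, b, c, flag d], q)
      (3 * length bs + 1)"
    using runs_match_words[OF assms(1-4) order_refl, of ans "Mark 2 # li" "Mark 5 # lw" rr k "flag a" b c "flag d" q]
    by (elim exE conjE) (rule that)
  let ?a = "flag (a \<and> \<not> (d \<and> bs = cs))" and ?d = "flag (d \<or> bs = cs)"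
  let ?W = "(rev p @ Mark 5 # lw, cs' @ rw)"
  have bi: "is_bit (top_sym (bs' @ ri)) \<longleftrightarrow> bs' \<noteq> []" using assms(1,3) p(1) by (cases bs') auto
  have bw: "is_bit (top_sym (cs' @ rw)) \<longleftrightarrow> cs' \<noteq> []" using assms(2,4) p(2) by (cases cs') auto
  have 4: "runs ans (Do [(tA, \<lambda>as. (if \<not> is_bit (as ! tI) \<and> \<not> is_bit (as ! tW) \<and> as ! tD = Bit True
    then Bit False else as ! tA, Stay)),
    (tD, \<lambda>as. (if \<not> is_bit (as ! tI) \<and> \<not> is_bit (as ! tW) then Bit True else as ! tD, Stay))])
    ([(rev p @ Mark 2 # li, bs' @ ri), ?W, rr, k, flag a, b, c, flag d], q)
    ([(rev p @ Mark 2 # li, bs' @ ri), ?W, rr, k, ?a, b, c, ?d], q) 1" (is "runs _ _ _ ?s4 _")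
    by (rule runs_Do) (use p(3) bi bw in auto)
  have nb: "bs' @ ri \<noteq> [Blank]" using assms(1,5) p(1) by (cases bs') auto
  \<comment> \<open>The unconditional move comes first because the head may already scan the
    \<open>Mark 2\<close> of the next literal, where the loop would stop immediately.\<close>
  have 5: "runs ans (move_head tI Left ;; Loop (\<lambda>as. as ! tI \<noteq> Mark 2) (move_head tI Left)) ?s4
    ([(li, Mark 2 # bs @ ri), ?W, rr, k, ?a, b, c, ?d], q) (3 * length bs + 6)"
  proof (cases p rule: rev_cases)
    case Nil
    have "runs ans (move_head tI Left)
      ([(rev p @ Mark 2 # li, bs' @ ri), ?W, rr, k, ?a, b, c, ?d], q)
      ([(li, Mark 2 # bs @ ri), ?W, rr, k, ?a, b, c, ?d], q) 1"
      by (rule runs_move_head) (use Nil nb p(1) in auto)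
    moreover have "runs ans (Loop (\<lambda>as. as ! tI \<noteq> Mark 2) (move_head tI Left))
      ([(li, Mark 2 # bs @ ri), ?W, rr, k, ?a, b, c, ?d], q)
      ([(li, Mark 2 # bs @ ri), ?W, rr, k, ?a, b, c, ?d], q) 1"
      by (rule runs_LoopF) auto
    ultimately show ?thesis by (rule runs_Seq) simp
  next
    case (snoc p1 y)
    have "\<forall>x\<in>set p1. is_bit x" and y1: "is_bit y" using assms(1) p(1) snoc by auto
    then have y: "is_bit y" "y \<noteq> Blank" "Mark 2 \<notin> set p1" "Blank \<notin> set p1"
      using bits_no_mark[of p1] by auto
    have "runs ans (move_head tI Left)
      ([(rev p @ Mark 2 # li, bs' @ ri), ?W, rr, k, ?a, b, c, ?d], q)
      ([(rev p1 @ Mark 2 # li, y # bs' @ ri), ?W, rr, k, ?a, b, c, ?d], q) 1"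
      by (rule runs_move_head) (use snoc nb y in auto)
    moreover have "runs ans (Loop (\<lambda>as. as ! tI \<noteq> Mark 2) (move_head tI Left))
      ([(rev p1 @ Mark 2 # li, y # bs' @ ri), ?W, rr, k, ?a, b, c, ?d], q)
      ([(li, Mark 2 # bs @ ri), ?W, rr, k, ?a, b, c, ?d], q) (3 * length p1 + 4)"
      by (rule runs_left_until[where ys = p1 and r = "y # bs' @ ri"]) (use y snoc p(1) in auto)
    ultimately show ?thesis by (rule runs_Seq) (use snoc p(1) in simp)
  qed
  show ?thesis unfolding match_one_def
    by (rule exI[of _ p], rule exI[of _ cs'], rule conjI[OF p(2)],
        rule runs_Seq[OF 1 runs_Seqs[OF 2 runs_Seqs[OF 3 runs_Seqs[OF 4 5]]]]) simp
qed

definition match_all :: prog where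
  "match_all = Loop (\<lambda>as. as ! tW \<noteq> Mark 3)
     (Cond (\<lambda>as. as ! tW = Mark 5) match_one (move_head tW Right))"

text \<open>\<open>d\<close> counts as one match found earlier. The induction is on the length
  because a comparison advances the work head by a whole prefix of bits, which contributes nothing
  to \<open>occs\<close>.\<close>

lemma runs_match_all:
  assumes bs: "\<forall>x\<in>set bs. is_bit x" "\<not> is_bit (top_sym ri)" "ri \<noteq> [Blank]"
  shows "no_stop xs \<Longrightarrow> n = count_list (occs xs) bs \<Longrightarrow>
    length xs * (6 * length bs + 16) + 1 \<le> T \<Longrightarrow>
    runs ans match_all
      ([(li, Mark 2 # bs @ ri), (lw, xs @ Mark 3 # r), rr, k, flag a, b, c, flag d], q)
      ([(li, Mark 2 # bs @ ri), (rev xs @ lw, Mark 3 # r), rr, k,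
        flag (a \<and> of_bool d + n \<le> 1), b, c, flag (d \<or> 0 < n)], q) T"
proof (induction "length xs" arbitrary: xs lw a d n T rule: less_induct)
  case less
  let ?I = "(li, Mark 2 # bs @ ri)"
  let ?s = "\<lambda>w a d. ([?I, w, rr, k, flag a, b, c, flag d], q)"
  show ?case
  proof (cases xs)
    case Nil
    have "(a \<and> of_bool d + n \<le> 1) = a" "(d \<or> 0 < n) = d" using less.prems(2) Nil by auto
    then show ?thesis unfolding match_all_def
      using Nil less.prems(3) by (auto intro: runs_LoopF)
  next
    case (Cons x xs1)
    have x: "x \<noteq> Blank" "x \<noteq> Mark 3" using less.prems(1) Cons by (auto simp: stop_def)
    show ?thesis
    proof (cases "x = Mark 5")
      case False
      have 1: "runs ans (move_head tW Right) (?s (lw, xs @ Mark 3 # r) a d) (?s (x # lw, xs1 @ Mark 3 # r) a d) 1" (is "runs _ _ _ ?s1 _")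
        by (rule runs_move_head) (use Cons x in auto)
      have 2: "runs ans match_all ?s1 (?s (rev xs1 @ x # lw, Mark 3 # r) (a \<and> of_bool d + n \<le> 1) (d \<or> 0 < n)) (length xs1 * (6 * length bs + 16) + 1)"
        by (rule less.hyps) (use Cons False less.prems in auto)
      have 3: "runs ans (Cond (\<lambda>as. as ! tW = Mark 5) match_one (move_head tW Right))
        (?s (lw, xs @ Mark 3 # r) a d) (?s (x # lw, xs1 @ Mark 3 # r) a d) 2"
        by (rule runs_CondF[OF _ 1]) (use Cons False in auto)
      have "runs ans match_all (?s (lw, xs @ Mark 3 # r) a d) (?s (rev xs1 @ x # lw, Mark 3 # r) (a \<and> of_bool d + n \<le> 1) (d \<or> 0 < n)) T"
        unfolding match_all_def
        by (rule runs_LoopT[OF _ 3 2[unfolded match_all_def]]) (use Cons less.prems(3) x in auto)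
      then show ?thesis using Cons by simp
    next
      case True
      let ?cs = "takeWhile is_bit xs1" and ?rest = "dropWhile is_bit xs1"
      note rest = top_dropWhile_is_bit[of xs1 3 r]
      have cs: "\<forall>x\<in>set ?cs. is_bit x" by (auto dest: set_takeWhileD)
      obtain p cs' where p: "?cs = p @ cs'"
        and 1: "runs ans match_one (?s (lw, Mark 5 # ?cs @ ?rest @ Mark 3 # r) a d) (?s (rev p @ Mark 5 # lw, cs' @ ?rest @ Mark 3 # r) (a \<and> \<not> (d \<and> bs = ?cs)) (d \<or> bs = ?cs)) (6 * length bs + 12)"
        using runs_match_one[OF bs(1) cs bs(2) rest bs(3), of ans li lw rr k a b c d q] by (elim exE conjE) (rule that)
      let ?ys = "cs' @ ?rest"
      have xs1: "xs1 = p @ ?ys" using p by (metis append.assoc takeWhile_dropWhile_id)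
      have bits: "\<forall>x\<in>set p. is_bit x" using cs p by auto
      let ?n = "count_list (occs ?ys) bs"
      have n: "n = of_bool (bs = ?cs) + ?n"
        using less.prems(2) Cons True occs_bits[OF bits, of ?ys] xs1 by auto
      have e1: "(a \<and> \<not> (d \<and> bs = ?cs)) \<and> of_bool (d \<or> bs = ?cs) + ?n \<le> 1 \<longleftrightarrow> a \<and> of_bool d + n \<le> 1"
        using n by (cases "bs = ?cs"; cases d) auto
      have e2: "(d \<or> bs = ?cs) \<or> 0 < ?n \<longleftrightarrow> d \<or> 0 < n" using n by auto
      have 2: "runs ans match_all (?s (rev p @ Mark 5 # lw, ?ys @ Mark 3 # r) (a \<and> \<not> (d \<and> bs = ?cs)) (d \<or> bs = ?cs))
        (?s (rev ?ys @ rev p @ Mark 5 # lw, Mark 3 # r) ((a \<and> \<not> (d \<and> bs = ?cs)) \<and> of_bool (d \<or> bs = ?cs) + ?n \<le> 1) ((d \<or> bs = ?cs) \<or> 0 < ?n))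
        (length ?ys * (6 * length bs + 16) + 1)"
        by (rule less.hyps) (use Cons less.prems(1) arg_cong[OF xs1, of length] arg_cong[OF xs1, of set] in auto)
      have 3: "runs ans (Cond (\<lambda>as. as ! tW = Mark 5) match_one (move_head tW Right))
        (?s (lw, xs @ Mark 3 # r) a d) (?s (rev p @ Mark 5 # lw, ?ys @ Mark 3 # r) (a \<and> \<not> (d \<and> bs = ?cs)) (d \<or> bs = ?cs)) (6 * length bs + 14)"
        by (rule runs_CondT[where U = "6 * length bs + 12"]) (use Cons True 1 in \<open>simp_all flip: append_assoc\<close>)
      have len: "length ?ys \<le> length xs1" using arg_cong[OF xs1, of length] by simp
      have "length ?ys * (6 * length bs + 16) \<le> length xs1 * (6 * length bs + 16)"
        using len by (rule mult_le_mono1)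
      then have T: "(6 * length bs + 14) + (length ?ys * (6 * length bs + 16) + 1) + 2 \<le> T"
        using less.prems(3) unfolding Cons length_Cons mult_Suc by linarith
      have "runs ans match_all (?s (lw, xs @ Mark 3 # r) a d) (?s (rev ?ys @ rev p @ Mark 5 # lw, Mark 3 # r) ((a \<and> \<not> (d \<and> bs = ?cs)) \<and> of_bool (d \<or> bs = ?cs) + ?n \<le> 1) ((d \<or> bs = ?cs) \<or> 0 < ?n)) T"
        unfolding match_all_def
        by (rule runs_LoopT[OF _ 3 2[unfolded match_all_def] T]) (use Cons True in auto)
      moreover have "rev ?ys @ rev p @ Mark 5 # lw = rev xs @ lw"
        using Cons True xs1 by (metis append.assoc append_Cons append_Nil rev.simps(2) rev_append)
      ultimately show ?thesis by (simp only: e1 e2)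
    qed
  qed
qed

definition literal_step :: prog where
  "literal_step = set_reg tD False ;; match_all ;; rewind tW ;;
     Do [(tB, \<lambda>as. (if as ! tD = Bit True then as ! tB else Bit False, Stay))] ;; move_head tI Right"

lemma runs_literal_step:
  assumes "\<forall>x\<in>set bs. is_bit x" "\<not> is_bit (top_sym ri)" "ri \<noteq> [Blank]" "no_stop ws"
    "n = count_list (occs ws) bs" "length ws * (6 * length bs + 19) + 10 \<le> T"
  shows "runs ans literal_step
      ([(li, Mark 2 # bs @ ri), ([], ws @ Mark 3 # r), rr, k, flag a, flag b, c, reg d], q)
      ([(Mark 2 # li, bs @ ri), ([], ws @ Mark 3 # r), rr, k,
        flag (a \<and> n \<le> 1), flag (b \<and> 0 < n), c, flag (0 < n)], q) T"
proof -
  let ?I = "(li, Mark 2 # bs @ ri)"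
  have 2: "runs ans match_all
    ([?I, ([], ws @ Mark 3 # r), rr, k, flag a, flag b, c, flag False], q)
    ([?I, (rev ws @ [], Mark 3 # r), rr, k,
    flag (a \<and> of_bool False + n \<le> 1), flag b, c, flag (False \<or> 0 < n)], q)
    (length ws * (6 * length bs + 16) + 1)" (is "runs _ _ _ ?s2 _")
    by (rule runs_match_all[OF assms(1-5) order_refl])
  have 3: "runs ans (rewind tW) ?s2
    ([?I, ([], ws @ Mark 3 # r), rr, k, flag (a \<and> n \<le> 1), flag b, c, flag (0 < n)], q)
    (3 * length ws + 6)" (is "runs _ _ _ ?s3 _")
    by (rule runs_rewind[where xs = ws]) (use assms(4) in \<open>auto simp: stop_def\<close>)
  have 4: "runs ans (Do [(tB, \<lambda>as. (if as ! tD = Bit True then as ! tB else Bit False, Stay))]) ?s3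
    ([?I, ([], ws @ Mark 3 # r), rr, k, flag (a \<and> n \<le> 1), flag (b \<and> 0 < n), c, flag (0 < n)], q) 1" (is "runs _ _ _ ?s4 _")
    by (rule runs_Do) auto
  have 5: "runs ans (move_head tI Right) ?s4
    ([(Mark 2 # li, bs @ ri), ([], ws @ Mark 3 # r), rr, k, flag (a \<and> n \<le> 1), flag (b \<and> 0 < n), c, flag (0 < n)], q) 1"
    by (rule runs_move_head) auto
  show ?thesis unfolding literal_step_def
    by (rule runs_Seq[OF runs_set_D runs_Seqs[OF 2 runs_Seqs[OF 3 runs_Seqs[OF 4 5]]]])
       (use assms(6) in \<open>simp add: algebra_simps\<close>)
qed

definition other_step :: prog where
  "other_step = Do [(tA, \<lambda>as. (if as ! tI = Mark 0 \<and> as ! tB = Bit True then Bit False else as ! tA, Stay)),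
     (tB, \<lambda>as. (if as ! tI = Mark 0 then Bit True else as ! tB, Stay)),
     (tI, \<lambda>as. (as ! tI, Right))]"

definition scan_loop :: prog where
  "scan_loop = Loop (\<lambda>as. as ! tI \<noteq> Mark 3) (Cond (\<lambda>as. as ! tI = Mark 2) literal_step other_step)"

text \<open>\<open>a\<close> is the verdict so far; \<open>b\<close> says that every variable met in
  the current clause is chosen, that is, that its negative literals seen so far are all false. A
  clause is judged when the next one opens, the last one after the end. An empty clause leaves
  \<open>b\<close> true and is rejected, as it should be.\<close>

fun scan_clauses :: "sym list list \<Rightarrow> sym list \<Rightarrow> bool \<times> bool \<Rightarrow> bool \<times> bool" where
  "scan_clauses ws [] s = s"
| "scan_clauses ws (x # xs) (a, b) = scan_clauses ws xs
     (if x = Mark 2 then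
        (a \<and> count_list ws (takeWhile is_bit xs) \<le> 1, b \<and> 0 < count_list ws (takeWhile is_bit xs))
      else if x = Mark 0 then (a \<and> \<not> b, True) else (a, b))"

lemma runs_scan_loop:
  assumes ws: "no_stop ws" "length ws \<le> N"
  shows "no_stop xs \<Longrightarrow> length xs \<le> N \<Longrightarrow> scan_clauses (occs ws) xs (a, b) = (a', b') \<Longrightarrow>
    length xs * (N * (6 * N + 19) + 14) + 1 \<le> T \<Longrightarrow>
    \<exists>d'. runs ans scan_loop
      ([(li, xs @ Mark 3 # kb), ([], ws @ Mark 3 # r), rr, k, flag a, flag b, c, reg d], q)
      ([(rev xs @ li, Mark 3 # kb), ([], ws @ Mark 3 # r), rr, k, flag a', flag b', c, reg d'], q) T"
proof (induction xs arbitrary: li a b d T)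
  case Nil
  have "runs ans scan_loop
    ([(li, [] @ Mark 3 # kb), ([], ws @ Mark 3 # r), rr, k, flag a, flag b, c, reg d], q)
    ([(rev [] @ li, Mark 3 # kb), ([], ws @ Mark 3 # r), rr, k, flag a, flag b, c, reg d], q) T"
    unfolding scan_loop_def by simp (rule runs_LoopF, use Nil in auto)
  then show ?case using Nil.prems(3) by auto
next
  case (Cons x xs)
  let ?W = "([], ws @ Mark 3 # r)" and ?M = "N * (6 * N + 19) + 10"
  let ?bs = "takeWhile is_bit xs" and ?rest = "dropWhile is_bit xs"
  let ?n = "count_list (occs ws) ?bs"
  let ?ab = "if x = Mark 2 then (a \<and> ?n \<le> 1, b \<and> 0 < ?n) else if x = Mark 0 then (a \<and> \<not> b, True) else (a, b)"
  let ?s = "\<lambda>li xs a b d. ([(li, xs @ Mark 3 # kb), ?W, rr, k, flag a, flag b, c, reg d], q)"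
  have x: "x \<noteq> Blank" "x \<noteq> Mark 3" using Cons.prems(1) by (auto simp: stop_def)
  have "\<exists>d1. runs ans (Cond (\<lambda>as. as ! tI = Mark 2) literal_step other_step)
    (?s li (x # xs) a b d) (?s (x # li) xs (fst ?ab) (snd ?ab) d1) (?M + 2)" (is "\<exists>d1. ?R d1")
  proof (cases "x = Mark 2")
    case True
    have rest: "\<not> is_bit (top_sym (?rest @ Mark 3 # kb))" "?rest @ Mark 3 # kb \<noteq> [Blank]"
      using top_dropWhile_is_bit by (simp_all add: append_eq_Cons_conv)
    have bs: "\<forall>x\<in>set ?bs. is_bit x" by (auto dest: set_takeWhileD)
    have "length ?bs \<le> N" using Cons.prems(2) length_takeWhile_le[of is_bit xs] by simp
    then have T: "length ws * (6 * length ?bs + 19) + 10 \<le> ?M"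
      using ws(2) by (intro add_mono mult_le_mono order_refl)
    have 1: "runs ans literal_step
      ([(li, Mark 2 # ?bs @ ?rest @ Mark 3 # kb), ?W, rr, k, flag a, flag b, c, reg d], q)
      ([(Mark 2 # li, ?bs @ ?rest @ Mark 3 # kb), ?W, rr, k,
      flag (a \<and> ?n \<le> 1), flag (b \<and> 0 < ?n), c, flag (0 < ?n)], q) ?M"
      by (rule runs_literal_step[OF bs rest ws(1) refl T])
    have e: "?bs @ ?rest @ Mark 3 # kb = xs @ Mark 3 # kb" by (simp flip: append_assoc)
    have 2: "runs ans literal_step (?s li (x # xs) a b d)
      ([(x # li, xs @ Mark 3 # kb), ?W, rr, k, flag (fst ?ab), flag (snd ?ab), c, flag (0 < ?n)], q) ?M"
      using 1 unfolding e by (simp add: True)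
    show ?thesis
      by (rule exI, rule runs_CondT[OF _ 2]) (use True in simp_all)
  next
    case False
    have 1: "runs ans other_step (?s li (x # xs) a b d) (?s (x # li) xs (fst ?ab) (snd ?ab) d) 1"
      unfolding other_step_def by (rule runs_Do) (use False x in auto)
    show ?thesis
      by (rule exI, rule runs_CondF[OF _ 1]) (use False in simp_all)
  qed
  then obtain d1 where 1: "?R d1" (is "runs _ _ _ ?s1 _")
    by (elim exE) (rule that)
  have "\<exists>d'. runs ans scan_loop (?s (x # li) xs (fst ?ab) (snd ?ab) d1)
    ([(rev xs @ x # li, Mark 3 # kb), ?W, rr, k, flag a', flag b', c, reg d'], q)
    (length xs * (N * (6 * N + 19) + 14) + 1)"
    by (rule Cons.IH) (use Cons.prems in auto)
  then obtain d' where 2: "runs ans scan_loop ?s1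
    ([(rev xs @ x # li, Mark 3 # kb), ?W, rr, k, flag a', flag b', c, reg d'], q)
    (length xs * (N * (6 * N + 19) + 14) + 1)"
    by (elim exE) (rule that)
  have "runs ans scan_loop (?s li (x # xs) a b d)
    ([(rev xs @ x # li, Mark 3 # kb), ?W, rr, k, flag a', flag b', c, reg d'], q) T"
    unfolding scan_loop_def
    by (rule runs_LoopT[OF _ 1 2[unfolded scan_loop_def]]) (use x Cons.prems(4) in auto)
  then show ?case by (intro exI[of _ d']) simp
qed

text \<open>The head on \<open>tK\<close> advances once per chosen occurrence. Their number is
  \<open>k\<close> if it never tries to leave the block of marks and stands on the blank behind it
  at the end.\<close>

definition count_loop :: prog where
  "count_loop = Loop (\<lambda>as. as ! tW \<noteq> Mark 3)
     (Do [(tW, \<lambda>as. (as ! tW, Right)),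
          (tA, \<lambda>as. (if as ! tW = Mark 5 \<and> as ! tK = Blank then Bit False else as ! tA, Stay)),
          (tK, \<lambda>as. (as ! tK, if as ! tW = Mark 5 \<and> as ! tK \<noteq> Blank then Right else Stay))])"

lemma replicate_ne_Blank [simp]: "replicate n (Mark i) \<noteq> [Blank]"
  by (cases n) auto

lemma top_replicate: "top_sym (replicate n x) = (if n = 0 then Blank else x)"
  by (cases n) auto

lemma runs_count_loop:
  "no_stop xs \<Longrightarrow> n = count_list xs (Mark 5) \<Longrightarrow> 3 * length xs + 1 \<le> T \<Longrightarrow>
   runs ans count_loop
     ([i, (lw, xs @ Mark 3 # r), rr, (unary m1, unary m2), flag a, b, c, d], q)
     ([i, (rev xs @ lw, Mark 3 # r), rr,
       (unary (m1 + min n m2), unary (m2 - n)), flag (a \<and> n \<le> m2), b, c, d], q) T"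
proof (induction xs arbitrary: lw n m1 m2 a T)
  case Nil
  then show ?case unfolding count_loop_def by simp (rule runs_LoopF, auto)
next
  case (Cons x xs)
  have x: "x \<noteq> Blank" "x \<noteq> Mark 3" using Cons.prems(1) by (auto simp: stop_def)
  let ?n = "count_list xs (Mark 5)"
  define m1' where "m1' = (if x = Mark 5 \<and> 0 < m2 then Suc m1 else m1)"
  define m2' where "m2' = (if x = Mark 5 then m2 - 1 else m2)"
  define a' where "a' = (a \<and> \<not> (x = Mark 5 \<and> m2 = 0))"
  have IH: "runs ans count_loop
    ([i, (x # lw, xs @ Mark 3 # r), rr, (unary m1', unary m2'), flag a', b, c, d], q)
    ([i, (rev xs @ x # lw, Mark 3 # r), rr,
    (unary (m1' + min ?n m2'), unary (m2' - ?n)), flag (a' \<and> ?n \<le> m2'), b, c, d], q)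
    (3 * length xs + 1)"
    by (rule Cons.IH) (use Cons.prems in auto)
  have e: "m1' + min ?n m2' = m1 + min n m2" "m2' - ?n = m2 - n" "(a' \<and> ?n \<le> m2') = (a \<and> n \<le> m2)"
    using Cons.prems(2) by (auto simp: m1'_def m2'_def a'_def)
  have "runs ans count_loop
    ([i, (lw, (x # xs) @ Mark 3 # r), rr, (unary m1, unary m2), flag a, b, c, d], q)
    ([i, (rev xs @ x # lw, Mark 3 # r), rr,
    (unary (m1 + min n m2), unary (m2 - n)), flag (a \<and> n \<le> m2), b, c, d], q) T"
    unfolding count_loop_def
    by (rule runs_LoopDo[where U = "3 * length xs + 1"])
       (use x IH[unfolded e count_loop_def] Cons.prems(3) in
         \<open>(cases m2; auto simp: m1'_def m2'_def a'_def)+\<close>)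
  then show ?case by simp
qed

definition check :: prog where
  "check = set_reg tA True ;; set_reg tB False ;; count_loop ;;
     Do [(tA, \<lambda>as. (if as ! tK \<noteq> Blank then Bit False else as ! tA, Stay))] ;;
     rewind tK ;; rewind tW ;; scan_loop ;;
     Do [(tA, \<lambda>as. (if as ! tB = Bit True then Bit False else as ! tA, Stay))] ;; rewind tI"

definition valid :: "sym list \<Rightarrow> nat \<Rightarrow> sym list \<Rightarrow> bool" where
  "valid F k ws = (case scan_clauses (occs ws) F (count_list ws (Mark 5) = k, False) of (a, b) \<Rightarrow> a \<and> \<not> b)"

text \<open>The cube arises because every symbol of the formula may trigger a scan of the whole
  mask, with a comparison of words at each marker.\<close>

definition check_time :: "nat \<Rightarrow> nat \<Rightarrow> nat" where
  "check_time N k = N * (N * (6 * N + 19) + 14) + 9 * N + 3 * k + 24"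

lemma runs_check:
  assumes F: "no_stop F" "length F \<le> N" and ws: "no_stop ws" "length ws \<le> N"
  shows "\<exists>b' d'. runs ans check
     ([([], F @ Mark 3 # kb), ([], ws @ Mark 3 # r), rr, ([], unary k), reg a, reg b, c, reg d], q)
     ([([], F @ Mark 3 # kb), ([], ws @ Mark 3 # r), rr, ([], unary k),
       flag (valid F k ws), reg b', c, reg d'], q) (check_time N k)"
proof -
  let ?I = "([], F @ Mark 3 # kb)" and ?W = "([], ws @ Mark 3 # r)" and ?K = "([], unary k)"
  let ?n = "count_list ws (Mark 5)"
  let ?K' = "(unary (0 + min ?n k), unary (k - ?n))"
  let ?W' = "(rev ws @ [], Mark 3 # r)"
  have 3: "runs ans count_loop
    ([?I, ?W, rr, ([], unary k), flag True, flag False, c, reg d], q)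
    ([?I, ?W', rr, ?K', flag (True \<and> ?n \<le> k), flag False, c, reg d], q) (3 * length ws + 1)" (is "runs _ _ _ ?s3 _")
    using runs_count_loop[OF ws(1) refl order_refl, where ?m1.0 = 0 and ?m2.0 = k and a = True and lw = "[]"] by simp
  have 4: "runs ans (Do [(tA, \<lambda>as. (if as ! tK \<noteq> Blank then Bit False else as ! tA, Stay))]) ?s3
    ([?I, ?W', rr, ?K', flag (?n = k), flag False, c, reg d], q) 1" (is "runs _ _ _ ?s4 _")
    by (rule runs_Do) (cases ?n k rule: linorder_cases, auto simp: top_replicate)
  have rep: "unary (min ?n k) @ unary (k - ?n) = unary k"
    by (simp flip: replicate_add)
  have 5: "runs ans (rewind tK) ?s4
    ([?I, ?W', rr, ?K, flag (?n = k), flag False, c, reg d], q) (3 * k + 6)" (is "runs _ _ _ ?s5 _")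
    by (rule runs_rewind[where xs = "unary (min ?n k)" and r = "unary (k - ?n)"])
       (use rep in auto)
  have 6: "runs ans (rewind tW) ?s5
    ([?I, ?W, rr, ?K, flag (?n = k), flag False, c, reg d], q) (3 * length ws + 6)" (is "runs _ _ _ ?s6 _")
    by (rule runs_rewind[where xs = ws and r = "Mark 3 # r"]) (use ws(1) in \<open>auto simp: stop_def\<close>)
  obtain a' b' where ab: "scan_clauses (occs ws) F (?n = k, False) = (a', b')" by fastforce
  obtain d' where 7: "runs ans scan_loop ?s6
    ([(rev F @ [], Mark 3 # kb), ?W, rr, ?K, flag a', flag b', c, reg d'], q)
    (length F * (N * (6 * N + 19) + 14) + 1)" (is "runs _ _ _ ?s7 _")
    using runs_scan_loop[OF ws F ab order_refl, of ans "[]" kb r rr ?K c d q] by (elim exE) (rule that)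
  have 8: "runs ans (Do [(tA, \<lambda>as. (if as ! tB = Bit True then Bit False else as ! tA, Stay))]) ?s7
    ([(rev F @ [], Mark 3 # kb), ?W, rr, ?K, flag (valid F k ws), flag b', c, reg d'], q) 1" (is "runs _ _ _ ?s8 _")
    by (rule runs_Do) (auto simp: valid_def ab)
  have 9: "runs ans (rewind tI) ?s8
    ([?I, ?W, rr, ?K, flag (valid F k ws), flag b', c, reg d'], q) (3 * length F + 6)"
    by (rule runs_rewind[where xs = F and r = "Mark 3 # kb"]) (use F(1) in \<open>auto simp: stop_def\<close>)
  have T: "length F * (N * (6 * N + 19) + 14) \<le> N * (N * (6 * N + 19) + 14)" using F(2) by (rule mult_le_mono1)
  show ?thesis unfolding check_def
    by (rule exI, rule exI, rule runs_Seq[OF runs_set_A runs_Seqs[OF runs_set_B runs_Seqs[OF 3 runs_Seqs[OF 4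
      runs_Seqs[OF 5 runs_Seqs[OF 6 runs_Seqs[OF 7 runs_Seqs[OF 8 9]]]]]]]])
       (use T F(2) ws(2) in \<open>unfold check_time_def, linarith\<close>)
qed

section \<open>Reading pointers from the proof string\<close>

definition query_step :: prog where
  "query_step = Ask tB ;; halve_tape tW ;; move_head tR Right"

text \<open>Only the length of the ruler matters from here on: each of its \<open>h\<close> cells
  triggers one query.\<close>

definition query_loop :: prog where
  "query_loop = Loop (\<lambda>as. as ! tR \<noteq> Blank) query_step"

definition halves :: "sym list \<Rightarrow> bool list \<Rightarrow> sym list" where
  "halves = foldl (\<lambda>xs p. halve p xs)"

lemma halves_simps [simp]: "halves xs [] = xs" "halves xs (p # ps) = halves (halve p xs) ps"
  by (simp_all add: halves_def)

lemma length_halves [simp]: "length (halves xs ps) = length xs"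
  by (induction ps arbitrary: xs) simp_all

lemma not_stop_halves: "no_stop xs \<Longrightarrow> no_stop (halves xs ps)"
proof (induction ps arbitrary: xs)
  case (Cons p ps)
  show ?case using Cons.IH[OF not_stop_halve[OF Cons.prems, of p]] by simp
qed simp

lemma runs_query_loop:
  assumes r: "stop (top_sym r)" "r \<noteq> [Blank]"
  shows "no_stop xs \<Longrightarrow> no_stop ys \<Longrightarrow> length ys * (6 * length xs + 11) + 1 \<le> T \<Longrightarrow>
    \<exists>a' b'. runs ans query_loop
     ([i, ([], xs @ r), (lr, ys), k, flag a, reg b, c, d], q)
     ([i, ([], halves xs (map ans [q..<q + length ys]) @ r), (rev ys @ lr, []), k, flag a', reg b', c, d],
      q + length ys) T"
proof (induction ys arbitrary: xs lr a b q T)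
  case Nil
  have "runs ans query_loop ([i, ([], xs @ r), (lr, []), k, flag a, reg b, c, d], q)
    ([i, ([], xs @ r), (lr, []), k, flag a, reg b, c, d], q) T"
    unfolding query_loop_def by (rule runs_LoopF) (use Nil in auto)
  then show ?case by (intro exI[of _ a] exI[of _ b]) simp
next
  case (Cons y ys)
  have y: "y \<noteq> Blank" using Cons.prems(2) by (auto simp: stop_def)
  have 1: "runs ans (Ask tB)
    ([i, ([], xs @ r), (lr, y # ys), k, flag a, reg b, c, d], q)
    ([i, ([], xs @ r), (lr, y # ys), k, flag a, flag (ans q), c, d], Suc q) 1" (is "runs _ _ _ ?s1 _")
    by (rule runs_Ask) auto
  obtain p' where 2: "runs ans (halve_tape tW) ?s1
    ([i, ([], halve (ans q) xs @ r), (lr, y # ys), k, flag (a \<or> Mark 4 \<in> set xs), flag p', c, d], Suc q)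
    (6 * length xs + 7)"
    using runs_halve_W[OF Cons.prems(1) r, of ans i "(lr, y # ys)" k a "ans q" c d "Suc q"] by (elim exE) (rule that)
  let ?a = "a \<or> Mark 4 \<in> set xs"
  have 3: "runs ans (move_head tR Right)
    ([i, ([], halve (ans q) xs @ r), (lr, y # ys), k, flag ?a, flag p', c, d], Suc q)
    ([i, ([], halve (ans q) xs @ r), (y # lr, ys), k, flag ?a, flag p', c, d], Suc q) 1"
    by (rule runs_move_head) (use y in auto)
  have 4: "runs ans query_step
    ([i, ([], xs @ r), (lr, y # ys), k, flag a, reg b, c, d], q)
    ([i, ([], halve (ans q) xs @ r), (y # lr, ys), k, flag ?a, flag p', c, d], Suc q) (6 * length xs + 9)" (is "runs _ _ _ ?s4 _")
    unfolding query_step_def by (rule runs_Seq[OF 1 runs_Seqs[OF 2 3]]) simp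
  have "\<exists>a' b'. runs ans query_loop
    ([i, ([], halve (ans q) xs @ r), (y # lr, ys), k, flag ?a, flag p', c, d], Suc q)
    ([i, ([], halves (halve (ans q) xs) (map ans [Suc q..<Suc q + length ys]) @ r), (rev ys @ y # lr, []), k, flag a', reg b', c, d],
    Suc q + length ys) (length ys * (6 * length xs + 11) + 1)"
    by (rule Cons.IH[OF not_stop_halve[OF Cons.prems(1)]]) (use Cons.prems(2) in auto)
  then obtain a' b' where 5: "runs ans query_loop ?s4
    ([i, ([], halves (halve (ans q) xs) (map ans [Suc q..<Suc q + length ys]) @ r), (rev ys @ y # lr, []), k, flag a', reg b', c, d],
    Suc q + length ys) (length ys * (6 * length xs + 11) + 1)"
    by (elim exE) (rule that)
  have e: "halves (halve (ans q) xs) (map ans [Suc q..<Suc q + length ys]) = halves xs (map ans [q..<q + length (y # ys)])"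
    by (simp add: upt_conv_Cons del: upt_Suc)
  have "runs ans query_loop
    ([i, ([], xs @ r), (lr, y # ys), k, flag a, reg b, c, d], q)
    ([i, ([], halves (halve (ans q) xs) (map ans [Suc q..<Suc q + length ys]) @ r), (rev ys @ y # lr, []), k, flag a', reg b', c, d],
    Suc q + length ys) T"
    unfolding query_loop_def
    by (rule runs_LoopT[OF _ 4 5[unfolded query_loop_def]]) (use y Cons.prems(3) in auto)
  then show ?case unfolding e by (intro exI[of _ a'] exI[of _ b']) simp
qed

text \<open>Every occurrence not yet chosen becomes a candidate again. There are at most
  \<open>2 ^ h\<close> of them, so \<open>h\<close> halvings leave at most one, which is then
  chosen. Bad answers may leave none; too few occurrences are then chosen in the end and
  \<open>check\<close> rejects.\<close>

definition guess_step :: prog where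
  "guess_step = sweep revive ;; query_loop ;; rewind tR ;; sweep pick_alive ;; move_head tK Right"

definition guess_loop :: prog where
  "guess_loop = Loop (\<lambda>as. as ! tK \<noteq> Blank) guess_step"

definition guess :: prog where
  "guess = guess_loop ;; rewind tK"

fun guesses :: "(nat \<Rightarrow> bool) \<Rightarrow> nat \<Rightarrow> nat \<Rightarrow> nat \<Rightarrow> sym list \<Rightarrow> sym list" where
  "guesses ans h 0 q xs = xs"
| "guesses ans h (Suc n) q xs =
     guesses ans h n (q + h) (map pick_alive (halves (map revive xs) (map ans [q..<q + h])))"

lemma length_guesses [simp]: "length (guesses ans h n q xs) = length xs"
  by (induction n arbitrary: q xs) simp_all

lemma not_stop_revive: "no_stop xs \<Longrightarrow> no_stop (map revive xs)"
  by (auto simp: stop_def revive_def)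

lemma not_stop_pick_alive: "no_stop xs \<Longrightarrow> no_stop (map pick_alive xs)"
  by (auto simp: stop_def pick_alive_def)

lemma not_stop_guesses: "no_stop xs \<Longrightarrow> no_stop (guesses ans h n q xs)"
proof (induction n arbitrary: q xs)
  case (Suc n)
  show ?case
    using Suc.IH[OF not_stop_pick_alive[OF not_stop_halves[OF not_stop_revive[OF Suc.prems]]]] by simp
qed simp

lemma runs_guess_step:
  assumes xs: "no_stop xs" and ys: "no_stop ys"
    and T: "length ys * (6 * length xs + 14) + 12 * length xs + 22 \<le> T"
  shows "\<exists>a' b'. runs ans guess_step
     ([i, ([], xs @ Mark 3 # r), ([], ys), (lk, Mark 0 # rk), flag a, reg b, c, d], q)
     ([i, ([], map pick_alive (halves (map revive xs) (map ans [q..<q + length ys])) @ Mark 3 # r), ([], ys), (Mark 0 # lk, rk),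
       flag a', reg b', c, d], q + length ys) T"
proof -
  let ?r = "Mark 3 # r" and ?K = "(lk, Mark 0 # rk)"
  let ?h = "halves (map revive xs) (map ans [q..<q + length ys])"
  have 1: "runs ans (sweep revive)
    ([i, ([], xs @ ?r), ([], ys), ?K, flag a, reg b, c, d], q)
    ([i, ([], map revive xs @ ?r), ([], ys), ?K, flag a, reg b, c, d], q) (6 * length xs + 7)" (is "runs _ _ _ ?s1 _")
    by (rule runs_sweep) (use xs in \<open>auto simp: stop_def revive_def\<close>)
  have r: "stop (top_sym ?r)" "?r \<noteq> [Blank]" by (simp_all add: stop_def)
  obtain a' b' where 2: "runs ans query_loop ?s1
    ([i, ([], ?h @ ?r), (rev ys @ [], []), ?K, flag a', reg b', c, d], q + length ys)
    (length ys * (6 * length (map revive xs) + 11) + 1)" (is "runs _ _ _ ?s2 _")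
    using runs_query_loop[OF r not_stop_revive[OF xs] ys order_refl, of ans i "[]" ?K a b c d q]
    by (elim exE) (rule that)
  have 3: "runs ans (rewind tR) ?s2
    ([i, ([], ?h @ ?r), ([], ys), ?K, flag a', reg b', c, d], q + length ys) (3 * length ys + 6)" (is "runs _ _ _ ?s3 _")
    by (rule runs_rewind[where xs = ys and r = "[]"]) (use ys in \<open>auto simp: stop_def\<close>)
  have 4: "runs ans (sweep pick_alive) ?s3
    ([i, ([], map pick_alive ?h @ ?r), ([], ys), ?K, flag a', reg b', c, d], q + length ys) (6 * length xs + 7)" (is "runs _ _ _ ?s4 _")
    by (rule runs_sweep)
       (use not_stop_halves[OF not_stop_revive[OF xs], of "map ans [q..<q + length ys]"] in
         \<open>auto simp: stop_def pick_alive_def simp del: upt_Suc\<close>)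
  have 5: "runs ans (move_head tK Right) ?s4
    ([i, ([], map pick_alive ?h @ ?r), ([], ys), (Mark 0 # lk, rk), flag a', reg b', c, d], q + length ys) 1"
    by (rule runs_move_head) auto
  show ?thesis unfolding guess_step_def
    by (rule exI, rule exI, rule runs_Seq[OF 1 runs_Seqs[OF 2 runs_Seqs[OF 3 runs_Seqs[OF 4 5]]]])
       (use T in \<open>simp add: algebra_simps\<close>)
qed

lemma runs_guess_loop:
  assumes ys: "no_stop ys"
  shows "no_stop xs \<Longrightarrow> n * (length ys * (6 * length xs + 14) + 12 * length xs + 24) + 1 \<le> T \<Longrightarrow>
    \<exists>a' b'. runs ans guess_loop
     ([i, ([], xs @ Mark 3 # r), ([], ys), (lk, unary n), flag a, reg b, c, d], q)
     ([i, ([], guesses ans (length ys) n q xs @ Mark 3 # r), ([], ys), (unary n @ lk, []),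
       flag a', reg b', c, d], q + n * length ys) T"
proof (induction n arbitrary: xs lk a b q T)
  case 0
  have "runs ans guess_loop
    ([i, ([], xs @ Mark 3 # r), ([], ys), (lk, []), flag a, reg b, c, d], q)
    ([i, ([], xs @ Mark 3 # r), ([], ys), (lk, []), flag a, reg b, c, d], q) T"
    unfolding guess_loop_def by (rule runs_LoopF) (use 0 in auto)
  then show ?case by (intro exI[of _ a] exI[of _ b]) simp
next
  case (Suc n)
  let ?r = "Mark 3 # r"
  let ?xs = "map pick_alive (halves (map revive xs) (map ans [q..<q + length ys]))"
  let ?M = "length ys * (6 * length xs + 14) + 12 * length xs + 22"
  obtain a1 b1 where 1: "runs ans guess_step
    ([i, ([], xs @ ?r), ([], ys), (lk, Mark 0 # unary n), flag a, reg b, c, d], q)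
    ([i, ([], ?xs @ ?r), ([], ys), (Mark 0 # lk, unary n), flag a1, reg b1, c, d], q + length ys) ?M" (is "runs _ _ _ ?s1 _")
    using runs_guess_step[OF Suc.prems(1) ys order_refl, of ans i r lk "unary n" a b c d q]
    by (elim exE) (rule that)
  have "\<exists>a' b'. runs ans guess_loop
    ([i, ([], ?xs @ ?r), ([], ys), (Mark 0 # lk, unary n), flag a1, reg b1, c, d], q + length ys)
    ([i, ([], guesses ans (length ys) n (q + length ys) ?xs @ ?r), ([], ys), (unary n @ Mark 0 # lk, []),
    flag a', reg b', c, d], q + length ys + n * length ys) (n * (?M + 2) + 1)"
    by (rule Suc.IH[OF not_stop_pick_alive[OF not_stop_halves[OF not_stop_revive[OF Suc.prems(1)]]]]) simp
  then obtain a' b' where 2: "runs ans guess_loop ?s1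
    ([i, ([], guesses ans (length ys) n (q + length ys) ?xs @ ?r), ([], ys), (unary n @ Mark 0 # lk, []),
    flag a', reg b', c, d], q + length ys + n * length ys) (n * (?M + 2) + 1)"
    by (elim exE) (rule that)
  have "runs ans guess_loop
    ([i, ([], xs @ ?r), ([], ys), (lk, Mark 0 # unary n), flag a, reg b, c, d], q)
    ([i, ([], guesses ans (length ys) n (q + length ys) ?xs @ ?r), ([], ys), (unary n @ Mark 0 # lk, []),
    flag a', reg b', c, d], q + length ys + n * length ys) T"
    unfolding guess_loop_def
    by (rule runs_LoopT[OF _ 1 2[unfolded guess_loop_def]]) (use Suc.prems(2) in \<open>auto simp: algebra_simps\<close>)
  then show ?case
    by (intro exI[of _ a'] exI[of _ b']) (simp add: replicate_app_Cons_same algebra_simps)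
qed

lemma runs_guess:
  assumes ys: "no_stop ys" and xs: "no_stop xs"
    and T: "n * (length ys * (6 * length xs + 14) + 12 * length xs + 27) + 7 \<le> T"
  shows "\<exists>a' b'. runs ans guess
     ([i, ([], xs @ Mark 3 # r), ([], ys), ([], unary n), flag a, reg b, c, d], q)
     ([i, ([], guesses ans (length ys) n q xs @ Mark 3 # r), ([], ys), ([], unary n),
       flag a', reg b', c, d], q + n * length ys) T"
proof -
  let ?W = "([], guesses ans (length ys) n q xs @ Mark 3 # r)"
  obtain a' b' where 1: "runs ans guess_loop
    ([i, ([], xs @ Mark 3 # r), ([], ys), ([], unary n), flag a, reg b, c, d], q)
    ([i, ?W, ([], ys), (unary n @ [], []), flag a', reg b', c, d], q + n * length ys)
    (n * (length ys * (6 * length xs + 14) + 12 * length xs + 24) + 1)" (is "runs _ _ _ ?s1 _")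
    using runs_guess_loop[OF ys xs order_refl, of ans i r "[]" n a b c d q] by (elim exE) (rule that)
  have 2: "runs ans (rewind tK) ?s1
    ([i, ?W, ([], ys), ([], unary n), flag a', reg b', c, d], q + n * length ys) (3 * n + 6)"
    by (rule runs_rewind[where xs = "unary n" and r = "[]"]) auto
  show ?thesis unfolding guess_def
    by (rule exI, rule exI, rule runs_Seq[OF 1 2]) (use T in \<open>simp add: algebra_simps\<close>)
qed

section \<open>Exhaustive search with a binary counter\<close>

fun incr :: "bool \<Rightarrow> sym list \<Rightarrow> sym list" where
  "incr c [] = []"
| "incr c (x # xs) =
     (if c \<and> x = Mark 2 then Mark 5 else if c \<and> x = Mark 5 then Mark 2 else x) # incr (c \<and> x \<noteq> Mark 2) xs"

lemma length_incr [simp]: "length (incr c xs) = length xs"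
  by (induction xs arbitrary: c) auto

lemma set_incr: "set (incr c xs) \<subseteq> {Mark 2, Mark 5} \<union> set xs"
proof (induction xs arbitrary: c)
  case (Cons x xs)
  from Cons[of "c \<and> x \<noteq> Mark 2"] show ?case by auto
qed simp

lemma not_stop_incr: "no_stop xs \<Longrightarrow> no_stop (incr c xs)"
  using set_incr[of c xs] by (auto simp: stop_def)

definition incr_loop :: prog where
  "incr_loop = Loop (\<lambda>as. as ! tW \<noteq> Mark 3)
     (Do [(tW, \<lambda>as. (if as ! tC = Bit True \<and> as ! tW = Mark 2 then Mark 5
            else if as ! tC = Bit True \<and> as ! tW = Mark 5 then Mark 2 else as ! tW, Right)),
          (tC, \<lambda>as. (if as ! tW = Mark 2 then Bit False else as ! tC, Stay))])"

lemma runs_incr_loop: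
  "no_stop xs \<Longrightarrow> 3 * length xs + 1 \<le> T \<Longrightarrow>
   runs ans incr_loop
     ([i, (lw, xs @ Mark 3 # r), rr, k, a, b, flag c, d], q)
     ([i, (rev (incr c xs) @ lw, Mark 3 # r), rr, k, a, b, flag (c \<and> Mark 2 \<notin> set xs), d], q) T"
proof (induction xs arbitrary: lw c T)
  case Nil
  then show ?case unfolding incr_loop_def by simp (rule runs_LoopF, auto)
next
  case (Cons x xs)
  have x: "x \<noteq> Blank" "x \<noteq> Mark 3" using Cons.prems(1) by (auto simp: stop_def)
  let ?y = "if c \<and> x = Mark 2 then Mark 5 else if c \<and> x = Mark 5 then Mark 2 else x"
  have IH: "runs ans incr_loop
    ([i, (?y # lw, xs @ Mark 3 # r), rr, k, a, b, flag (c \<and> x \<noteq> Mark 2), d], q)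
    ([i, (rev (incr (c \<and> x \<noteq> Mark 2) xs) @ ?y # lw, Mark 3 # r), rr, k, a, b,
    flag ((c \<and> x \<noteq> Mark 2) \<and> Mark 2 \<notin> set xs), d], q) (3 * length xs + 1)"
    by (rule Cons.IH) (use Cons.prems in auto)
  have e: "zexec [(tW, \<lambda>as. (if as ! tC = Bit True \<and> as ! tW = Mark 2 then Mark 5
    else if as ! tC = Bit True \<and> as ! tW = Mark 5 then Mark 2 else as ! tW, Right)),
    (tC, \<lambda>as. (if as ! tW = Mark 2 then Bit False else as ! tC, Stay))]
    [i, (lw, (x # xs) @ Mark 3 # r), rr, k, a, b, flag c, d] =
    [i, (?y # lw, xs @ Mark 3 # r), rr, k, a, b, flag (c \<and> x \<noteq> Mark 2), d]"
    using x by (cases c) auto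
  have e2: "rev (incr (c \<and> x \<noteq> Mark 2) xs) @ ?y # lw = rev (incr c (x # xs)) @ lw" by simp
  have e3: "((c \<and> x \<noteq> Mark 2) \<and> Mark 2 \<notin> set xs) = (c \<and> Mark 2 \<notin> set (x # xs))" by auto
  show ?case
    unfolding incr_loop_def
    by (rule runs_LoopDo[where U = "3 * length xs + 1"], simp add: x, unfold e,
        rule IH[unfolded e2 e3 incr_loop_def]) (use Cons.prems(2) in simp)
qed

definition search_step :: prog where
  "search_step = set_reg tC True ;; incr_loop ;; rewind tW ;; Cond (\<lambda>as. as ! tC = Bit True) (Do []) check"

definition search_loop :: prog where
  "search_loop = Loop (\<lambda>as. as ! tA \<noteq> Bit True \<and> as ! tC \<noteq> Bit True) search_step"

definition search :: prog where
  "search = check ;; set_reg tC False ;; search_loop"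

fun mask_value :: "sym list \<Rightarrow> nat" where
  "mask_value [] = 0"
| "mask_value (x # xs) =
     (if x = Mark 2 then 2 * mask_value xs else if x = Mark 5 then 1 + 2 * mask_value xs else mask_value xs)"

fun mask_size :: "sym list \<Rightarrow> nat" where
  "mask_size [] = 0"
| "mask_size (x # xs) = of_bool (x = Mark 2 \<or> x = Mark 5) + mask_size xs"

lemma mask_size_incr [simp]: "mask_size (incr c xs) = mask_size xs"
  by (induction xs arbitrary: c) auto

lemma mask_value_less: "mask_value xs < 2 ^ mask_size xs"
  by (induction xs) auto

lemma incr_False [simp]: "incr False xs = xs"
  by (induction xs) auto

text \<open>The mask is a binary counter with digits \<open>Mark 2\<close> (zero) and
  \<open>Mark 5\<close> (one), least significant first; the carry passes through all other symbols
  unchanged. Without a \<open>Mark 2\<close> the counter is full and wraps around to zero.\<close>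

lemma mask_value_incr:
  "mask_value (incr True xs) + of_bool (Mark 2 \<notin> set xs) * 2 ^ mask_size xs = Suc (mask_value xs)"
proof (induction xs)
  case (Cons x xs)
  consider "x = Mark 2" | "x = Mark 5" | "x \<noteq> Mark 2" "x \<noteq> Mark 5" by blast
  then show ?case
  proof cases
    case 2
    with Cons show ?thesis by (cases "Mark 2 \<in> set xs") simp_all
  next
    case 3
    with Cons show ?thesis by (cases "Mark 2 \<in> set xs") simp_all
  qed simp
qed simp

text \<open>\<open>n\<close> is the number of masks from the current one, whose verdict is already
  in \<open>tA\<close>, up to the last. The loop ends with a success or with the overflow reported
  in \<open>tC\<close>.\<close>

lemma runs_search_loop:
  fixes F N k
  defines "M \<equiv> check_time N k + 6 * N + 14"
  assumes F: "no_stop F" "length F \<le> N"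
  shows "no_stop ws \<Longrightarrow> length ws \<le> N \<Longrightarrow> n = 2 ^ mask_size ws - mask_value ws \<Longrightarrow> n * M + 1 \<le> T \<Longrightarrow>
    \<exists>ws' b' c' d'. runs ans search_loop
     ([([], F @ Mark 3 # kb), ([], ws @ Mark 3 # r), rr, ([], unary k),
       flag (valid F k ws), reg b, flag False, reg d], q)
     ([([], F @ Mark 3 # kb), ([], ws' @ Mark 3 # r), rr, ([], unary k),
       flag (\<exists>i<n. valid F k ((incr True ^^ i) ws)), reg b', reg c', reg d'], q) T"
proof (induction n arbitrary: ws b d T)
  case 0
  then show ?case using mask_value_less[of ws] by simp
next
  case (Suc n)
  let ?I = "([], F @ Mark 3 # kb)" and ?K = "([], unary k)" and ?r = "Mark 3 # r"
  let ?s = "\<lambda>ws v b c d. ([?I, ([], ws @ ?r), rr, ?K, flag v, reg b, flag c, reg d], q)"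
  show ?case
  proof (cases "valid F k ws")
    case True
    then have "0 < Suc n \<and> valid F k ((incr True ^^ 0) ws)" by simp
    then have e: "(\<exists>i<Suc n. valid F k ((incr True ^^ i) ws)) = True" by blast
    have "runs ans search_loop (?s ws True b False d) (?s ws True b False d) T"
      unfolding search_loop_def by (rule runs_LoopF) (use Suc.prems(4) in auto)
    then show ?thesis unfolding e using True
      by (intro exI[of _ ws] exI[of _ b] exI[of _ "Bit False"] exI[of _ d]) simp
  next
    case False
    let ?c = "Mark 2 \<notin> set ws" and ?ws = "incr True ws"
    have 2: "runs ans incr_loop (?s ws False b True d)
      ([?I, (rev ?ws @ [], ?r), rr, ?K, flag False, reg b, flag (True \<and> ?c), reg d], q) (3 * length ws + 1)" (is "runs _ _ _ ?s2 _")
      by (rule runs_incr_loop[OF Suc.prems(1) order_refl])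
    have nb: "Blank \<notin> set ?ws" using not_stop_incr[OF Suc.prems(1)] by (auto simp: stop_def)
    have 3: "runs ans (rewind tW) ?s2 (?s ?ws False b ?c d) (3 * length ws + 6)"
      by (rule runs_rewind[where xs = ?ws and r = ?r]) (use nb in auto)
    note mv = mask_value_incr[of ws] mask_value_less[of ?ws] mask_value_less[of ws]
    have M: "1 + (3 * length ws + 1 + (3 * length ws + 6 + (check_time N k + 1))) + 2 \<le> M"
      using Suc.prems(2) by (simp add: M_def)
    show ?thesis
    proof (cases ?c)
      case True
      \<comment> \<open>An overflow means that the current mask had the maximal value
        \<open>2 ^ mask_size ws - 1\<close>, so nothing is left to try.\<close>
      then have n: "n = 0" using mv Suc.prems(3) by simp
      then have e: "(\<exists>i<Suc n. valid F k ((incr True ^^ i) ws)) = False" using False by simp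
      have 4: "runs ans (Cond (\<lambda>as. as ! tC = Bit True) (Do []) check)
        (?s ?ws False b ?c d) (?s ?ws False b True d) 3"
        by (rule runs_CondT[OF _ runs_Do[OF _ order_refl]]) (use True in auto)
      have 5: "runs ans search_step (?s ws False b False d) (?s ?ws False b True d) (6 * length ws + 11)" (is "runs _ _ _ ?s5 _")
        unfolding search_step_def
        by (rule runs_Seq[OF runs_set_C runs_Seqs[OF 2 runs_Seqs[OF 3 4]]]) simp
      have 6: "runs ans search_loop ?s5 (?s ?ws False b True d) 1"
        unfolding search_loop_def by (rule runs_LoopF) auto
      have "runs ans search_loop (?s ws False b False d) (?s ?ws False b True d) T"
        unfolding search_loop_def
        by (rule runs_LoopT[OF _ 5 6[unfolded search_loop_def]])
           (use Suc.prems(2,4) n in \<open>simp_all add: M_def check_time_def\<close>)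
      then show ?thesis unfolding e using False
        by (intro exI[of _ ?ws] exI[of _ b] exI[of _ "Bit True"] exI[of _ d]) simp
    next
      case c: False
      then have n: "n = 2 ^ mask_size ?ws - mask_value ?ws" using mv Suc.prems(3) by simp
      have e: "(\<exists>i<Suc n. valid F k ((incr True ^^ i) ws)) = (\<exists>i<n. valid F k ((incr True ^^ i) ?ws))"
        using False by (simp add: Ex_less_Suc2 funpow_Suc_right del: funpow.simps)
      have len: "length ?ws \<le> N" using Suc.prems(2) by simp
      obtain b1 d1 where 4: "runs ans check (?s ?ws False b ?c d) (?s ?ws (valid F k ?ws) b1 ?c d1) (check_time N k)"
        using runs_check[OF F not_stop_incr[OF Suc.prems(1), of True] len, of ans kb r rr k "Bit False" b "flag ?c" d q]
        by (elim exE) (rule that)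
      have 5: "runs ans (Cond (\<lambda>as. as ! tC = Bit True) (Do []) check)
        (?s ?ws False b ?c d) (?s ?ws (valid F k ?ws) b1 ?c d1) (check_time N k + 1)"
        by (rule runs_CondF[OF _ 4]) (use c in auto)
      have 6: "runs ans search_step (?s ws False b False d) (?s ?ws (valid F k ?ws) b1 ?c d1)
        (1 + (3 * length ws + 1 + (3 * length ws + 6 + (check_time N k + 1))))"
        unfolding search_step_def
        by (rule runs_Seqs[OF runs_set_C runs_Seqs[OF 2 runs_Seqs[OF 3 5]]])
      have "\<exists>ws' b' c' d'. runs ans search_loop (?s ?ws (valid F k ?ws) b1 False d1)
        ([?I, ([], ws' @ ?r), rr, ?K, flag (\<exists>i<n. valid F k ((incr True ^^ i) ?ws)), reg b', reg c', reg d'], q) (n * M + 1)" (is "\<exists>ws' b' c' d'. ?R ws' b' c' d'")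
        by (rule Suc.IH[OF not_stop_incr[OF Suc.prems(1)] _ n order_refl]) (use Suc.prems(2) in simp)
      then obtain ws' b' c' d' where 7: "?R ws' b' c' d'"
        by (elim exE) (rule that)
      have c': "?c = False" using c by simp
      have "runs ans search_loop (?s ws False b False d)
        ([?I, ([], ws' @ ?r), rr, ?K, flag (\<exists>i<n. valid F k ((incr True ^^ i) ?ws)), reg b', reg c', reg d'], q) T"
        unfolding search_loop_def
        by (rule runs_LoopT[OF _ 6[unfolded c'] 7[unfolded search_loop_def]])
           (use Suc.prems(4) M in simp_all)
      then show ?thesis unfolding e using False
        by (intro exI[of _ ws'] exI[of _ b'] exI[of _ c'] exI[of _ d']) simp
    qed
  qed
qed

lemma runs_search:
  assumes F: "no_stop F" "length F \<le> N" and ws: "no_stop ws" "length ws \<le> N"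
    and n: "n = 2 ^ mask_size ws - mask_value ws"
    and T: "Suc n * (check_time N k + 6 * N + 14) + 2 \<le> T"
  shows "\<exists>ws' b' c' d'. runs ans search
     ([([], F @ Mark 3 # kb), ([], ws @ Mark 3 # r), rr, ([], unary k), reg a, reg b, reg c, reg d], q)
     ([([], F @ Mark 3 # kb), ([], ws' @ Mark 3 # r), rr, ([], unary k),
       flag (\<exists>i<n. valid F k ((incr True ^^ i) ws)), reg b', reg c', reg d'], q) T"
proof -
  let ?I = "([], F @ Mark 3 # kb)" and ?K = "([], unary k)" and ?r = "Mark 3 # r"
  obtain b1 d1 where 1: "runs ans check
    ([?I, ([], ws @ ?r), rr, ?K, reg a, reg b, reg c, reg d], q)
    ([?I, ([], ws @ ?r), rr, ?K, flag (valid F k ws), reg b1, reg c, reg d1], q) (check_time N k)"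
    using runs_check[OF F ws, of ans kb r rr k a b "reg c" d q] by (elim exE) (rule that)
  obtain ws' b' c' d' where 2: "runs ans search_loop
    ([?I, ([], ws @ ?r), rr, ?K, flag (valid F k ws), reg b1, flag False, reg d1], q)
    ([?I, ([], ws' @ ?r), rr, ?K, flag (\<exists>i<n. valid F k ((incr True ^^ i) ws)), reg b', reg c', reg d'], q)
    (n * (check_time N k + 6 * N + 14) + 1)"
    using runs_search_loop[OF F ws n order_refl, of ans kb r rr k b1 d1 q] by (elim exE) (rule that)
  show ?thesis unfolding search_def
    by (rule exI, rule exI, rule exI, rule exI, rule runs_Seq[OF 1 runs_Seqs[OF runs_set_C 2]]) (use T in simp)
qed

section \<open>Symbol lists, formulas and assignments\<close>

text \<open>Forgets the choices. Masks obtained by guessing or by counting agree with the formula up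
  to \<open>unmark\<close>, and this is all that soundness will use about them.\<close>

definition unmark :: "sym \<Rightarrow> sym" where
  "unmark x = (if x = Mark 4 \<or> x = Mark 5 then Mark 2 else x)"

lemma unmark_revive [simp]: "unmark (revive x) = unmark x"
  by (simp add: unmark_def revive_def)

lemma unmark_pick_alive [simp]: "unmark (pick_alive x) = unmark x"
  by (simp add: unmark_def pick_alive_def)

lemma unmark_halve [simp]: "map unmark (halve p xs) = map unmark xs"
proof (induction xs arbitrary: p)
  case (Cons x xs)
  then show ?case by (simp add: unmark_def)
qed simp

lemma unmark_halves [simp]: "map unmark (halves xs ps) = map unmark xs"
  by (induction ps arbitrary: xs) simp_all

lemma unmark_guesses: "map unmark (guesses ans h n q xs) = map unmark xs"
proof (induction n arbitrary: q xs)
  case (Suc n)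
  have "map unmark (map f xs) = map unmark xs" if "\<And>x. unmark (f x) = unmark x" for f xs
    using that by simp
  then show ?case using Suc by (simp del: map_map add: upt_Suc)
qed simp

lemma unmark_incr [simp]: "map unmark (incr c xs) = map unmark xs"
proof (induction xs arbitrary: c)
  case (Cons x xs)
  then show ?case by (simp add: unmark_def)
qed simp

lemma unmark_incr_funpow: "map unmark ((incr True ^^ i) xs) = map unmark xs"
  by (induction i) simp_all

lemma mask_size_incr_funpow: "mask_size ((incr True ^^ i) xs) = mask_size xs"
  by (induction i) simp_all

lemma mask_value_incr_funpow:
  "mask_value xs + i < 2 ^ mask_size xs \<Longrightarrow> mask_value ((incr True ^^ i) xs) = mask_value xs + i"
proof (induction i)
  case (Suc i)
  let ?ys = "(incr True ^^ i) xs"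
  have v: "mask_value ?ys = mask_value xs + i" using Suc by simp
  have "mask_value (incr True ?ys) + of_bool (Mark 2 \<notin> set ?ys) * 2 ^ mask_size xs = Suc (mask_value xs + i)"
    using mask_value_incr[of ?ys] v by (simp add: mask_size_incr_funpow)
  then show ?case using Suc.prems by (cases "Mark 2 \<in> set ?ys") auto
qed simp

text \<open>Uniqueness of binary expansions: parity determines the first digit. Together with
  counting up from zero it shows that the search meets every mask.\<close>

lemma mask_eqI:
  "map unmark xs = map unmark ys \<Longrightarrow> mask_value xs = mask_value ys \<Longrightarrow>
   Mark 4 \<notin> set xs \<Longrightarrow> Mark 4 \<notin> set ys \<Longrightarrow> xs = ys"
proof (induction xs arbitrary: ys)
  case (Cons x xs)
  then obtain y ys' where ys: "ys = y # ys'" by (cases ys) auto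
  have u: "unmark x = unmark y" "map unmark xs = map unmark ys'" using Cons.prems(1) ys by auto
  have n4: "x \<noteq> Mark 4" "y \<noteq> Mark 4" "Mark 4 \<notin> set xs" "Mark 4 \<notin> set ys'"
    using Cons.prems(3,4) ys by auto
  have "x = y \<or> (x = Mark 2 \<and> y = Mark 5) \<or> (x = Mark 5 \<and> y = Mark 2)"
    using u(1) n4 by (auto simp: unmark_def split: if_splits)
  then have "x = y \<and> mask_value xs = mask_value ys'"
  proof (elim disjE conjE)
    assume "x = y"
    then show ?thesis using Cons.prems(2) ys by (auto split: if_splits)
  next
    assume "x = Mark 2" "y = Mark 5"
    then have "2 * mask_value xs = 1 + 2 * mask_value ys'" using Cons.prems(2) ys by simp
    then show ?thesis by presburger
  next
    assume "x = Mark 5" "y = Mark 2"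
    then have "1 + 2 * mask_value xs = 2 * mask_value ys'" using Cons.prems(2) ys by simp
    then show ?thesis by presburger
  qed
  then show ?case using Cons.IH u(2) n4 ys by simp
qed simp

lemma mask_size_unmark: "map unmark xs = map unmark ys \<Longrightarrow> Mark 4 \<notin> set xs \<Longrightarrow> Mark 4 \<notin> set ys \<Longrightarrow>
  mask_size xs = mask_size ys"
proof (induction xs arbitrary: ys)
  case (Cons x xs)
  then obtain y ys' where ys: "ys = y # ys'" by (cases ys) auto
  have "mask_size xs = mask_size ys'" by (rule Cons.IH) (use Cons.prems ys in auto)
  moreover have "(x = Mark 2 \<or> x = Mark 5) = (y = Mark 2 \<or> y = Mark 5)"
    using Cons.prems ys by (auto simp: unmark_def split: if_splits)
  ultimately show ?case using ys by simp
qed simp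

lemma Mark4_incr: "Mark 4 \<notin> set xs \<Longrightarrow> Mark 4 \<notin> set ((incr True ^^ i) xs)"
proof (induction i)
  case (Suc i)
  then show ?case using set_incr[of True "(incr True ^^ i) xs"] by auto
qed simp

lemma incr_reaches:
  assumes "map unmark ws = map unmark xs" "Mark 4 \<notin> set ws" "Mark 4 \<notin> set xs" "mask_value xs = 0"
  shows "\<exists>i<2 ^ mask_size xs. (incr True ^^ i) xs = ws"
proof (intro exI conjI)
  let ?i = "mask_value ws"
  show lt: "?i < 2 ^ mask_size xs" using mask_value_less[of ws] mask_size_unmark[OF assms(1-3)] by simp
  show "(incr True ^^ ?i) xs = ws"
  proof (rule mask_eqI)
    show "map unmark ((incr True ^^ ?i) xs) = map unmark ws" using assms(1) by (simp add: unmark_incr_funpow)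
    show "mask_value ((incr True ^^ ?i) xs) = mask_value ws"
      using mask_value_incr_funpow[of xs ?i] lt assms(4) by simp
  qed (use assms Mark4_incr in auto)
qed

section \<open>Pointers can select any occurrence\<close>

lemma halve_keeps: "p < length ys \<Longrightarrow> ys ! p = Mark 4 \<Longrightarrow> \<exists>b. halve b ys ! p = Mark 4"
proof (induction ys arbitrary: p)
  case (Cons y ys)
  show ?case
  proof (cases p)
    case 0
    then have "halve True (y # ys) ! p = Mark 4" using Cons.prems by simp
    then show ?thesis by blast
  next
    case (Suc p')
    then obtain b where "halve b ys ! p' = Mark 4" using Cons.IH[of p'] Cons.prems by auto
    then have "halve (if y = Mark 4 then \<not> b else b) (y # ys) ! p = Mark 4" using Suc by simp
    then show ?thesis by blast
  qed
qed simp

lemma kill_unique: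
  "p < length ys \<Longrightarrow> ys ! p = Mark 4 \<Longrightarrow> count_list ys (Mark 4) \<le> 1 \<Longrightarrow> (map kill ys)[p := Mark 4] = ys"
proof (induction ys arbitrary: p)
  case (Cons y ys)
  show ?case
  proof (cases p)
    case 0
    then have "Mark 4 \<notin> set ys" using Cons.prems by (auto simp flip: count_list_0_iff)
    then show ?thesis using 0 Cons.prems kill_id by simp
  next
    case (Suc p')
    then have "Mark 4 \<in> set ys" using Cons.prems by (metis length_Cons Suc_less_eq nth_Cons_Suc nth_mem)
    then have "0 < count_list ys (Mark 4)" by (metis count_list_0_iff neq0_conv)
    then have "y \<noteq> Mark 4" using Cons.prems(3) by auto
    then show ?thesis using Suc Cons by (simp add: kill_def)
  qed
qed simp

text \<open>The two parities keep complementary sets of candidates, so some bit always keeps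
  position \<open>p\<close>. Either parity leaves at most half of the candidates, rounded up, so a
  bound \<open>2 ^ h\<close> drops to \<open>2 ^ (h - 1)\<close>, and after \<open>h\<close> bits
  only \<open>p\<close> remains.\<close>

lemma halves_select:
  "p < length ys \<Longrightarrow> ys ! p = Mark 4 \<Longrightarrow> count_list ys (Mark 4) \<le> 2 ^ h \<Longrightarrow>
   \<exists>ps. length ps = h \<and> halves ys ps = (map kill ys)[p := Mark 4]"
proof (induction h arbitrary: ys)
  case 0
  then show ?case using kill_unique[of p ys] by simp
next
  case (Suc h)
  obtain b where b: "halve b ys ! p = Mark 4" using halve_keeps Suc.prems by blast
  have "count_list (halve b ys) (Mark 4) \<le> 2 ^ h" using Suc.prems(3) by (cases b) (simp_all add: count_halve)
  then obtain ps where "length ps = h" "halves (halve b ys) ps = (map kill ys)[p := Mark 4]"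
    using Suc.IH[of "halve b ys"] b Suc.prems(1) by auto
  then show ?case by (intro exI[of _ "b # ps"]) simp
qed

lemma guess_one:
  assumes p: "p < length xs" "xs ! p = Mark 2" and n4: "Mark 4 \<notin> set xs" and h: "count_list xs (Mark 2) \<le> 2 ^ h"
  shows "\<exists>ps. length ps = h \<and> map pick_alive (halves (map revive xs) ps) = xs[p := Mark 5]"
proof -
  have "count_list (map revive xs) (Mark 4) = count_list xs (Mark 2)"
    using n4 by (induction xs) (auto simp: revive_def)
  then obtain ps where ps: "length ps = h" "halves (map revive xs) ps = (map kill (map revive xs))[p := Mark 4]"
    using halves_select[of p "map revive xs" h] p h by (auto simp: revive_def)
  have "map kill (map revive xs) = xs"
    unfolding map_map by (rule map_idI) (use n4 in \<open>auto simp: kill_def revive_def\<close>)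
  moreover have "map pick_alive xs = xs"
    by (rule map_idI) (use n4 in \<open>auto simp: pick_alive_def\<close>)
  ultimately have "map pick_alive (halves (map revive xs) ps) = xs[p := Mark 5]"
    using ps(2) by (simp only: map_update) (simp add: pick_alive_def)
  then show ?thesis using ps(1) by blast
qed

lemma count_list_update:
  "p < length xs \<Longrightarrow> count_list (xs[p := y]) z + of_bool (xs ! p = z) = count_list xs z + of_bool (y = z)"
proof (induction xs arbitrary: p)
  case (Cons x xs)
  then show ?case by (cases p) auto
qed simp

definition mask_le :: "sym list \<Rightarrow> sym list \<Rightarrow> bool" where
  "mask_le xs ws \<longleftrightarrow> list_all2 (\<lambda>x y. x = y \<or> x = Mark 2 \<and> y = Mark 5) xs ws"

lemma mask_le_count: "mask_le xs ws \<Longrightarrow> count_list xs (Mark 5) \<le> count_list ws (Mark 5)"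
  unfolding mask_le_def by (induction rule: list_all2_induct) auto

lemma mask_le_eq: "mask_le xs ws \<Longrightarrow> count_list xs (Mark 5) = count_list ws (Mark 5) \<Longrightarrow> xs = ws"
proof (induction xs arbitrary: ws)
  case (Cons x xs)
  then obtain y ys where ws: "ws = y # ys" "x = y \<or> x = Mark 2 \<and> y = Mark 5" "mask_le xs ys"
    by (auto simp: mask_le_def list_all2_Cons1)
  have "count_list xs (Mark 5) \<le> count_list ys (Mark 5)" using mask_le_count ws(3) by blast
  then have "x = y" using Cons.prems(2) ws by auto
  moreover from this have "xs = ys" by (intro Cons.IH) (use Cons.prems(2) ws in \<open>auto split: if_splits\<close>)
  ultimately show ?case using ws by simp
qed (simp add: mask_le_def)

text \<open>Each pointer is made to select a position where the current mask still differs from the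
  target \<open>ws\<close>. The number of chosen occurrences grows by one each time, and once it
  equals that of \<open>ws\<close> the two masks coincide. The answers are first built as a list,
  independently of where in the query sequence they are read.\<close>

lemma guesses_complete:
  "mask_le xs ws \<Longrightarrow> Mark 4 \<notin> set xs \<Longrightarrow> count_list xs (Mark 2) \<le> 2 ^ h \<Longrightarrow>
   count_list ws (Mark 5) = count_list xs (Mark 5) + n \<Longrightarrow>
   \<exists>bs. length bs = n * h \<and> (\<forall>ans q. (\<forall>i<n * h. ans (q + i) = bs ! i) \<longrightarrow> guesses ans h n q xs = ws)"
proof (induction n arbitrary: xs)
  case 0
  then show ?case using mask_le_eq[of xs ws] by simp
next
  case (Suc n)
  have len: "length xs = length ws" using Suc.prems(1) by (simp add: mask_le_def list_all2_lengthD)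
  have "xs \<noteq> ws" using Suc.prems(4) by auto
  then obtain p where p: "p < length xs" "xs ! p \<noteq> ws ! p" using len nth_equalityI by blast
  then have x: "xs ! p = Mark 2" "ws ! p = Mark 5"
    using Suc.prems(1) by (auto simp: mask_le_def list_all2_conv_all_nth)
  obtain ps where ps: "length ps = h" "map pick_alive (halves (map revive xs) ps) = xs[p := Mark 5]"
    using guess_one[OF p(1) x(1) Suc.prems(2,3)] by blast
  let ?xs = "xs[p := Mark 5]"
  have "mask_le ?xs ws"
    using Suc.prems(1) x p(1) by (auto simp: mask_le_def list_all2_conv_all_nth nth_list_update)
  moreover have "Mark 4 \<notin> set ?xs" using Suc.prems(2) set_update_subset_insert[of xs p "Mark 5"] by auto
  moreover have "count_list ?xs (Mark 2) \<le> 2 ^ h"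
    using count_list_update[OF p(1), of "Mark 5" "Mark 2"] Suc.prems(3) x(1) by simp
  moreover have "count_list ws (Mark 5) = count_list ?xs (Mark 5) + n"
    using count_list_update[OF p(1), of "Mark 5" "Mark 5"] Suc.prems(4) x(1) by simp
  ultimately obtain bs where bs: "length bs = n * h"
    "\<And>ans q. (\<forall>i<n * h. ans (q + i) = bs ! i) \<Longrightarrow> guesses ans h n q ?xs = ws"
    using Suc.IH[of ?xs] by blast
  show ?case
  proof (intro exI[of _ "ps @ bs"] conjI allI impI)
    show "length (ps @ bs) = Suc n * h" using ps bs by simp
    fix ans :: "nat \<Rightarrow> bool" and q
    assume ans: "\<forall>i<Suc n * h. ans (q + i) = (ps @ bs) ! i"
    have "map ans [q..<q + h] = ps"
    proof (rule nth_equalityI)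
      fix i assume "i < length (map ans [q..<q + h])"
      then show "map ans [q..<q + h] ! i = ps ! i" using ans[rule_format, of i] ps(1) by (simp add: nth_append)
    qed (simp add: ps)
    moreover have "guesses ans h n (q + h) ?xs = ws"
    proof (rule bs(2), intro allI impI)
      fix i assume "i < n * h"
      then show "ans (q + h + i) = bs ! i"
        using ans[rule_format, of "h + i"] ps(1) by (simp add: nth_append add.assoc)
    qed
    ultimately show "guesses ans h (Suc n) q xs = ws" by (simp add: ps(2))
  qed
qed

lemma answers_surj: "\<exists>\<sigma>. \<forall>i<length bs. answers \<sigma> i = bs ! i"
proof (intro exI allI impI)
  let ?n = "length bs"
  \<comment> \<open>Bit \<open>j\<close> is stored at the address \<open>2 ^ j - 1\<close> of query
    \<open>j\<close>; these addresses are distinct and below \<open>2 ^ ?n\<close>. All other cells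
    hold \<open>False\<close>.\<close>
  let ?\<sigma> = "map (\<lambda>a. \<exists>j<?n. a = 2 ^ j - 1 \<and> bs ! j) [0..<2 ^ ?n]"
  fix i assume i: "i < ?n"
  have "(2::nat) ^ i < 2 ^ ?n" using i by (rule power_strict_increasing) simp
  then have lt: "2 ^ i - 1 < (2::nat) ^ ?n" by (rule le_less_trans[OF diff_le_self])
  have inj: "j = i" if "(2::nat) ^ i - 1 = 2 ^ j - 1" for j
  proof -
    have "(1::nat) \<le> 2 ^ i" "(1::nat) \<le> 2 ^ j" by simp_all
    then have "(2::nat) ^ i = 2 ^ j" using that by linarith
    then show ?thesis by simp
  qed
  show "answers ?\<sigma> i = bs ! i"
  proof -
    have "?\<sigma> ! (2 ^ i - 1) \<longleftrightarrow> (\<exists>j<?n. 2 ^ i - 1 = (2::nat) ^ j - 1 \<and> bs ! j)"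
      using lt by simp
    also have "\<dots> \<longleftrightarrow> bs ! i" using inj i by blast
    finally show ?thesis using lt by (simp add: answers_def proof_bit_def)
  qed
qed

section \<open>Symbol words, clauses and the meaning of the check\<close>

fun words :: "sym list \<Rightarrow> sym list list" where
  "words [] = []"
| "words (x # xs) = (if x = Mark 2 then [takeWhile is_bit xs] else []) @ words xs"

lemma is_bit_unmark [simp]: "is_bit (unmark x) = is_bit x"
  by (simp add: unmark_def)

lemma takeWhile_unmark: "takeWhile is_bit (map unmark xs) = takeWhile is_bit xs"
proof (induction xs)
  case (Cons x xs)
  have "unmark x = x" if "is_bit x" using that by (auto simp: unmark_def)
  then show ?case using Cons by simp
qed simp

lemma occs_subset_words: "set (occs xs) \<subseteq> set (words (map unmark xs))"
proof (induction xs)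
  case (Cons x xs)
  have "unmark x = Mark 2" if "x = Mark 5" using that by (simp add: unmark_def)
  then show ?case using Cons by (auto simp: takeWhile_unmark)
qed simp

lemma distinct_iff_count_list: "distinct xs \<longleftrightarrow> (\<forall>x. count_list xs x \<le> 1)"
proof (induction xs)
  case (Cons y xs)
  have "(\<forall>x. count_list (y # xs) x \<le> 1) \<longleftrightarrow> count_list xs y = 0 \<and> (\<forall>x. count_list xs x \<le> 1)"
  proof (intro iffI conjI allI)
    assume *: "\<forall>x. count_list (y # xs) x \<le> 1"
    show "count_list xs y = 0" using spec[OF *, of y] by simp
    show "count_list xs x \<le> 1" for x using spec[OF *, of x] by (simp split: if_splits)
  next
    fix x assume *: "count_list xs y = 0 \<and> (\<forall>x. count_list xs x \<le> 1)"
    then have "count_list xs x \<le> 1" by blast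
    then show "count_list (y # xs) x \<le> 1" using * by (cases "y = x") simp_all
  qed
  then show ?case using Cons.IH by (simp add: count_list_0_iff)
qed simp

lemma length_occs: "length (occs xs) = count_list xs (Mark 5)"
  by (induction xs) auto

text \<open>Chooses one occurrence for each word of \<open>S\<close> that occurs. Removing a word
  once chosen is needed because \<open>valid\<close> rejects a variable chosen twice.\<close>

fun pick :: "sym list set \<Rightarrow> sym list \<Rightarrow> sym list" where
  "pick S [] = []"
| "pick S (x # xs) =
     (if x = Mark 2 \<and> takeWhile is_bit xs \<in> S then Mark 5 # pick (S - {takeWhile is_bit xs}) xs
      else x # pick S xs)"

lemma takeWhile_pick [simp]: "takeWhile is_bit (pick S xs) = takeWhile is_bit xs"
proof (induction xs arbitrary: S)
  case (Cons x xs)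
  then show ?case by simp
qed simp

lemma pick_spec:
  assumes "Mark 5 \<notin> set xs"
  shows "set (occs (pick S xs)) = S \<inter> set (words xs)" "distinct (occs (pick S xs))"
proof -
  have "set (occs (pick S xs)) = S \<inter> set (words xs) \<and> distinct (occs (pick S xs))"
    using assms
  proof (induction xs arbitrary: S)
    case (Cons x xs)
    have *: "set (occs (pick S' xs)) = S' \<inter> set (words xs)" "distinct (occs (pick S' xs))" for S'
      using Cons.IH[of S'] Cons.prems by auto
    show ?case
    proof (cases "x = Mark 2 \<and> takeWhile is_bit xs \<in> S")
      case True
      then show ?thesis using *[of "S - {takeWhile is_bit xs}"] by auto
    next
      case False
      then show ?thesis using *[of S] Cons.prems by auto
    qed
  qed simp
  then show "set (occs (pick S xs)) = S \<inter> set (words xs)" "distinct (occs (pick S xs))" by auto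
qed

lemma mask_le_pick: "mask_le xs (pick S xs)"
proof (induction xs arbitrary: S)
  case (Cons x xs)
  then show ?case by (simp add: mask_le_def)
qed (simp add: mask_le_def)

lemma mask_le_unmark: "mask_le xs ws \<Longrightarrow> map unmark ws = map unmark xs"
  unfolding mask_le_def by (induction rule: list_all2_induct) (auto simp: unmark_def)

lemma mask_le_Mark4: "mask_le xs ws \<Longrightarrow> Mark 4 \<notin> set xs \<Longrightarrow> Mark 4 \<notin> set ws"
  unfolding mask_le_def by (induction rule: list_all2_induct) auto

lemma is_bit_encode_nat: "x \<in> set (encode_nat n) \<Longrightarrow> is_bit x"
  by (auto simp: encode_nat_def)

definition bits_of :: "nat \<Rightarrow> bool list" where
  "bits_of n = map (bit n) [0..<floorlog 2 n]"

lemma encode_nat_bits: "encode_nat n = map Bit (bits_of n)"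
  by (simp add: encode_nat_def bits_of_def)

lemma value_bits_of: "horner_sum of_bool 2 (bits_of n) = n"
proof -
  have "n < 2 ^ floorlog 2 n" by (rule floorlog_leD) simp_all
  then show ?thesis by (simp add: bits_of_def horner_sum_bit_eq_take_bit take_bit_nat_eq_self)
qed

lemma inj_encode_nat: "inj encode_nat"
proof (rule injI)
  fix m n assume "encode_nat m = encode_nat n"
  then have "bits_of m = bits_of n" by (simp add: encode_nat_bits inj_map_eq_map inj_def)
  then show "m = n" by (metis value_bits_of)
qed

definition formula_code :: "cnf \<Rightarrow> sym list" where
  "formula_code \<phi> = concat (map encode_clause \<phi>)"

lemma formula_code_simps [simp]:
  "formula_code [] = []"
  "formula_code (C # \<phi>) = Mark 0 # concat (map encode_literal C) @ formula_code \<phi>"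
  by (simp_all add: formula_code_def encode_clause_def)

definition negative :: "literal list \<Rightarrow> bool" where
  "negative C \<longleftrightarrow> set C \<subseteq> range Neg"

text \<open>What follows a variable's word must not begin with a bit, or
  \<open>takeWhile is_bit\<close> would read beyond it. This includes the empty word, which encodes
  variable 0.\<close>

definition starts_with_mark :: "sym list \<Rightarrow> bool" where
  "starts_with_mark xs \<longleftrightarrow> takeWhile is_bit xs = []"

lemma starts_with_mark_code: "starts_with_mark xs \<Longrightarrow> starts_with_mark (concat (map encode_literal C) @ xs)"
proof (cases C)
  case (Cons l C')
  then show ?thesis by (cases l) (auto simp: starts_with_mark_def)
qed simp

lemma starts_with_mark_formula: "starts_with_mark (formula_code \<phi>)"
  by (cases \<phi>) (auto simp: starts_with_mark_def)

lemma takeWhile_encode_nat: "starts_with_mark xs \<Longrightarrow> takeWhile is_bit (encode_nat n @ xs) = encode_nat n"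
  by (simp add: takeWhile_append2 is_bit_encode_nat starts_with_mark_def)

lemma scan_clauses_bits: "\<forall>x\<in>set bs. is_bit x \<Longrightarrow> scan_clauses ws (bs @ xs) s = scan_clauses ws xs s"
proof (induction bs)
  case (Cons x bs)
  then have "x \<noteq> Mark 2" "x \<noteq> Mark 0" by auto
  then show ?case using Cons by (cases s) simp
qed simp

lemma scan_clauses_literals:
  "negative C \<Longrightarrow> starts_with_mark xs \<Longrightarrow>
   scan_clauses ws (concat (map encode_literal C) @ xs) (a, b) =
   scan_clauses ws xs
     (a \<and> (\<forall>l\<in>set C. count_list ws (encode_nat (var_of l)) \<le> 1),
      b \<and> (\<forall>l\<in>set C. encode_nat (var_of l) \<in> set ws))"
proof (induction C arbitrary: a b)
  case (Cons l C)
  obtain v where l: "l = Neg v" using Cons.prems by (auto simp: negative_def)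
  have "takeWhile is_bit (encode_nat v @ concat (map encode_literal C) @ xs) = encode_nat v"
    using Cons.prems by (intro takeWhile_encode_nat starts_with_mark_code)
  moreover have "negative C" using Cons.prems by (simp add: negative_def)
  moreover have "0 < count_list ws (encode_nat v) \<longleftrightarrow> encode_nat v \<in> set ws"
    by (metis count_list_0_iff neq0_conv)
  ultimately show ?case using Cons.IH Cons.prems(2) is_bit_encode_nat
    by (simp add: l scan_clauses_bits conj_assoc)
qed simp

text \<open>The conjunct \<open>\<not> b\<close> concerns a clause still pending when the formula
  begins; it makes the statement inductive, since a clause is judged only by what comes after
  it.\<close>

lemma scan_clauses_formula:
  "\<forall>C\<in>set \<phi>. negative C \<Longrightarrow>
   (case scan_clauses ws (formula_code \<phi>) (a, b) of (a', b') \<Rightarrow> a' \<and> \<not> b') \<longleftrightarrow>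
   a \<and> \<not> b \<and> (\<forall>C\<in>set \<phi>. \<forall>l\<in>set C. count_list ws (encode_nat (var_of l)) \<le> 1) \<and>
   (\<forall>C\<in>set \<phi>. \<exists>l\<in>set C. encode_nat (var_of l) \<notin> set ws)"
proof (induction \<phi> arbitrary: a b)
  case (Cons C \<phi>)
  then show ?case
    by (simp add: scan_clauses_literals starts_with_mark_formula) blast
qed simp

lemma words_bits: "\<forall>x\<in>set bs. is_bit x \<Longrightarrow> words (bs @ xs) = words xs"
  by (induction bs) auto

lemma words_literals:
  "negative C \<Longrightarrow> starts_with_mark xs \<Longrightarrow>
   words (concat (map encode_literal C) @ xs) = map (encode_nat \<circ> var_of) C @ words xs"
proof (induction C)
  case (Cons l C)
  obtain v where l: "l = Neg v" using Cons.prems by (auto simp: negative_def)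
  have "takeWhile is_bit (encode_nat v @ concat (map encode_literal C) @ xs) = encode_nat v"
    using Cons.prems by (intro takeWhile_encode_nat starts_with_mark_code)
  moreover have "negative C" using Cons.prems by (simp add: negative_def)
  ultimately show ?case using Cons.IH Cons.prems(2) is_bit_encode_nat by (simp add: l words_bits)
qed simp

lemma words_formula: "\<forall>C\<in>set \<phi>. negative C \<Longrightarrow> words (formula_code \<phi>) = map (encode_nat \<circ> var_of) (concat \<phi>)"
  by (induction \<phi>) (simp_all add: words_literals starts_with_mark_formula)

lemma set_words_formula: "\<forall>C\<in>set \<phi>. negative C \<Longrightarrow> set (words (formula_code \<phi>)) = encode_nat ` vars \<phi>"
  by (auto simp: words_formula vars_def)

lemma length_words: "length (words xs) = count_list xs (Mark 2)"
  by (induction xs) auto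

lemma set_formula_code:
  assumes "\<forall>C\<in>set \<phi>. negative C" "x \<in> set (formula_code \<phi>)"
  shows "is_bit x \<or> x = Mark 0 \<or> x = Mark 2"
proof -
  obtain C where C: "C \<in> set \<phi>" "x \<in> set (encode_clause C)" using assms(2) by (auto simp: formula_code_def)
  then consider "x = Mark 0" | l where "l \<in> set C" "x \<in> set (encode_literal l)"
    by (auto simp: encode_clause_def)
  then show ?thesis
  proof cases
    case 2
    then obtain v where "l = Neg v" using assms(1) C(1) by (auto simp: negative_def)
    then show ?thesis using 2 is_bit_encode_nat by auto
  qed simp
qed

lemma formula_code_symbols:
  assumes "\<forall>C\<in>set \<phi>. negative C"
  shows "no_stop (formula_code \<phi>)" "Mark 4 \<notin> set (formula_code \<phi>)" "Mark 5 \<notin> set (formula_code \<phi>)"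
    "map unmark (formula_code \<phi>) = formula_code \<phi>"
proof -
  show "no_stop (formula_code \<phi>)" "Mark 4 \<notin> set (formula_code \<phi>)" "Mark 5 \<notin> set (formula_code \<phi>)"
    using set_formula_code[OF assms] by (fastforce simp: stop_def)+
  then show "map unmark (formula_code \<phi>) = formula_code \<phi>"
    by (intro map_idI) (auto simp: unmark_def)
qed

text \<open>The variables whose words are chosen are set to true. No word is chosen twice, so the
  number of chosen occurrences is the number of true variables; each clause keeps a variable that is
  not chosen and hence a true negative literal.\<close>

lemma valid_sound:
  assumes neg: "\<forall>C\<in>set \<phi>. negative C" and ws: "map unmark ws = formula_code \<phi>"
    and valid: "valid (formula_code \<phi>) k ws"
  shows "\<exists>\<alpha>. satisfies \<alpha> \<phi> \<and> weight \<phi> \<alpha> = k"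
proof (intro exI conjI)
  let ?os = "occs ws" and ?\<alpha> = "\<lambda>v. encode_nat v \<in> set (occs ws)"
  have v: "count_list ws (Mark 5) = k" "\<forall>C\<in>set \<phi>. \<forall>l\<in>set C. count_list ?os (encode_nat (var_of l)) \<le> 1"
    "\<forall>C\<in>set \<phi>. \<exists>l\<in>set C. encode_nat (var_of l) \<notin> set ?os"
    using valid unfolding valid_def scan_clauses_formula[OF neg] by auto
  show "satisfies ?\<alpha> \<phi>"
  proof (unfold satisfies_def, intro ballI)
    fix C assume C: "C \<in> set \<phi>"
    then obtain l where l: "l \<in> set C" "encode_nat (var_of l) \<notin> set ?os" using v(3) by blast
    then obtain x where "l = Neg x" using neg C by (auto simp: negative_def)
    then show "\<exists>l\<in>set C. sat_literal ?\<alpha> l" using l by (intro bexI[of _ l]) auto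
  qed
  have sub: "set ?os \<subseteq> encode_nat ` vars \<phi>"
    using occs_subset_words[of ws] set_words_formula[OF neg] ws by simp
  \<comment> \<open>The check bounds multiplicities only for words of variables of the formula; by
    \<open>sub\<close> no other word can be chosen.\<close>
  have "count_list ?os w \<le> 1" if "w \<in> set ?os" for w
  proof -
    from that sub have "w \<in> encode_nat ` vars \<phi>" by blast
    then show ?thesis using v(2) by (auto simp: vars_def)
  qed
  then have "count_list ?os w \<le> 1" for w by (cases "w \<in> set ?os") simp_all
  then have "distinct ?os" by (simp add: distinct_iff_count_list)
  then have "card (set ?os) = k" using length_occs[of ws] v(1) by (simp add: distinct_card)
  moreover have "set ?os = encode_nat ` {x \<in> vars \<phi>. ?\<alpha> x}" using sub by auto
  moreover have "card (encode_nat ` {x \<in> vars \<phi>. ?\<alpha> x}) = card {x \<in> vars \<phi>. ?\<alpha> x}"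
    by (rule card_image) (use inj_encode_nat in \<open>auto intro: inj_on_subset\<close>)
  ultimately show "weight \<phi> ?\<alpha> = k" by (simp add: weight_def)
qed

lemma valid_complete:
  assumes neg: "\<forall>C\<in>set \<phi>. negative C" and sat: "satisfies \<alpha> \<phi>" "weight \<phi> \<alpha> = k"
  shows "\<exists>ws. mask_le (formula_code \<phi>) ws \<and> count_list ws (Mark 5) = k \<and> valid (formula_code \<phi>) k ws"
proof (intro exI conjI)
  let ?S = "encode_nat ` {x \<in> vars \<phi>. \<alpha> x}"
  let ?ws = "pick ?S (formula_code \<phi>)"
  note F = formula_code_symbols[OF neg]
  show "mask_le (formula_code \<phi>) ?ws" by (rule mask_le_pick)
  have os: "set (occs ?ws) = ?S" "distinct (occs ?ws)"
    using pick_spec[OF F(3), of ?S] set_words_formula[OF neg] by auto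
  have "card ?S = card {x \<in> vars \<phi>. \<alpha> x}"
    by (rule card_image) (use inj_encode_nat in \<open>auto intro: inj_on_subset\<close>)
  then have "length (occs ?ws) = k"
    using os sat(2) distinct_card[OF os(2)] by (simp add: weight_def)
  then show cnt: "count_list ?ws (Mark 5) = k" by (simp add: length_occs)
  have le: "count_list (occs ?ws) w \<le> 1" for w
    using os(2) by (simp add: distinct_iff_count_list)
  have "\<exists>l\<in>set C. encode_nat (var_of l) \<notin> set (occs ?ws)" if C: "C \<in> set \<phi>" for C
  proof -
    obtain l where l: "l \<in> set C" "sat_literal \<alpha> l" using sat(1) C by (auto simp: satisfies_def)
    then obtain x where "l = Neg x" using neg C by (auto simp: negative_def)
    then show ?thesis using l os(1) inj_encode_nat by (intro bexI[of _ l]) (auto dest: injD)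
  qed
  then show "valid (formula_code \<phi>) k ?ws"
    unfolding valid_def scan_clauses_formula[OF neg] using cnt le by auto
qed

section \<open>The verifier\<close>

definition solver :: prog where
  "solver = copy_input ;; to_unary ;; make_ruler ;; compare_ruler ;;
     Cond (\<lambda>as. as ! tA = Bit True) (guess ;; check) search"

definition solver_alphabet :: "sym set" where
  "solver_alphabet = {Blank, Bit False, Bit True, Mark 0, Mark 1, Mark 2, Mark 3, Mark 4, Mark 5}"

lemma solver_alphabet_simps [simp]:
  "Blank \<in> solver_alphabet" "Bit b \<in> solver_alphabet" "Mark 0 \<in> solver_alphabet" "Mark 2 \<in> solver_alphabet"
  "Mark 3 \<in> solver_alphabet" "Mark 4 \<in> solver_alphabet" "Mark 5 \<in> solver_alphabet"
  by (cases b; simp add: solver_alphabet_def)+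

lemma well_formed_solver: "well_formed 8 solver_alphabet solver"
proof -
  have nth: "as ! j \<in> solver_alphabet" if "length as = 8" "set as \<subseteq> solver_alphabet" "j < 8" for as j
    using that nth_mem[of j as] by auto
  show ?thesis
    by (simp add: solver_def copy_input_def rewind_def move_head_def to_unary_def set_reg_def decrement_def
        make_ruler_def ruler_step_def halve_tape_def halve_loop_def compare_ruler_def compare_step_def guess_def guess_loop_def
        guess_step_def sweep_def query_loop_def query_step_def check_def count_loop_def scan_loop_def
        literal_step_def match_all_def match_one_def match_words_def other_step_def search_def
        search_loop_def search_step_def incr_loop_def revive_def pick_alive_def nth)
qed

text \<open>\<open>a\<close> is the outcome of the ruler comparison. The factor \<open>2 ^ L\<close>
  is charged to the search branch only, where \<open>h < 2 ^ k\<close> bounds it in terms of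
  \<open>k\<close>.\<close>

lemma runs_solver:
  assumes F: "no_stop F" "Mark 4 \<notin> set F" "Mark 5 \<notin> set F"
    and k: "k = horner_sum of_bool 2 kb" and h: "h = floorlog 2 (count_list F (Mark 2))"
    and w: "w = F @ Mark 3 # map Bit kb"
  defines "X \<equiv> length w" and "L \<equiv> count_list F (Mark 2)"
  shows "\<exists>a zs. (a \<longrightarrow> k = 0 \<or> 2 ^ (k - 1) \<le> h) \<and> (\<not> a \<longrightarrow> h < 2 ^ k) \<and>
    zscan (zs ! tA) = Bit (if a then valid F k (guesses ans h k 0 F) else \<exists>i<2 ^ L. valid F k ((incr True ^^ i) F)) \<and>
    length zs = 8 \<and>
    runs ans solver (([], w) # replicate 7 ([], []), 0) (zs, if a then k * h else 0)
      (500 * (Suc k * X ^ 3 * (if a then 1 else 2 ^ L)))"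
proof -
  let ?I = "([], F @ Mark 3 # map Bit kb)" and ?K = "([], unary k)"
  let ?z = "reg Blank" and ?N = "length F"
  let ?xs = "map revive F"
  have nb: "Blank \<notin> set w" using F(1) by (auto simp: w stop_def)
  have ns: "no_stop ?xs" by (rule not_stop_revive[OF F(1)])
  have xs3: "Mark 3 \<notin> set ?xs" "Blank \<notin> set ?xs" using ns by (auto simp: stop_def)
  have cnt: "count_list ?xs (Mark 4) = count_list F (Mark 2)"
    using F(2) by (induction F) (auto simp: revive_def)
  have kill: "map kill ?xs = F"
    unfolding map_map by (rule map_idI) (use F(2) in \<open>auto simp: kill_def revive_def\<close>)
  have rw: "map revive w = ?xs @ Mark 3 # map Bit kb" by (simp add: w revive_def)
  have init: "([], w) # replicate 7 ([], []) = [?I, ([], []), ([], []), ([], []), ?z, ?z, ?z, ?z]"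
    by (simp add: numeral_eq_Suc reg_Blank w)
  have 1: "runs ans copy_input ([?I, ([], []), ([], []), ([], []), ?z, ?z, ?z, ?z], 0)
    ([?I, ([], ?xs @ Mark 3 # map Bit kb), ([], []), ([], []), ?z, ?z, ?z, ?z], 0) (9 * X + 13)" (is "runs _ _ _ ?s1 _")
    using runs_copy_input[OF nb order_refl, of ans "([], [])" "([], [])" ?z ?z ?z ?z 0]
    unfolding rw by (simp add: w X_def)
  obtain kb' where 2: "runs ans to_unary ?s1
    ([?I, ([], ?xs @ Mark 3 # map Bit kb'), ([], []), ?K, flag False, ?z, ?z, ?z], 0)
    (6 * length ?xs + Suc k * (6 * length kb + 14) + 16)"
    using runs_to_unary[OF xs3 k order_refl, of ans ?I "([], [])" Blank ?z ?z ?z 0] by (elim exE) (rule that)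
  let ?r = "Mark 3 # map Bit kb'"
  have r: "stop (top_sym ?r)" "?r \<noteq> [Blank]" by (simp_all add: stop_def)
  obtain b1 where 3: "runs ans make_ruler
    ([?I, ([], ?xs @ ?r), ([], []), ?K, flag False, ?z, ?z, ?z], 0)
    ([?I, ([], map kill ?xs @ ?r), ([], replicate h (Mark 4)), ?K, flag False, reg b1, ?z, ?z], 0)
    (Suc h * (6 * length ?xs + 16) + 7)"
    using runs_make_ruler[OF ns r h[folded cnt] order_refl, of ans ?I ?K "Bit False" Blank ?z ?z 0]
    by (elim exE) (rule that)
  obtain ys a b2 where 4: "runs ans compare_ruler
    ([?I, ([], F @ ?r), ([], replicate h (Mark 4)), ?K, flag False, reg b1, ?z, ?z], 0)
    ([?I, ([], F @ ?r), ([], ys), ?K, flag a, reg b2, ?z, ?z], 0) (k * (6 * h + 16) + 10)"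
    and ys: "length ys = h" "no_stop ys"
    and a: "a \<longrightarrow> k = 0 \<or> 2 ^ (k - 1) \<le> h" "\<not> a \<longrightarrow> h < 2 ^ k"
    using runs_compare_ruler[OF order_refl, of ans ?I "([], F @ ?r)" h k "Bit False" b1 ?z ?z 0]
    by (elim exE conjE) (rule that)
  have X: "1 \<le> X" "?N \<le> X" "length kb \<le> X" by (simp_all add: X_def w)
  have LN: "L \<le> ?N" unfolding L_def by (rule count_le_length)
  have "L < 2 ^ L" by (rule less_exp)
  then have "h \<le> L" unfolding h L_def by (intro floorlog_leI) simp_all
  then have hX: "h \<le> X" using LN X(2) by linarith
  \<comment> \<open>A common unit of cost: the cube comes from \<open>check\<close>, the factor
    \<open>Suc k\<close> from the unary conversion, the comparison and the \<open>k\<close>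
    pointers.\<close>
  define Y where "Y = Suc k * X ^ 3"
  have Y: "X * X * X \<le> Y" "X * X \<le> Y" "X \<le> Y" "1 \<le> Y" "k * (X * X) \<le> Y" "k * X \<le> Y" "k \<le> Y" "Suc k * X \<le> Y"
  proof -
    have x1: "X \<le> X * X" "X * X \<le> X * X * X" using X(1) by simp_all
    have x2: "1 * (X * X * X) \<le> Suc k * (X * X * X)" by (rule mult_le_mono1) simp
    have x3: "Y = Suc k * (X * X * X)" by (simp add: Y_def power3_eq_cube)
    show "X * X * X \<le> Y" "X * X \<le> Y" "X \<le> Y" "1 \<le> Y" using x1 x2 x3 X(1) by linarith+
    have x4: "k * (X * X) \<le> k * (X * X * X)" "k * X \<le> k * (X * X)" "k * 1 \<le> k * X" "Suc k * X \<le> Suc k * (X * X * X)"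
      using x1 X(1) by (auto intro!: mult_le_mono2 simp del: mult_Suc)
    have x5: "k * (X * X * X) \<le> Suc k * (X * X * X)" by simp
    show "k * (X * X) \<le> Y" "k * X \<le> Y" "k \<le> Y" "Suc k * X \<le> Y" using x3 x4 x5 by linarith+
  qed
  have e: "2 * X * (22 * X) = 44 * (X * X)" "k * (22 * X) = 22 * (k * X)" "X * (20 * X) = 20 * (X * X)"
    "k * (59 * (X * X)) = 59 * (k * (X * X))" "X * (25 * X) = 25 * (X * X)" "X * (39 * (X * X)) = 39 * (X * X * X)"
    by simp_all
  have T1: "9 * X + 13 \<le> 22 * Y" using Y(3,4) by linarith
  have "Suc k * (6 * length kb + 14) \<le> Suc k * (20 * X)"
    using X by (intro mult_le_mono2) linarith
  then have T2: "6 * length ?xs + Suc k * (6 * length kb + 14) + 16 \<le> 42 * Y"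
    using Y(3,4,8) X(2) unfolding length_map by linarith
  have "Suc h * (6 * length ?xs + 16) \<le> (2 * X) * (22 * X)"
    using X hX unfolding length_map by (intro mult_le_mono) linarith+
  then have T3: "Suc h * (6 * length ?xs + 16) + 7 \<le> 51 * Y"
    using Y(2,4) e(1) by linarith
  have "k * (6 * h + 16) \<le> k * (22 * X)" using X hX by (intro mult_le_mono2) linarith
  then have T4: "k * (6 * h + 16) + 10 \<le> 32 * Y"
    using Y(4,6) e(2) by linarith
  have T5: "k * (length ys * (6 * length F + 14) + 12 * length F + 27) + 7 \<le> 66 * Y"
  proof -
    have "length ys * (6 * length F + 14) \<le> X * (20 * X)"
      using X hX ys(1) by (intro mult_le_mono) linarith+
    moreover have "12 * length F + 27 \<le> 39 * X" using X by linarith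
    moreover have "X \<le> X * X" using X(1) by simp
    ultimately have "length ys * (6 * length F + 14) + 12 * length F + 27 \<le> 59 * (X * X)"
      using e(3) by linarith
    then have "k * (length ys * (6 * length F + 14) + 12 * length F + 27) \<le> k * (59 * (X * X))"
      by (rule mult_le_mono2)
    then show ?thesis using Y(4,5) e(4) by linarith
  qed
  have T6: "check_time ?N k + 6 * ?N + 14 \<le> 100 * Y"
  proof -
    have "?N * (6 * ?N + 19) \<le> X * (25 * X)" using X by (intro mult_le_mono) linarith+
    then have "?N * (6 * ?N + 19) + 14 \<le> 39 * (X * X)"
      using mult_le_mono[OF X(1) X(1)] e(5) by linarith
    then have "?N * (?N * (6 * ?N + 19) + 14) \<le> X * (39 * (X * X))"
      using X(2) by (intro mult_le_mono)
    then have "?N * (?N * (6 * ?N + 19) + 14) \<le> 39 * (X * X * X)"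
      by (simp only: e(6))
    then show ?thesis using Y(1,3,4,7) X(2) unfolding check_time_def by linarith
  qed
  let ?s4 = "([?I, ([], F @ ?r), ([], ys), ?K, flag a, reg b2, ?z, ?z], 0)"
    and ?C = "Cond (\<lambda>as. as ! tA = Bit True) (guess ;; check) search"
    and ?G = "guesses ans (length ys) k 0 F" and ?q = "if a then k * h else 0"
    and ?T = "300 * (Y * (if a then 1 else 2 ^ L))"
  let ?res = "if a then valid F k (guesses ans h k 0 F) else \<exists>i<2 ^ L. valid F k ((incr True ^^ i) F)"
  have "\<exists>zs. zscan (zs ! tA) = Bit ?res \<and> length zs = 8 \<and>
    runs ans ?C ?s4 (zs, ?q) ?T"
  proof (cases a)
    case True
    obtain a' b3 where g: "runs ans guess ?s4 ([?I, ([], ?G @ ?r), ([], ys), ?K, flag a', reg b3, ?z, ?z], 0 + k * length ys)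
      (k * (length ys * (6 * length F + 14) + 12 * length F + 27) + 7)" (is "runs _ _ _ ?sg _")
      using runs_guess[OF ys(2) F(1) order_refl, of ans ?I "map Bit kb'" k a b2 ?z ?z 0] by (elim exE) (rule that)
    have len: "length ?G \<le> ?N" by simp
    obtain b4 d4 where c: "runs ans check ?sg
      ([?I, ([], ?G @ ?r), ([], ys), ?K,
      flag (valid F k ?G), reg b4, ?z, reg d4], 0 + k * length ys) (check_time ?N k)"
      using runs_check[OF F(1) order_refl not_stop_guesses[OF F(1)] len,
          of ans "map Bit kb" "map Bit kb'" "([], ys)" k "Bit a'" b3 ?z Blank "0 + k * length ys"]
      by (elim exE) (rule that)
    show ?thesis
    proof (rule exI, intro conjI)
      show "runs ans ?C ?s4 ([?I, ([], ?G @ ?r), ([], ys), ?K,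
        flag (valid F k ?G), reg b4, ?z, reg d4], ?q) ?T"
      proof (rule runs_CondT)
        show "runs ans (guess ;; check) ?s4
          ([?I, ([], ?G @ ?r), ([], ys), ?K,
          flag (valid F k ?G), reg b4, ?z, reg d4], ?q) (166 * Y)"
          using runs_Seq[OF g c, of "166 * Y"] T5 T6 True ys(1) by simp
      qed (use True Y(4) in auto)
    qed (use True ys(1) in auto)
  next
    case False
    \<comment> \<open>No occurrence is chosen in the formula itself, so the counter starts at zero
      and all \<open>2 ^ L\<close> masks lie ahead.\<close>
    have mv: "mask_value F = 0" "mask_size F = L"
      unfolding L_def using F(3) by (induction F) auto
    have n: "2 ^ L = 2 ^ mask_size F - mask_value F" using mv by simp
    have Ts: "Suc (2 ^ L) * (check_time ?N k + 6 * ?N + 14) + 2 \<le> 202 * (Y * 2 ^ L)"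
    proof -
      have one: "(1::nat) \<le> 2 ^ L" by simp
      have "Suc (2 ^ L) * (check_time ?N k + 6 * ?N + 14) \<le> (2 * 2 ^ L) * (100 * Y)"
        using T6 one by (intro mult_le_mono) linarith+
      also have "\<dots> = 200 * (Y * 2 ^ L)" by (simp add: algebra_simps)
      finally show ?thesis using mult_le_mono[OF Y(4) one] by linarith
    qed
    obtain ws' b' c' d' where s: "runs ans search ?s4 ([?I, ([], ws' @ ?r), ([], ys), ?K, flag (\<exists>i<2 ^ L. valid F k ((incr True ^^ i) F)), reg b', reg c', reg d'], 0)
      (202 * (Y * 2 ^ L))"
      using runs_search[OF F(1) order_refl F(1) order_refl n Ts, of ans "map Bit kb" "map Bit kb'" "([], ys)" "Bit a" b2 Blank Blank 0]
      by (elim exE) (rule that)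
    show ?thesis
    proof (rule exI, intro conjI)
      show "runs ans ?C ?s4 ([?I, ([], ws' @ ?r), ([], ys), ?K, flag (\<exists>i<2 ^ L. valid F k ((incr True ^^ i) F)), reg b', reg c', reg d'],
        ?q) ?T"
      proof (rule runs_CondF)
        show "runs ans search ?s4 ([?I, ([], ws' @ ?r), ([], ys), ?K, flag (\<exists>i<2 ^ L. valid F k ((incr True ^^ i) F)), reg b', reg c', reg d'],
          ?q) (202 * (Y * 2 ^ L))"
          using s False by simp
        have "1 \<le> Y * 2 ^ L" using Y(4) by simp
        then show "202 * (Y * 2 ^ L) + 1 \<le> ?T" using False by simp
      qed (use False in auto)
    qed (use False in auto)
  qed
  then obtain zs where zs: "zscan (zs ! tA) = Bit ?res" "length zs = 8"
    and 5: "runs ans ?C ?s4 (zs, ?q) ?T"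
    by (elim exE conjE) (rule that)
  have "Y \<le> Y * (if a then 1 else 2 ^ L)" by simp
  \<comment> \<open>The five phases cost at most 22, 42, 51, 32 and 300 units, together 447.\<close>
  then have T: "(9 * X + 13) + ((6 * length ?xs + Suc k * (6 * length kb + 14) + 16) +
    ((Suc h * (6 * length ?xs + 16) + 7) + ((k * (6 * h + 16) + 10) +
    ?T))) \<le> 500 * (Y * (if a then 1 else 2 ^ L))"
    using T1 T2 T3 T4 by linarith
  have "runs ans solver ([?I, ([], []), ([], []), ([], []), ?z, ?z, ?z, ?z], 0) (zs, ?q)
    (500 * (Y * (if a then 1 else 2 ^ L)))"
    unfolding solver_def
    by (rule runs_Seq[OF 1 runs_Seqs[OF 2 runs_Seqs[OF 3[unfolded kill] runs_Seqs[OF 4 5]]] T])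
  then show ?thesis using a zs unfolding init Y_def by (intro exI[of _ a] exI[of _ zs]) simp
qed

section \<open>A computable bound in the parameter\<close>

lemma computable_comp:
  assumes "computable f" "computable g"
  shows "computable (\<lambda>k. f (g k))"
proof -
  obtain F G where F: "recursive 1 F" "\<forall>k. F [k] = f k" and G: "recursive 1 G" "\<forall>k. G [k] = g k"
    using assms by (auto simp: computable_def)
  have "recursive 1 (\<lambda>xs. F (map (\<lambda>h. h xs) [G]))"
    by (rule recursive.comp) (use F(1) G(1) in auto)
  then show ?thesis using F(2) G(2) by (auto simp: computable_def intro!: exI[of _ "\<lambda>xs. F [G xs]"])
qed

lemma computable_Suc: "computable Suc"
  unfolding computable_def by (intro exI conjI, rule recursive.succ) simp

lemma recursive_const: "recursive n (\<lambda>_. c)"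
proof (induction c)
  case 0
  show ?case by (rule recursive.zero)
next
  case (Suc c)
  have "recursive n (\<lambda>xs. (\<lambda>ys. Suc (ys ! 0)) (map (\<lambda>h. h xs) [\<lambda>_. c]))"
    by (rule recursive.comp) (use Suc recursive.succ in auto)
  then show ?case by simp
qed

text \<open>Primitive recursion whose step ignores the counter and applies \<open>s\<close> to the
  previous value, which stands at index 1. Doubling and then powers of two arise as
  iterations.\<close>

lemma computable_iterate:
  assumes "computable s"
  shows "computable (\<lambda>k. (s ^^ k) c)"
proof -
  obtain S where S: "recursive 1 S" "\<forall>k. S [k] = s k" using assms by (auto simp: computable_def)
  have "recursive 2 (\<lambda>xs. S (map (\<lambda>h. h xs) [\<lambda>xs. xs ! 1]))"
    by (rule recursive.comp) (use S(1) recursive.proj[of 1 2] in auto)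
  then have "recursive (0 + 2) (\<lambda>xs. S [xs ! 1])" by (simp add: numeral_2_eq_2)
  from recursive.prec[OF recursive_const this, of c]
  have "recursive 1 (\<lambda>xs. rec_nat c (\<lambda>y r. S [(y # r # tl xs) ! 1]) (hd xs))" by simp
  moreover have "rec_nat c (\<lambda>y r. S [(y # r # ys) ! 1]) k = (s ^^ k) c" for k ys
    by (induction k) (simp_all add: S(2))
  ultimately show ?thesis
    unfolding computable_def
    by (intro exI[of _ "\<lambda>xs. rec_nat c (\<lambda>y r. S [(y # r # tl xs) ! 1]) (hd xs)"]) simp
qed

lemma computable_power2: "computable (\<lambda>k. 2 ^ k)"
proof -
  have "computable (\<lambda>k. Suc (Suc k))" using computable_comp[OF computable_Suc computable_Suc] .
  from computable_iterate[OF this, of 0] have "computable (\<lambda>k. ((\<lambda>k. Suc (Suc k)) ^^ k) 0)" .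
  moreover have "((\<lambda>k. Suc (Suc k)) ^^ k) 0 = 2 * k" for k by (induction k) simp_all
  ultimately have "computable (\<lambda>k. 2 * k)" by simp
  from computable_iterate[OF this, of 1] have "computable (\<lambda>k. ((\<lambda>k. 2 * k) ^^ k) 1)" .
  moreover have "((\<lambda>k. 2 * k) ^^ k) 1 = (2::nat) ^ k" for k by (induction k) simp_all
  ultimately show ?thesis by simp
qed

text \<open>In the search branch \<open>L < 2 ^ h\<close> and \<open>h < 2 ^ k\<close>, so the
  number of masks is below a tower of three exponentials in \<open>k\<close>. The summand 3 in the
  exponent absorbs the factor \<open>500 * Suc k\<close> and leaves the inequality strict.\<close>

definition time_factor :: "nat \<Rightarrow> nat" where
  "time_factor k = 2 ^ 2 ^ 2 ^ (k + 3)"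

lemma computable_time_factor: "computable time_factor"
proof -
  have "computable (\<lambda>k. Suc (Suc (Suc k)))"
    using computable_comp[OF computable_Suc computable_comp[OF computable_Suc computable_Suc]] .
  then have "computable (\<lambda>k. 2 ^ 2 ^ 2 ^ Suc (Suc (Suc k)))"
    by (intro computable_comp[OF computable_power2])
  moreover have "time_factor = (\<lambda>k. 2 ^ 2 ^ 2 ^ Suc (Suc (Suc k)))"
    by (simp add: time_factor_def fun_eq_iff numeral_3_eq_3)
  ultimately show ?thesis by (simp only:)
qed

lemma time_factor_bound:
  assumes "L \<le> 2 ^ 2 ^ k"
  shows "500 * (Suc k * 2 ^ L) < time_factor k"
proof -
  let ?u = "(2::nat) ^ k"
  have k: "Suc k \<le> ?u" using less_exp[of k] by (simp add: Suc_le_eq)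
  have u1: "1 \<le> ?u" by simp
  have "Suc k \<le> 2 ^ k" by (rule k)
  moreover have "(2::nat) ^ L \<le> 2 ^ 2 ^ ?u" using assms by (intro power_increasing) simp_all
  ultimately have "500 * (Suc k * 2 ^ L) \<le> 500 * (2 ^ k * 2 ^ 2 ^ ?u)"
    by (intro mult_le_mono order_refl)
  also have "\<dots> < 2 ^ 9 * (2 ^ k * 2 ^ 2 ^ ?u)" by simp
  also have "\<dots> = 2 ^ (9 + k + 2 ^ ?u)" by (simp add: power_add)
  also have "\<dots> \<le> 2 ^ 2 ^ (8 * ?u)"
  proof (rule power_increasing)
    have "k < ?u" "?u < 2 ^ ?u" by (rule less_exp)+
    moreover have "(1::nat) \<le> 2 ^ ?u" by simp
    ultimately have "9 + k + 2 ^ ?u \<le> 11 * 2 ^ ?u" by linarith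
    also have "\<dots> \<le> 2 ^ 7 * 2 ^ ?u" by simp
    also have "\<dots> = 2 ^ (7 + ?u)" by (simp add: power_add)
    also have "\<dots> \<le> 2 ^ (8 * ?u)" using u1 by (intro power_increasing) simp_all
    finally show "9 + k + 2 ^ ?u \<le> 2 ^ (8 * ?u)" .
  qed simp
  also have "\<dots> = time_factor k" by (simp add: time_factor_def power_add mult.commute)
  finally show ?thesis .
qed

section \<open>The verifier, its soundness and its completeness\<close>

definition verifier :: machine where
  "verifier = machine_of 8 solver_alphabet solver (\<lambda>as. as ! tA = Bit True)"

lemma turing_machine_verifier: "turing_machine verifier"
  unfolding verifier_def
  by (rule turing_machine_machine_of[OF well_formed_solver]) (simp_all add: solver_alphabet_def)

lemma encode_instance_formula_code: "encode_instance (\<phi>, k) = formula_code \<phi> @ Mark 3 # map Bit (bits_of k)"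
  by (simp add: formula_code_def encode_nat_bits)

lemma Gamma_negative: "\<phi> \<in> Gamma_neg_1_2 \<Longrightarrow> \<forall>C\<in>set \<phi>. negative C"
  by (auto simp: Gamma_neg_1_2_def negative_def)

definition pointer_length :: "cnf \<Rightarrow> nat" where
  "pointer_length \<phi> = floorlog 2 (count_list (formula_code \<phi>) (Mark 2))"

definition accepts :: "bool \<Rightarrow> bool list \<Rightarrow> cnf \<Rightarrow> nat \<Rightarrow> bool" where
  "accepts a \<sigma> \<phi> k \<longleftrightarrow>
     (if a then valid (formula_code \<phi>) k (guesses (answers \<sigma>) (pointer_length \<phi>) k 0 (formula_code \<phi>))
      else \<exists>i<2 ^ count_list (formula_code \<phi>) (Mark 2). valid (formula_code \<phi>) k ((incr True ^^ i) (formula_code \<phi>)))"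

lemma verifier_run:
  fixes \<phi> k
  assumes \<phi>: "\<forall>C\<in>set \<phi>. negative C"
  defines "w \<equiv> encode_instance (\<phi>, k)"
  shows "\<exists>a. (a \<longrightarrow> k = 0 \<or> 2 ^ (k - 1) \<le> pointer_length \<phi>) \<and>
    halts_within verifier \<sigma> w (time_factor k * length w ^ 3) \<and>
    tosses_at_most verifier \<sigma> w 0 \<and>
    queries_at_most verifier \<sigma> w (if a then k * pointer_length \<phi> else 0) \<and>
    accept_prob verifier \<sigma> w = of_bool (accepts a \<sigma> \<phi> k)"
proof -
  let ?F = "formula_code \<phi>" and ?h = "pointer_length \<phi>"
  let ?L = "count_list ?F (Mark 2)" and ?X = "length w"
  obtain a zs where a: "a \<longrightarrow> k = 0 \<or> 2 ^ (k - 1) \<le> ?h" "\<not> a \<longrightarrow> ?h < 2 ^ k"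
    and zs: "zscan (zs ! tA) = Bit (accepts a \<sigma> \<phi> k)" "length zs = 8"
    and run: "runs (answers \<sigma>) solver (([], w) # replicate 7 ([], []), 0) (zs, if a then k * ?h else 0)
      (500 * (Suc k * ?X ^ 3 * (if a then 1 else 2 ^ ?L)))"
    using runs_solver[OF formula_code_symbols(1-3)[OF \<phi>] value_bits_of[symmetric] pointer_length_def refl, of k "answers \<sigma>"]
    unfolding encode_instance_formula_code[symmetric] w_def[symmetric] accepts_def[symmetric]
    by (elim exE conjE) (rule that)
  then obtain t where t: "t \<le> 500 * (Suc k * ?X ^ 3 * (if a then 1 else 2 ^ ?L))"
    and ex: "exec (answers \<sigma>) solver (([], w) # replicate (8 - 1) ([], []), 0) t (zs, if a then k * ?h else 0)"
    by (auto simp: runs_def)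
  let ?E = "if a then 0 else ?L"
  have "?E \<le> 2 ^ 2 ^ k"
  proof (cases a)
    case False
    have "?L < 2 ^ ?h" unfolding pointer_length_def by (rule floorlog_leD) simp_all
    also have "\<dots> \<le> 2 ^ 2 ^ k" using a(2) False by (intro power_increasing) simp_all
    finally show ?thesis using False by simp
  qed simp
  then have "500 * (Suc k * 2 ^ ?E) < time_factor k" by (rule time_factor_bound)
  \<comment> \<open>The code is never empty, as it contains \<open>Mark 3\<close>. A strict bound on
    \<open>t\<close> is required because the final test takes one further step.\<close>
  moreover have "0 < ?X ^ 3" by (simp add: w_def encode_instance_formula_code)
  ultimately have "500 * (Suc k * 2 ^ ?E) * ?X ^ 3 < time_factor k * ?X ^ 3" by (rule mult_strict_right_mono)
  moreover have "500 * (Suc k * ?X ^ 3 * (if a then 1 else 2 ^ ?L)) = 500 * (Suc k * 2 ^ ?E) * ?X ^ 3"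
    by (simp add: algebra_simps)
  ultimately have "t < time_factor k * ?X ^ 3" using t by linarith
  moreover have "map zscan zs ! tA = Bit True \<longleftrightarrow> accepts a \<sigma> \<phi> k" using zs by simp
  ultimately show ?thesis
    using a(1) machine_of_correct[OF _ ex, where A = solver_alphabet and P = "\<lambda>as. as ! tA = Bit True"]
    unfolding verifier_def by (intro exI[of _ a]) simp
qed

lemma accepts_sound:
  assumes "\<forall>C\<in>set \<phi>. negative C" "accepts a \<sigma> \<phi> k"
  shows "\<exists>\<alpha>. satisfies \<alpha> \<phi> \<and> weight \<phi> \<alpha> = k"
proof -
  let ?F = "formula_code \<phi>"
  obtain ws where "map unmark ws = map unmark ?F" "valid ?F k ws"
  proof (cases a)
    case True
    then show ?thesis using assms(2) that[OF unmark_guesses] by (simp add: accepts_def)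
  next
    case False
    then show ?thesis using assms(2) that[OF unmark_incr_funpow] by (auto simp: accepts_def)
  qed
  then show ?thesis using valid_sound[OF assms(1)] formula_code_symbols(4)[OF assms(1)] by simp
qed

lemma mask_value_no_Mark5: "Mark 5 \<notin> set xs \<Longrightarrow> mask_value xs = 0"
  by (induction xs) auto

lemma mask_size_no_Mark5: "Mark 5 \<notin> set xs \<Longrightarrow> mask_size xs = count_list xs (Mark 2)"
  by (induction xs) auto

text \<open>\<open>verifier_run\<close> asserts only that some branch \<open>a\<close> is taken, so
  a single proof string has to serve both. Its bits are pointers to the occurrences of a valid mask,
  and the search reaches the same mask by counting.\<close>

lemma accepts_complete:
  assumes neg: "\<forall>C\<in>set \<phi>. negative C" and sat: "satisfies \<alpha> \<phi>" "weight \<phi> \<alpha> = k"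
  shows "\<exists>\<sigma>. \<forall>a. accepts a \<sigma> \<phi> k"
proof -
  let ?F = "formula_code \<phi>" and ?h = "pointer_length \<phi>"
  note F = formula_code_symbols[OF neg]
  obtain ws where ws: "mask_le ?F ws" "count_list ws (Mark 5) = k" "valid ?F k ws"
    using valid_complete[OF neg sat] by blast
  have c5: "count_list ?F (Mark 5) = 0" using F(3) by (simp add: count_list_0_iff)
  have "count_list ?F (Mark 2) < 2 ^ ?h" unfolding pointer_length_def by (rule floorlog_leD) simp_all
  then obtain bs where bs: "length bs = k * ?h"
    "\<And>ans q. (\<forall>i<k * ?h. ans (q + i) = bs ! i) \<Longrightarrow> guesses ans ?h k q ?F = ws"
    using guesses_complete[OF ws(1) F(2), of ?h k] ws(2) c5 by auto
  obtain \<sigma> where "\<forall>i<length bs. answers \<sigma> i = bs ! i" using answers_surj by blast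
  then have "guesses (answers \<sigma>) ?h k 0 ?F = ws" by (intro bs(2)) (simp add: bs(1))
  moreover have "\<exists>i<2 ^ mask_size ?F. (incr True ^^ i) ?F = ws"
    by (rule incr_reaches[OF mask_le_unmark[OF ws(1)] mask_le_Mark4[OF ws(1) F(2)] F(2) mask_value_no_Mark5[OF F(3)]])
  ultimately show ?thesis
    using ws(3) mask_size_no_Mark5[OF F(3)] by (intro exI[of _ \<sigma>]) (auto simp: accepts_def)
qed

section \<open>The number of queries\<close>

lemma pointer_length_bound:
  assumes "\<phi> \<in> Gamma_neg_1_2" "clause_count \<phi> \<le> 2 ^ m"
  shows "pointer_length \<phi> \<le> m + 2"
proof -
  have "\<forall>C\<in>set \<phi>. negative C" by (rule Gamma_negative[OF assms(1)])
  then have "count_list (formula_code \<phi>) (Mark 2) = length (concat \<phi>)"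
    using words_formula by (metis length_map length_words)
  also have "\<dots> \<le> 2 * length \<phi>"
  proof -
    \<comment> \<open>Here the clause width enters: at most \<open>2 ^ (m + 1)\<close> occurrences,
      a number with at most \<open>m + 2\<close> binary digits.\<close>
    have "\<forall>C\<in>set \<phi>. length C \<le> 2" using assms(1) by (auto simp: Gamma_neg_1_2_def)
    then show ?thesis by (induction \<phi>) auto
  qed
  also have "\<dots> \<le> 2 * 2 ^ m" using assms(2) by (simp add: clause_count_def)
  also have "\<dots> < 2 ^ (m + 2)" by simp
  finally show ?thesis unfolding pointer_length_def by (intro floorlog_leI) simp_all
qed

definition query_bound :: "nat \<Rightarrow> nat" where
  "query_bound n = (n + 2) * floorlog 2 (n + 2)"

text \<open>Pointers are read only if \<open>2 ^ (k - 1) \<le> h\<close>, which makes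
  \<open>k\<close> at most the binary length of \<open>h\<close>. This is the origin of the
  logarithmic factor.\<close>

lemma query_bound_le:
  assumes "h \<le> n + 2" "k = 0 \<or> 2 ^ (k - 1) \<le> h"
  shows "k * h \<le> query_bound n"
proof (cases "k = 0")
  case False
  then have "Suc (k - 1) \<le> floorlog 2 h" using assms(2) by (intro floorlog_ge_SucI) simp_all
  also have "\<dots> \<le> floorlog 2 (n + 2)" using assms(1) by (rule floorlog_mono)
  finally have "k \<le> floorlog 2 (n + 2)" using False by simp
  then have "k * h \<le> floorlog 2 (n + 2) * (n + 2)" using assms(1) by (rule mult_le_mono)
  then show ?thesis by (simp add: query_bound_def mult.commute)
qed simp

lemma query_bound_bigo: "(\<lambda>n. real (query_bound n)) \<in> O(\<lambda>n. real n * log 2 (real n))"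
\<comment> \<open>For \<open>n \<ge> 4\<close> each factor at most doubles:
  \<open>n + 2 \<le> 2 * n\<close>, and the binary length of \<open>n + 2\<close> is at most
  \<open>2 + log 2 n \<le> 2 * log 2 n\<close>.\<close>
proof (rule bigoI[where c = 4])
  show "\<forall>\<^sub>F n in sequentially. norm (real (query_bound n)) \<le> 4 * norm (real n * log 2 (real n))"
    using eventually_ge_at_top[of 4]
  proof eventually_elim
    case (elim n)
    have "log 2 (2 ^ 2) \<le> log 2 (real n)" using elim by (intro log_mono) simp_all
    then have l: "2 \<le> log 2 (real n)" by (simp only: log_pow_cancel)
    have "real (floorlog 2 (n + 2)) \<le> log 2 (real (n + 2)) + 1"
    proof -
      have "0 \<le> \<lfloor>log 2 (real (n + 2))\<rfloor>" by simp
      then have "real (floorlog 2 (n + 2)) = real_of_int \<lfloor>log 2 (real (n + 2))\<rfloor> + 1"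
        by (simp add: floorlog_def)
      then show ?thesis by linarith
    qed
    also have "log 2 (real (n + 2)) \<le> log 2 (2 * real n)" using elim by (intro log_mono) simp_all
    also have "log 2 (2 * real n) = 1 + log 2 (real n)" using elim by (simp add: log_mult)
    finally have "real (floorlog 2 (n + 2)) \<le> 2 * log 2 (real n)" using l by linarith
    moreover have "real (n + 2) \<le> 2 * real n" using elim by simp
    ultimately have "real (n + 2) * real (floorlog 2 (n + 2)) \<le> (2 * real n) * (2 * log 2 (real n))"
      by (intro mult_mono) simp_all
    then show ?case using l
      by (simp only: query_bound_def of_nat_mult real_norm_def abs_mult abs_of_nat)
  qed
qed

lemma queries_at_most_mono: "queries_at_most V \<sigma> w b \<Longrightarrow> b \<le> b' \<Longrightarrow> queries_at_most V \<sigma> w b'"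
  unfolding queries_at_most_def by (meson order_trans)

theorem theorem3:
  fixes m :: "cnf \<times> nat \<Rightarrow> nat"
  assumes "\<And>\<phi> k. (\<phi>, k) \<in> instances (WSAT Gamma_neg_1_2) \<Longrightarrow>
             max (var_count \<phi>) (clause_count \<phi>) \<le> 2 ^ m (\<phi>, k)"
  shows "WSAT Gamma_neg_1_2 \<in>
           p_PCP m (\<lambda>n. real n * log 2 (real n)) (\<lambda>n. real n * log 2 (real n))"
proof -
  let ?Q = "WSAT Gamma_neg_1_2" and ?r = "\<lambda>n. real n * log 2 (real n)"
  have inst: "(\<phi>, k) \<in> instances ?Q \<longleftrightarrow> \<phi> \<in> Gamma_neg_1_2 \<and> 0 < k" for \<phi> k
    by (simp add: WSAT_def)
  have enc: "encode ?Q = encode_instance" by (simp add: WSAT_def)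
  have yes: "(\<phi>, k) \<in> yes_instances ?Q \<longleftrightarrow> \<phi> \<in> Gamma_neg_1_2 \<and> 0 < k \<and> (\<exists>\<alpha>. satisfies \<alpha> \<phi> \<and> weight \<phi> \<alpha> = k)" for \<phi> k
    by (simp add: WSAT_def)
  have sub: "set (encode_instance (\<phi>, k)) \<subseteq> solver_alphabet" if "\<phi> \<in> Gamma_neg_1_2" for \<phi> k
    using set_formula_code[OF Gamma_negative[OF that]]
    by (fastforce simp: encode_instance_formula_code is_bit_iff simp del: encode_instance.simps)
  have time: "fpt_time verifier ?Q"
    unfolding fpt_time_def
  proof (intro exI conjI ballI)
    show "computable time_factor" by (rule computable_time_factor)
    fix I assume "I \<in> instances ?Q"
    then obtain \<phi> k where I: "I = (\<phi>, k)" "\<phi> \<in> Gamma_neg_1_2" using inst by (cases I) auto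
    have "halts_within verifier \<sigma> (encode_instance (\<phi>, k)) (time_factor k * length (encode_instance (\<phi>, k)) ^ 3)" for \<sigma>
      using verifier_run[OF Gamma_negative[OF I(2)], of k \<sigma>] by blast
    then show "case I of (x, k) \<Rightarrow> \<forall>\<sigma>. halts_within verifier \<sigma> (encode ?Q (x, k))
      (time_factor k * length (encode ?Q (x, k)) ^ 3)"
      unfolding I enc by simp
  qed
  have "p_pcp_verifier verifier ?Q"
    unfolding p_pcp_verifier_def
  proof (intro conjI ballI impI allI)
    show "turing_machine verifier" by (rule turing_machine_verifier)
    show "fpt_time verifier ?Q" by (rule time)
  next
    fix I assume "I \<in> instances ?Q"
    then obtain \<phi> k where I: "I = (\<phi>, k)" "\<phi> \<in> Gamma_neg_1_2" using inst by (cases I) auto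
    show "set (encode ?Q I) \<subseteq> alphabet verifier"
      using sub[OF I(2), of k] unfolding I enc verifier_def by simp
  next
    fix I assume "I \<in> instances ?Q" "I \<in> yes_instances ?Q"
    then obtain \<phi> k \<alpha> where I: "I = (\<phi>, k)" "\<phi> \<in> Gamma_neg_1_2" "satisfies \<alpha> \<phi>" "weight \<phi> \<alpha> = k"
      using yes by (cases I) auto
    obtain \<sigma> where "\<forall>a. accepts a \<sigma> \<phi> k"
      using accepts_complete[OF Gamma_negative[OF I(2)] I(3,4)] by blast
    then have "accept_prob verifier \<sigma> (encode_instance (\<phi>, k)) = 1"
      using verifier_run[OF Gamma_negative[OF I(2)], of k \<sigma>] by auto
    then show "\<exists>\<sigma>. accept_prob verifier \<sigma> (encode ?Q I) = 1" unfolding I(1) enc by blast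
  next
    fix I \<sigma> assume "I \<in> instances ?Q" "I \<notin> yes_instances ?Q"
    then obtain \<phi> k where I: "I = (\<phi>, k)" "\<phi> \<in> Gamma_neg_1_2" "\<nexists>\<alpha>. satisfies \<alpha> \<phi> \<and> weight \<phi> \<alpha> = k"
      using inst yes by (cases I) auto
    have "\<not> accepts a \<sigma> \<phi> k" for a using accepts_sound[OF Gamma_negative[OF I(2)]] I(3) by blast
    then have "accept_prob verifier \<sigma> (encode_instance (\<phi>, k)) = 0"
      using verifier_run[OF Gamma_negative[OF I(2)], of k \<sigma>] by auto
    then show "accept_prob verifier \<sigma> (encode ?Q I) \<le> 1 / 2" unfolding I(1) enc by simp
  qed
  moreover have "restricted m ?r ?r verifier ?Q"
    unfolding restricted_def
  proof (intro exI conjI ballI allI)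
    show "(\<lambda>n. real ((\<lambda>_. 0) n)) \<in> O(?r)" by simp
    show "(\<lambda>n. real (query_bound n)) \<in> O(?r)" by (rule query_bound_bigo)
    fix I \<sigma> assume I_inst: "I \<in> instances ?Q"
    then obtain \<phi> k where I: "I = (\<phi>, k)" "\<phi> \<in> Gamma_neg_1_2" using inst by (cases I) auto
    have "clause_count \<phi> \<le> 2 ^ m I" using assms[of \<phi> k] I_inst I(1) by simp
    then have h: "pointer_length \<phi> \<le> m I + 2" by (rule pointer_length_bound[OF I(2)])
    obtain a where a: "a \<longrightarrow> k = 0 \<or> 2 ^ (k - 1) \<le> pointer_length \<phi>"
      "tosses_at_most verifier \<sigma> (encode ?Q I) 0"
      "queries_at_most verifier \<sigma> (encode ?Q I) (if a then k * pointer_length \<phi> else 0)"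
      using verifier_run[OF Gamma_negative[OF I(2)], of k \<sigma>] unfolding I(1) enc by blast
    show "tosses_at_most verifier \<sigma> (encode ?Q I) ((\<lambda>_. 0) (m I))" using a(2) by simp
    show "queries_at_most verifier \<sigma> (encode ?Q I) (query_bound (m I))"
      by (rule queries_at_most_mono[OF a(3)]) (use a(1) query_bound_le[OF h] in auto)
  qed
  ultimately show ?thesis by (auto simp: p_PCP_def)
qed

end
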